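(* Let $k\ge1$ and let $T(\widetilde A)$ be a partially symmetric, bounded, positive invertible operator on $l^2_{2k}$ generated by $\widetilde A\in L^\infty_{2k\times 2k}$. For $n\in\mathbb N$ let $d_1^{(n)}\le\cdots\le d_{nk}^{(n)}$ be the symplectic eigenvalues of $T_n(\widetilde A)$, and let $\mathfrak m_{\widetilde A}=\operatorname{ess\,inf}_{\theta\in[-\pi,\pi]}d_1(\widetilde A(\theta))$. Then for each $m\in\mathbb N$, $$\lim_{n\to\infty}d_m^{(n)}=\mathfrak m_{\widetilde A}$$ (where $d_m^{(n)}$ is defined as soon as $nk\ge m$). Consequently $$\overline{\bigcup_{n\in\mathbb N}W_s(T_n(\widetilde A))}=\overline{W_s(\widetilde A)} .$$
   Context: $L^\infty_{2k\times 2k}$ is the set of measurable functions $\widetilde A$ from $[-\pi,\pi]$ to the complex $2k\times 2k$ matrices with essentially bounded entries and $\widetilde A(-\pi)=\widetilde A(\pi)$. The Fourier coefficients of $\widetilde A$ are $A_n=\frac1{2\pi}\int_{-\pi}^{\pi}\widetilde A(\theta)e^{-\imath n\theta}d\theta$, $n\in\mathbb Z$. $l^2_{2k}$ is the Hilbert space of square summable sequences $(x_0,x_1,\dots)$ with $x_i\in\mathbb C^{2k}$. $T(\widetilde A)=[A_{i-j}]_{i,j=0}^\infty$ is the block Toeplitz operator on $l^2_{2k}$ generated by $\widetilde A$, and $T_n(\widetilde A)=[A_{i-j}]_{i,j=0}^{n-1}$. $T(\widetilde A)$ is partially symmetric if every $A_n$ is real and $A_{-n}=A_n$ for all $n\in\mathbb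 N$. An operator $T$ is positive invertible if it is Hermitian, $\langle x,Tx\rangle>0$ for all $x\neq0$, and $T$ is invertible (with bounded inverse). The essential range $\mathcal R(\widetilde A)$ is the set of matrices $B$ such that $\{t:\|\widetilde A(t)-B\|<\epsilon\}$ has positive Lebesgue measure for every $\epsilon>0$. Under these hypotheses $T_n(\widetilde A)$ is real positive definite for every $n$, every matrix in $\mathcal R(\widetilde A)$ is real positive definite, and hence $\widetilde A(\theta)$ is real positive definite for almost every $\theta$. Let $J_2=\begin{bmatrix}0&1\\-1&0\end{bmatrix}$ and $J_{2m}=J_2\oplus\cdots\oplus J_2$ ($m$ times). A real $2m\times 2m$ matrix $M$ is symplectic if $M^TJ_{2m}M=J_{2m}$. By Williamson's theorem, for every real positive definite $2m\times 2m$ matrix $B$ there is a symplectic $M$ with $MBM^T=d_1(B)I_2\oplus\cdots\oplus d_m(B)I_2$, where $0<d_1(B)\le\cdots\le d_m(B)$ are uniquely determined by $B$ (the symplectic eigenvalues of $B$). Symplectic numerical ranges: for a real positive definite $2m\times2m$ matrix $B$, $W_s(B)=\{\frac12(\langle u,Bu\rangle+\langle v,Bv\rangle):u,v\in\mathbb R^{2m},\ \langle u,J_{2m}v\rangle=1\}$. For $\widetilde A$ with all matrices in $\mathcal R(\widetilde A)$ real positive definite, $$W_s(\widetilde A)=\left\{\frac1{2\pi}\int_{-\pi}^{\pi}\frac{\langle\widetilde u(\theta),\widetilde A(\theta)\widetilde u(\theta)\rangle+\langle\widetilde v(\theta),\widetilde A(\theta)\widetilde v(\theta)\rangle}{2}d\theta:\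 \frac1{2\pi}\int_{-\pi}^{\pi}\langle\widetilde u(\theta),J_{2k}\widetilde v(\theta)\rangle d\theta=1,\ \widetilde u,\widetilde v\in L^2_{2k}\right\},$$ where $L^2_{2k}$ is the space of square integrable functions $[-\pi,\pi]\to\mathbb C^{2k}$ (with equal values at $\pm\pi$) and $\langle x,y\rangle=\sum_i\overline{x_i}y_i$. *)

theory Defs
  imports "HOL-Analysis.Analysis" "Jordan_Normal_Form.Matrix"
begin

definition J2 :: "real mat" where
  "J2 = mat_of_rows_list 2 [[0, 1], [-1, 0]]"

text \<open>Here \<open>m\<close> is half the size of the matrix, as in the other notions indexed by \<open>m\<close> or \<open>k\<close>;
  in those indexed by \<open>d\<close>, \<open>d\<close> is the full size of a block.\<close>

definition symp_J :: "nat \<Rightarrow> real mat" where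
  "symp_J m = diag_block_mat (replicate m J2)"

definition symplectic :: "nat \<Rightarrow> real mat \<Rightarrow> bool" where
  "symplectic m M \<longleftrightarrow>
     M \<in> carrier_mat (2 * m) (2 * m) \<and> Matrix.transpose_mat M * symp_J m * M = symp_J m"

text \<open>The list of the symplectic eigenvalues of a real positive definite matrix of size \<open>2m\<close>,
  in increasing order.  It exists and is unique for such a matrix by Williamson's theorem; no
  value is intended for other matrices.\<close>

definition symp_spectrum :: "nat \<Rightarrow> real mat \<Rightarrow> real list" where
  "symp_spectrum m B =
     (THE ds. length ds = m \<and> sorted ds \<and> (\<forall>d \<in> set ds. 0 < d) \<and>
        (\<exists>M. symplectic m M \<and>
           M * B * Matrix.transpose_mat M = diag_block_mat (map (\<lambda>d. d \<cdot>\<^sub>m 1\<^sub>m 2) ds)))"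

text \<open>The \<open>j\<close>-th symplectic eigenvalue, numbered from 1; meaningful for \<open>1 \<le> j \<le> m\<close>.\<close>

definition symp_eig :: "nat \<Rightarrow> real mat \<Rightarrow> nat \<Rightarrow> real" where
  "symp_eig m B j = symp_spectrum m B ! (j - 1)"

definition symp_num_range :: "nat \<Rightarrow> real mat \<Rightarrow> real set" where
  "symp_num_range m B =
     {(scalar_prod u (B *\<^sub>v u) + scalar_prod v (B *\<^sub>v v)) / 2 | u v.
        u \<in> carrier_vec (2 * m) \<and> v \<in> carrier_vec (2 * m) \<and>
        scalar_prod u (symp_J m *\<^sub>v v) = 1}"

text \<open>The inner product is conjugate linear in the first argument, whereas the library's
  product \<open>v \<bullet>c w\<close> is conjugate linear in the second one.\<close>

definition cip :: "complex vec \<Rightarrow> complex vec \<Rightarrow> complex" where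
  "cip x y = y \<bullet>c x"

definition vec_norm2 :: "complex vec \<Rightarrow> real" where
  "vec_norm2 v = (\<Sum>i<dim_vec v. (cmod (vec_index v i))\<^sup>2)"

definition l2 :: "nat \<Rightarrow> (nat \<Rightarrow> complex vec) set" where
  "l2 d = {x. (\<forall>i. x i \<in> carrier_vec d) \<and> summable (\<lambda>i. vec_norm2 (x i))}"

definition l2_inner :: "(nat \<Rightarrow> complex vec) \<Rightarrow> (nat \<Rightarrow> complex vec) \<Rightarrow> complex" where
  "l2_inner x y = (\<Sum>i. cip (x i) (y i))"

definition l2_norm :: "(nat \<Rightarrow> complex vec) \<Rightarrow> real" where
  "l2_norm x = sqrt (\<Sum>i. vec_norm2 (x i))"

definition bounded_op :: "nat \<Rightarrow> ((nat \<Rightarrow> complex vec) \<Rightarrow> nat \<Rightarrow> complex vec) \<Rightarrow> bool" where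
  "bounded_op d T \<longleftrightarrow>
     (\<forall>x \<in> l2 d. T x \<in> l2 d) \<and>
     (\<forall>x \<in> l2 d. \<forall>y \<in> l2 d. T (\<lambda>i. x i + y i) = (\<lambda>i. T x i + T y i)) \<and>
     (\<forall>c. \<forall>x \<in> l2 d. T (\<lambda>i. c \<cdot>\<^sub>v x i) = (\<lambda>i. c \<cdot>\<^sub>v T x i)) \<and>
     (\<exists>C. \<forall>x \<in> l2 d. l2_norm (T x) \<le> C * l2_norm x)"

text \<open>The order on the complex numbers is the one in which \<open>0 < z\<close> says that \<open>z\<close> is real and
  positive.\<close>

definition positive_invertible ::
    "nat \<Rightarrow> ((nat \<Rightarrow> complex vec) \<Rightarrow> nat \<Rightarrow> complex vec) \<Rightarrow> bool" where
  "positive_invertible d T \<longleftrightarrow>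
     (\<forall>x \<in> l2 d. \<forall>y \<in> l2 d. l2_inner x (T y) = l2_inner (T x) y) \<and>
     (\<forall>x \<in> l2 d. x \<noteq> (\<lambda>i. 0\<^sub>v d) \<longrightarrow> 0 < l2_inner x (T x)) \<and>
     (\<exists>S. bounded_op d S \<and> (\<forall>x \<in> l2 d. S (T x) = x \<and> T (S x) = x))"

abbreviation circ :: "real measure" where
  "circ \<equiv> lebesgue_on {- pi..pi}"

definition Linf :: "nat \<Rightarrow> (real \<Rightarrow> complex mat) set" where
  "Linf d = {A.
     (\<forall>\<theta> \<in> {- pi..pi}. A \<theta> \<in> carrier_mat d d) \<and>
     (\<forall>r < d. \<forall>s < d. (\<lambda>\<theta>. A \<theta> $$ (r, s)) \<in> borel_measurable circ) \<and>
     (\<forall>r < d. \<forall>s < d. \<exists>C. AE \<theta> in circ. cmod (A \<theta> $$ (r, s)) \<le> C) \<and>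
     A (- pi) = A pi}"

definition L2 :: "nat \<Rightarrow> (real \<Rightarrow> complex vec) set" where
  "L2 d = {u.
     (\<forall>\<theta> \<in> {- pi..pi}. u \<theta> \<in> carrier_vec d) \<and>
     (\<forall>r < d. (\<lambda>\<theta>. vec_index (u \<theta>) r) \<in> borel_measurable circ) \<and>
     integrable circ (\<lambda>\<theta>. vec_norm2 (u \<theta>)) \<and>
     u (- pi) = u pi}"

definition fourier_coeff :: "nat \<Rightarrow> (real \<Rightarrow> complex mat) \<Rightarrow> int \<Rightarrow> complex mat" where
  "fourier_coeff d A n =
     Matrix.mat d d (\<lambda>(r, s).
       complex_of_real (1 / (2 * pi)) *
       (LINT \<theta>|circ. A \<theta> $$ (r, s) * exp (- \<i> * of_int n * of_real \<theta>)))"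

definition partially_symmetric :: "nat \<Rightarrow> (real \<Rightarrow> complex mat) \<Rightarrow> bool" where
  "partially_symmetric d A \<longleftrightarrow>
     (\<forall>n. \<forall>r < d. \<forall>s < d. fourier_coeff d A n $$ (r, s) \<in> \<real>) \<and>
     (\<forall>n::nat. fourier_coeff d A (- int n) = fourier_coeff d A (int n))"

text \<open>The block Toeplitz operator, acting on sequences of vectors of length \<open>d\<close>; the series
  defining its rows is taken coordinatewise.\<close>

definition toeplitz_op ::
    "nat \<Rightarrow> (real \<Rightarrow> complex mat) \<Rightarrow> (nat \<Rightarrow> complex vec) \<Rightarrow> nat \<Rightarrow> complex vec" where
  "toeplitz_op d A x =
     (\<lambda>i. Matrix.vec d (\<lambda>r. \<Sum>j. vec_index (fourier_coeff d A (int i - int j) *\<^sub>v x j) r))"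

definition toeplitz_trunc :: "nat \<Rightarrow> nat \<Rightarrow> (real \<Rightarrow> complex mat) \<Rightarrow> complex mat" where
  "toeplitz_trunc d n A =
     Matrix.mat (n * d) (n * d) (\<lambda>(p, q).
       fourier_coeff d A (int (p div d) - int (q div d)) $$ (p mod d, q mod d))"

text \<open>Intended only for matrices all of whose entries are real.\<close>

abbreviation real_mat :: "complex mat \<Rightarrow> real mat" where
  "real_mat \<equiv> map_mat Re"

definition ess_inf :: "'a measure \<Rightarrow> ('a \<Rightarrow> real) \<Rightarrow> real" where
  "ess_inf M f = Sup {c. AE x in M. c \<le> f x}"

text \<open>The numerical range of a symbol with block size \<open>2k\<close>.  Its elements are written as
  complex integrals; they are real whenever \<open>A \<theta>\<close> is Hermitian for almost all \<open>\<theta>\<close>.\<close>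

definition symbol_symp_num_range :: "nat \<Rightarrow> (real \<Rightarrow> complex mat) \<Rightarrow> complex set" where
  "symbol_symp_num_range k A =
     {complex_of_real (1 / (2 * pi)) *
        (LINT \<theta>|circ. (cip (u \<theta>) (A \<theta> *\<^sub>v u \<theta>) + cip (v \<theta>) (A \<theta> *\<^sub>v v \<theta>)) / 2) | u v.
        u \<in> L2 (2 * k) \<and> v \<in> L2 (2 * k) \<and>
        complex_of_real (1 / (2 * pi)) *
          (LINT \<theta>|circ. cip (u \<theta>) (map_mat complex_of_real (symp_J k) *\<^sub>v v \<theta>)) = 1}"

end

(* With z = x + i y one has z^* (B + i c J) z = <x,Bx> + <y,By> - 2 c <x,Jy>, and in Williamson
   coordinates the Hermitian matrix B + i c J splits into 2x2 blocks with eigenvalues d_j + c and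
   d_j - c. Hence, for c >= 0, d_j(B) < c iff B + i c J is negative definite on some j-dimensional
   complex subspace. The truncation T_n(A) + i c J is the n-th block Toeplitz matrix of the symbol
   A + i c J, and a bounded symbol is positive semidefinite almost everywhere iff all its block
   Toeplitz matrices are. So the essential infimum of d_1(A(theta)) is inf_n d_1^(n). If a vector
   is negative for some T_n(A) + i c J, then copies of it shifted far apart span a negative
   definite space of any prescribed dimension, because the Fourier coefficients tend to 0; hence
   every d_m^(n) eventually drops below c. *)

theory Submission
  imports Defs "Jordan_Normal_Form.Determinant"
begin

subsection \<open>Block forms and homogeneous linear systems\<close>

text \<open>\<open>symp_spectrum\<close> is a definite description, so Williamson's theorem is
  needed with existence and uniqueness. Existence is variational: minimising pairs are chosen one
  after another in symplectic complements. Uniqueness is a by-product of the inertia criterion,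
  which fixes every threshold of the spectrum without mentioning the symplectic matrix. The delicate
  half of the Toeplitz criterion is the passage from forms to almost every point. Coefficients of a
  scalar polynomial p attached to one fixed vector produce the weight |p|^2, and such weights
  approximate all nonnegative continuous functions on the circle. The same criterion for scalar
  symbols shows that Fourier coefficients determine a symbol, whence the symbol is real and
  symmetric almost everywhere. Positive invertibility enters as a lower bound \<delta> common to all
  truncations; without such a margin only semidefiniteness would pass to the symbol. For the
  numerical ranges, every real number above the essential infimum lies in some range of a
  truncation, and no point of the range of the symbol lies below it, so both closures are the same
  half-line.\<close>

definition Jf :: "nat \<Rightarrow> nat \<Rightarrow> real" where
  "Jf i j = (if even i \<and> j = Suc i then 1 else if odd i \<and> i = Suc j then - 1 else 0)"

text \<open>Bilinear over any commutative ring: the conjugate of a Hermitian form is placed on the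
  argument where it is used, so real and complex computations share one set of rules. Vectors are
  functions on \<open>nat\<close> of which only the values below \<open>n\<close> count, so a single
  \<open>Jf\<close> serves all sizes.\<close>

definition sform :: "nat \<Rightarrow> (nat \<Rightarrow> nat \<Rightarrow> 'a) \<Rightarrow> (nat \<Rightarrow> 'a) \<Rightarrow> (nat \<Rightarrow> 'a) \<Rightarrow> 'a::comm_ring_1" where
  "sform n F x y = (\<Sum>i<n. \<Sum>j<n. F i j * x i * y j)"

lemma Jf_skew: "Jf j i = - Jf i j"
  by (auto simp: Jf_def)

lemma diag_block_mat_2x2:
  assumes "\<And>X. X \<in> set Xs \<Longrightarrow> X \<in> carrier_mat 2 2"
  shows "diag_block_mat Xs \<in> carrier_mat (2 * length Xs) (2 * length Xs) \<and>
    (\<forall>i<2 * length Xs. \<forall>j<2 * length Xs. diag_block_mat Xs $$ (i, j) =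
       (if i div 2 = j div 2 then Xs ! (i div 2) $$ (i mod 2, j mod 2) else 0))"
  using assms
proof (induction Xs)
  case Nil
  then show ?case by auto
next
  case (Cons X Xs)
  let ?D = "diag_block_mat Xs"
  have X: "X \<in> carrier_mat 2 2" and D: "?D \<in> carrier_mat (2 * length Xs) (2 * length Xs)"
    using Cons by auto
  have eq: "diag_block_mat (X # Xs) = four_block_mat X (0\<^sub>m 2 (2 * length Xs)) (0\<^sub>m (2 * length Xs) 2) ?D"
    using X D by (simp add: Let_def)
  have car: "diag_block_mat (X # Xs) \<in> carrier_mat (2 * length (X # Xs)) (2 * length (X # Xs))"
    unfolding eq using four_block_carrier_mat[OF X D] by simp
  have ent: "diag_block_mat (X # Xs) $$ (i, j) =
       (if i div 2 = j div 2 then (X # Xs) ! (i div 2) $$ (i mod 2, j mod 2) else 0)"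
    if i: "i < 2 * length (X # Xs)" and j: "j < 2 * length (X # Xs)" for i j
  proof -
    have IH: "?D $$ (i - 2, j - 2) = (if (i - 2) div 2 = (j - 2) div 2
        then Xs ! ((i - 2) div 2) $$ ((i - 2) mod 2, (j - 2) mod 2) else 0)"
      if "i \<ge> 2" "j \<ge> 2"
      using Cons i j that by auto
    have red: "a div 2 = Suc ((a - 2) div 2) \<and> a mod 2 = (a - 2) mod 2" if "a \<ge> 2" for a :: nat
      using that by (auto simp: le_iff_add)
    have "diag_block_mat (X # Xs) $$ (i, j) = (if i < 2 then if j < 2 then X $$ (i, j) else 0
       else if j < 2 then 0 else ?D $$ (i - 2, j - 2))"
      unfolding eq using X D i j by (subst index_mat_four_block) auto
    then show ?thesis
      using IH red[of i] red[of j] by (auto simp: not_less)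
  qed
  from car ent show ?case by blast
qed

lemma symp_J_carrier: "symp_J m \<in> carrier_mat (2 * m) (2 * m)"
  and symp_J_index: "i < 2 * m \<Longrightarrow> j < 2 * m \<Longrightarrow> symp_J m $$ (i, j) = Jf i j"
proof -
  have J2: "J2 \<in> carrier_mat 2 2" unfolding J2_def mat_of_rows_list_def by (auto simp: numeral_2_eq_2)
  note * = diag_block_mat_2x2[of "replicate m J2"]
  show "symp_J m \<in> carrier_mat (2 * m) (2 * m)"
    unfolding symp_J_def using * J2 by simp
  have J2e: "J2 $$ (a, b) = (if a = b then 0 else if a = 0 then 1 else -1)" if "a < 2" "b < 2" for a b
    using that unfolding J2_def mat_of_rows_list_def by (auto simp: less_2_cases_iff)
  assume ij: "i < 2 * m" "j < 2 * m"
  then have "symp_J m $$ (i, j) = (if i div 2 = j div 2 then J2 $$ (i mod 2, j mod 2) else 0)"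
    unfolding symp_J_def using * J2 by simp
  also have "\<dots> = Jf i j"
  proof -
    have "even i \<and> j = Suc i \<longleftrightarrow> i div 2 = j div 2 \<and> i mod 2 = 0 \<and> j mod 2 = 1"
      and "odd i \<and> i = Suc j \<longleftrightarrow> i div 2 = j div 2 \<and> i mod 2 = 1 \<and> j mod 2 = 0"
      by presburger+
    then show ?thesis
      unfolding Jf_def using J2e[of "i mod 2" "j mod 2"] not_mod_2_eq_1_eq_0[of i] not_mod_2_eq_1_eq_0[of j]
      by (cases "i div 2 = j div 2"; cases "i mod 2 = 0"; cases "j mod 2 = 0") (simp_all only:, simp_all)
  qed
  finally show "symp_J m $$ (i, j) = Jf i j" .
qed

lemma symp_diag_carrier:
    "diag_block_mat (map (\<lambda>d. d \<cdot>\<^sub>m (1\<^sub>m 2 :: real mat)) ds) \<in> carrier_mat (2 * length ds) (2 * length ds)"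
    (is "diag_block_mat ?Xs \<in> _")
  and symp_diag_index: "i < 2 * length ds \<Longrightarrow> j < 2 * length ds \<Longrightarrow>
    diag_block_mat (map (\<lambda>d. d \<cdot>\<^sub>m (1\<^sub>m 2 :: real mat)) ds) $$ (i, j) = (if i = j then ds ! (i div 2) else 0)"
proof -
  have *: "diag_block_mat ?Xs \<in> carrier_mat (2 * length ?Xs) (2 * length ?Xs) \<and>
    (\<forall>i<2 * length ?Xs. \<forall>j<2 * length ?Xs. diag_block_mat ?Xs $$ (i, j) =
       (if i div 2 = j div 2 then ?Xs ! (i div 2) $$ (i mod 2, j mod 2) else 0))"
    by (rule diag_block_mat_2x2) auto
  then show "diag_block_mat ?Xs \<in> carrier_mat (2 * length ds) (2 * length ds)"
    by simp
  assume ij: "i < 2 * length ds" "j < 2 * length ds"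
  with * have "diag_block_mat ?Xs $$ (i, j) = (if i div 2 = j div 2 then ?Xs ! (i div 2) $$ (i mod 2, j mod 2) else 0)"
    by simp
  also have "\<dots> = (if i = j then ds ! (i div 2) else 0)"
  proof (cases "i div 2 = j div 2")
    case True
    then have "i = j \<longleftrightarrow> i mod 2 = j mod 2"
      by (metis div_mult_mod_eq)
    moreover have "j div 2 < length ds" using ij by auto
    ultimately show ?thesis using True by simp
  qed auto
  finally show "diag_block_mat ?Xs $$ (i, j) = (if i = j then ds ! (i div 2) else 0)" .
qed

lemma sform_swap: "(\<And>i j. i < n \<Longrightarrow> j < n \<Longrightarrow> F i j = G j i) \<Longrightarrow> sform n F x y = sform n G y x"
  unfolding sform_def by (subst sum.swap) (auto intro!: sum.cong simp: ac_simps)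

lemma sform_add_left: "sform n F (\<lambda>p. x p + y p) z = sform n F x z + sform n F y z"
  and sform_add_right: "sform n F z (\<lambda>p. x p + y p) = sform n F z x + sform n F z y"
  and sform_diff_left: "sform n F (\<lambda>p. x p - y p) z = sform n F x z - sform n F y z"
  and sform_diff_right: "sform n F z (\<lambda>p. x p - y p) = sform n F z x - sform n F z y"
  unfolding sform_def
  by (simp_all add: distrib_left distrib_right left_diff_distrib right_diff_distrib sum.distrib sum_subtractf)

lemma sform_scale_left: "sform n F (\<lambda>p. a * x p) z = a * sform n F x z"
  and sform_scale_right: "sform n F z (\<lambda>p. a * x p) = a * sform n F z x"
  unfolding sform_def
  by (simp_all add: sum_distrib_left mult_ac)

lemma sform_zero [simp]: "sform n F (\<lambda>p. 0) z = 0" "sform n F z (\<lambda>p. 0) = 0"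
  by (simp_all add: sform_def)

lemma sform_sum_left: "sform n F (\<lambda>p. \<Sum>i\<in>I. a i * X i p) y = (\<Sum>i\<in>I. a i * sform n F (X i) y)"
  and sform_sum_right: "sform n F y (\<lambda>p. \<Sum>i\<in>I. a i * X i p) = (\<Sum>i\<in>I. a i * sform n F y (X i))"
  by (induction I rule: infinite_finite_induct)
    (simp_all add: sform_add_left sform_scale_left sform_add_right sform_scale_right)

lemma sform_cong:
  "(\<And>i j. i < n \<Longrightarrow> j < n \<Longrightarrow> F i j = G i j) \<Longrightarrow> (\<And>i. i < n \<Longrightarrow> x i = x' i) \<Longrightarrow> (\<And>i. i < n \<Longrightarrow> y i = y' i)
   \<Longrightarrow> sform n F x y = sform n G x' y'"
  unfolding sform_def by (auto intro!: sum.cong)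

text \<open>Gaussian elimination by induction on the number of equations: the last one is solved for
  a pivot unknown \<open>p\<close>, which is then substituted into the others. The map
  \<open>s\<close> enumerates the indices different from \<open>p\<close>.\<close>

lemma homogeneous_system_nontrivial:
  fixes L :: "nat \<Rightarrow> nat \<Rightarrow> 'a :: field"
  assumes "r < n"
  shows "\<exists>x. (\<exists>i<n. x i \<noteq> 0) \<and> (\<forall>k<r. (\<Sum>i<n. L k i * x i) = 0)"
  using assms
proof (induction r arbitrary: n L)
  case 0
  then show ?case by (intro exI[of _ "\<lambda>i. 1"]) auto
next
  case (Suc r)
  show ?case
  proof (cases "\<forall>i<n. L r i = 0")
    case True
    from Suc.IH[of n L] Suc.prems obtain x where
      "\<exists>i<n. x i \<noteq> 0" "\<forall>k<r. (\<Sum>i<n. L k i * x i) = 0" by auto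
    with True show ?thesis by (intro exI[of _ x]) (auto simp: less_Suc_eq)
  next
    case False
    then obtain p where p: "p < n" "L r p \<noteq> 0" by auto
    define s where "s = (\<lambda>i. if i < p then i else Suc i)"
    define q where "q = (\<lambda>i. L r i / L r p)"
    from Suc.prems have "r < n - 1" by simp
    from Suc.IH[OF this, of "\<lambda>k i. L k (s i) - L k p * q (s i)"] obtain y where
      y: "\<exists>i<n - 1. y i \<noteq> 0" and y0: "\<And>k. k < r \<Longrightarrow> (\<Sum>i<n - 1. (L k (s i) - L k p * q (s i)) * y i) = 0" by auto
    have bij: "bij_betw s {..<n - 1} ({..<n} - {p})"
      unfolding s_def using p(1)
      by (intro bij_betwI[where g = "\<lambda>i. if i < p then i else i - 1"]) (auto split: if_splits)
    define x where "x = (\<lambda>i. if i = p then - (\<Sum>i<n - 1. q (s i) * y i) else y (the_inv_into {..<n - 1} s i))"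
    have xs: "x (s i) = y i" if "i < n - 1" for i
    proof -
      have "s i \<noteq> p" by (auto simp: s_def)
      moreover have "the_inv_into {..<n - 1} s (s i) = i"
        using bij that by (intro the_inv_into_f_f) (auto simp: bij_betw_def)
      ultimately show ?thesis by (simp add: x_def)
    qed
    have sum_eq: "(\<Sum>i<n. L k i * x i) = L k p * x p + (\<Sum>i<n - 1. L k (s i) * y i)" for k
    proof -
      have "(\<Sum>i<n. L k i * x i) = L k p * x p + (\<Sum>i\<in>{..<n} - {p}. L k i * x i)"
        using p(1) by (subst sum.remove[of _ p]) auto
      also have "(\<Sum>i\<in>{..<n} - {p}. L k i * x i) = (\<Sum>i<n - 1. L k (s i) * x (s i))"
        by (rule sum.reindex_bij_betw[OF bij, symmetric])
      finally show ?thesis using xs by simp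
    qed
    have xp: "x p = - (\<Sum>i<n - 1. q (s i) * y i)" by (simp add: x_def)
    have "(\<Sum>i<n. L k i * x i) = (\<Sum>i<n - 1. (L k (s i) - L k p * q (s i)) * y i)" for k
      unfolding sum_eq xp
      by (simp add: left_diff_distrib sum_subtractf sum_distrib_left mult.assoc del: mult_minus_right)
    moreover have "L r (s i) - L r p * q (s i) = 0" for i
      using p(2) by (simp add: q_def)
    ultimately have "\<forall>k<Suc r. (\<Sum>i<n. L k i * x i) = 0"
      using y0 by (auto simp: less_Suc_eq)
    moreover have "\<exists>i<n. x i \<noteq> 0"
    proof -
      obtain i where "i < n - 1" "y i \<noteq> 0" using y by auto
      moreover have "s i < n" using bij \<open>i < n - 1\<close> by (auto simp: bij_betw_def)
      ultimately show ?thesis using xs by metis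
    qed
    ultimately show ?thesis by blast
  qed
qed

subsection \<open>Williamson normal form\<close>

lemma sform_Jf_skew: "sform n Jf y x = - sform n Jf (x :: nat \<Rightarrow> real) y"
proof -
  have "sform n Jf y x = sform n (\<lambda>i j. - Jf i j) x y"
    by (rule sform_swap) (rule Jf_skew)
  then show ?thesis by (simp add: sform_def sum_negf)
qed

lemma sform_Jf_self [simp]: "sform n Jf x x = (0 :: real)"
  using sform_Jf_skew[of n x x] by simp

lemma sform_Jf_nondegenerate:
  fixes x :: "nat \<Rightarrow> real"
  assumes "p < 2 * m" "x p \<noteq> 0"
  obtains q where "q < 2 * m" "sform (2 * m) Jf x (\<lambda>i. if i = q then 1 else 0) \<noteq> 0"
proof -
  define q where "q = (if even p then Suc p else p - 1)"
  have q: "q < 2 * m" using assms(1) unfolding q_def by presburger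
  have J: "Jf i q = (if i = p then (if even p then 1 else - 1) else 0)" for i
    unfolding Jf_def q_def by auto presburger+
  have "sform (2 * m) Jf x (\<lambda>i. if i = q then 1 else 0) = (\<Sum>i<2 * m. Jf i q * x i)"
    using q by (simp add: sform_def if_distrib[of "(*) _"] cong: if_cong)
  also have "\<dots> = (if even p then x p else - x p)"
    using assms(1) by (simp add: J if_distrib[of "\<lambda>a. a * _"] cong: if_cong)
  finally show ?thesis using that[OF q] assms(2) by auto
qed

text \<open>The symplectic complement of the first \<open>j\<close> pairs. Requiring zeros from
  \<open>n\<close> on makes these functions a faithful copy of a subspace of R^n, as the compactness
  argument below requires.\<close>

definition symp_compl :: "nat \<Rightarrow> (nat \<Rightarrow> nat \<Rightarrow> real) \<Rightarrow> (nat \<Rightarrow> nat \<Rightarrow> real) \<Rightarrow> nat \<Rightarrow> (nat \<Rightarrow> real) set" where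
  "symp_compl n u v j =
     {x. (\<forall>p\<ge>n. x p = 0) \<and> (\<forall>l<j. sform n Jf x (u l) = 0 \<and> sform n Jf x (v l) = 0)}"

lemma symp_compl_lin:
  assumes "x \<in> symp_compl n u v j" "y \<in> symp_compl n u v j"
  shows "(\<lambda>p. x p + t * y p) \<in> symp_compl n u v j"
  using assms by (auto simp: symp_compl_def sform_add_left sform_scale_left)

lemma symp_compl_scale:
  assumes "x \<in> symp_compl n u v j"
  shows "(\<lambda>p. t * x p) \<in> symp_compl n u v j"
  using assms by (auto simp: symp_compl_def sform_scale_left)

text \<open>The pair minimises the sum of the two quadratic values among normalised pairs in the symplectic
  complement of its predecessors; the stationarity conditions then make the form diagonal.\<close>

definition greedy_pair :: "nat \<Rightarrow> (nat \<Rightarrow> nat \<Rightarrow> real) \<Rightarrow> (nat \<Rightarrow> nat \<Rightarrow> real) \<Rightarrow> (nat \<Rightarrow> nat \<Rightarrow> real) \<Rightarrow>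
    (nat \<Rightarrow> real) \<Rightarrow> nat \<Rightarrow> bool" where
  "greedy_pair n F u v d j \<longleftrightarrow>
     u j \<in> symp_compl n u v j \<and> v j \<in> symp_compl n u v j \<and> sform n Jf (u j) (v j) = 1 \<and> 0 < d j \<and>
     sform n F (u j) (u j) + sform n F (v j) (v j) = 2 * d j \<and>
     (\<forall>x\<in>symp_compl n u v j. \<forall>y\<in>symp_compl n u v j.
        2 * d j * sform n Jf x y \<le> sform n F x x + sform n F y y)"

lemma greedy_pair_canonical:
  assumes "\<And>j. j < i \<Longrightarrow> greedy_pair n F u v d j" "j < i" "l < i"
  shows "sform n Jf (u j) (u l) = 0" "sform n Jf (v j) (v l) = 0"
    "sform n Jf (u j) (v l) = (if j = l then 1 else 0)"
proof -
  have less: "sform n Jf (u j) (u l) = 0 \<and> sform n Jf (v j) (v l) = 0 \<and>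
      sform n Jf (u j) (v l) = 0 \<and> sform n Jf (v j) (u l) = 0"
    if "l < j" "j < i" for j l
    using assms(1)[OF that(2)] that(1) by (auto simp: greedy_pair_def symp_compl_def)
  have same: "sform n Jf (u j) (v j) = 1" if "j < i" for j
    using assms(1)[OF that] by (auto simp: greedy_pair_def)
  show "sform n Jf (u j) (u l) = 0" "sform n Jf (v j) (v l) = 0"
    "sform n Jf (u j) (v l) = (if j = l then 1 else 0)"
    using less[of l j] less[of j l] same assms(2,3) sform_Jf_skew[of n "u j" "u l"]
      sform_Jf_skew[of n "v j" "v l"] sform_Jf_skew[of n "u j" "v l"]
    by (cases j l rule: linorder_cases; simp)+
qed

text \<open>This makes the minimisation for the next pair feasible. Counting dimensions gives a
  nonzero \<open>x\<close> in the complement and nondegeneracy a unit vector \<open>z\<close> with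
  nonzero pairing; removing from \<open>z\<close> its symplectic projection onto the earlier pairs
  puts it into the complement and leaves its pairing with \<open>x\<close> unchanged. Exchanging the
  two vectors corrects the sign.\<close>

lemma symp_compl_isotropic_free:
  assumes gp: "\<And>j. j < i \<Longrightarrow> greedy_pair (2 * m) F u v d j" and "i < m"
  shows "\<exists>x\<in>symp_compl (2 * m) u v i. \<exists>y\<in>symp_compl (2 * m) u v i. 0 < sform (2 * m) Jf x y"
proof -
  let ?w = "sform (2 * m) Jf" and ?W = "symp_compl (2 * m) u v i"
  \<comment> \<open>The \<open>2 * i\<close> orthogonality conditions as rows of a linear system,
    even rows for the \<open>u l\<close> and odd rows for the \<open>v l\<close>.\<close>
  define R where "R = (\<lambda>k p. \<Sum>q<2 * m. Jf p q * (if even k then u (k div 2) q else v (k div 2) q))"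
  have Rw: "(\<Sum>p<2 * m. R (2 * l) p * x p) = ?w x (u l)" "(\<Sum>p<2 * m. R (Suc (2 * l)) p * x p) = ?w x (v l)" for l x
    by (auto simp: R_def sform_def sum_distrib_right sum_distrib_left ac_simps)
  obtain x0 where x0: "\<exists>p<2 * m. x0 p \<noteq> 0" "\<forall>k<2 * i. (\<Sum>p<2 * m. R k p * x0 p) = 0"
    using homogeneous_system_nontrivial[of "2 * i" "2 * m" R] \<open>i < m\<close> by auto
  define x where "x = (\<lambda>p. if p < 2 * m then x0 p else 0)"
  have xx: "?w x z = ?w x0 z" for z by (rule sform_cong) (auto simp: x_def)
  have x: "x \<in> ?W"
  proof -
    have "?w x (u l) = 0 \<and> ?w x (v l) = 0" if "l < i" for l
    proof -
      have "2 * l < 2 * i" "Suc (2 * l) < 2 * i" using that by auto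
      with x0(2) have "(\<Sum>p<2 * m. R (2 * l) p * x0 p) = 0" "(\<Sum>p<2 * m. R (Suc (2 * l)) p * x0 p) = 0"
        by blast+
      then show ?thesis unfolding Rw xx by simp
    qed
    then show ?thesis by (simp add: symp_compl_def x_def)
  qed
  obtain p where p: "p < 2 * m" "x p \<noteq> 0" using x0(1) by (auto simp: x_def)
  obtain q where q: "q < 2 * m" "?w x (\<lambda>i. if i = q then 1 else 0) \<noteq> 0"
    using sform_Jf_nondegenerate[of p m x] p by blast
  define z :: "nat \<Rightarrow> real" where "z = (\<lambda>i. if i = q then 1 else 0)"
  define y where "y = (\<lambda>p. z p - ((\<Sum>l<i. ?w z (v l) * u l p) - (\<Sum>l<i. ?w z (u l) * v l p)))"
  note can = greedy_pair_canonical[OF gp]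
  have can': "?w (v l) (u j) = (if j = l then - 1 else 0)" if "j < i" "l < i" for j l
    using can(3)[OF _ that] sform_Jf_skew[of "2 * m" "v l" "u j"] by auto
  have y: "y \<in> ?W"
  proof -
    have "y p = 0" if "p \<ge> 2 * m" for p
    proof -
      have "u l p = 0 \<and> v l p = 0" if "l < i" for l
        using gp[OF that] \<open>p \<ge> 2 * m\<close> by (auto simp: greedy_pair_def symp_compl_def)
      then show ?thesis using that q(1) by (auto simp: y_def z_def)
    qed
    moreover have "?w y (u j) = 0 \<and> ?w y (v j) = 0" if "j < i" for j
    proof -
      have "?w y (u j) = ?w z (u j) - ((\<Sum>l<i. ?w z (v l) * ?w (u l) (u j)) - (\<Sum>l<i. ?w z (u l) * ?w (v l) (u j)))"
        "?w y (v j) = ?w z (v j) - ((\<Sum>l<i. ?w z (v l) * ?w (u l) (v j)) - (\<Sum>l<i. ?w z (u l) * ?w (v l) (v j)))"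
        unfolding y_def by (simp_all only: sform_diff_left sform_sum_left)
      then show ?thesis using that can can'
        by (simp add: if_distrib[of "(*) _"] cong: if_cong)
    qed
    ultimately show ?thesis by (auto simp: symp_compl_def)
  qed
  have "?w x y = ?w x z - ((\<Sum>l<i. ?w z (v l) * ?w x (u l)) - (\<Sum>l<i. ?w z (u l) * ?w x (v l)))"
    unfolding y_def by (simp only: sform_diff_right sform_sum_right)
  also have "\<dots> = ?w x z" using x by (simp add: symp_compl_def)
  finally have ne: "?w x y \<noteq> 0" using q(2) by (simp add: z_def)
  show ?thesis
  proof (cases "?w x y > 0")
    case False
    with ne have "?w y x > 0" using sform_Jf_skew[of "2 * m" y x] by simp
    with x y show ?thesis by blast
  qed (use x y in blast)
qed

lemma continuous_on_sform:
  fixes f g :: "'a :: topological_space \<Rightarrow> nat \<Rightarrow> real"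
  assumes "\<And>p. continuous_on S (\<lambda>z. f z p)" "\<And>p. continuous_on S (\<lambda>z. g z p)"
  shows "continuous_on S (\<lambda>z. sform n F (f z) (g z))"
  unfolding sform_def by (intro continuous_intros assms)

text \<open>The constraint that the pairing be 1 cuts out an unbounded set. Therefore the
  scale-invariant quotient of twice the pairing by the sum of the quadratic values is maximised over
  a compact sphere; its maximum \<mu> gives the new value 1 / \<mu>. A pair of real vectors is coded
  as one complex sequence, by real and imaginary parts.\<close>

lemma greedy_pair_exists:
  assumes pos: "\<And>x. \<exists>p<2 * m. x p \<noteq> 0 \<Longrightarrow> 0 < sform (2 * m) F x x"
    and gp: "\<And>j. j < i \<Longrightarrow> greedy_pair (2 * m) F u v d j" and "i < m"
  shows "\<exists>a b c. greedy_pair (2 * m) F (u(i := a)) (v(i := b)) (d(i := c)) i"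
proof -
  let ?n = "2 * m" and ?W = "symp_compl (2 * m) u v i"
  let ?w = "sform ?n Jf" and ?b = "sform ?n F"
  let ?R = "\<lambda>z :: nat \<Rightarrow> complex. \<lambda>p. Re (z p)" and ?I = "\<lambda>z :: nat \<Rightarrow> complex. \<lambda>p. Im (z p)"
  define N where "N = (\<lambda>z. \<Sum>p<?n. (Re (z p))\<^sup>2 + (Im (z p))\<^sup>2)"
  \<comment> \<open>Coordinates from \<open>2 * m\<close> on are pinned to 0, so \<open>C\<close> is
    a product of compact sets and is compact by Tychonoff's theorem, although the ambient space has
    infinitely many coordinates.\<close>
  define C where "C = PiE UNIV (\<lambda>p. if p < ?n then cball (0 :: complex) 1 else {0})"
  define K where "K = C \<inter> {z. ?R z \<in> ?W \<and> ?I z \<in> ?W \<and> N z = 1}"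
  have contR: "continuous_on S (\<lambda>z :: nat \<Rightarrow> complex. Re (z p))" and contI: "continuous_on S (\<lambda>z :: nat \<Rightarrow> complex. Im (z p))" for S p
    by (intro continuous_intros continuous_on_subset[OF continuous_on_product_coordinates]; simp)+
  have contw: "continuous_on S (\<lambda>z. sform ?n G (?R z) (?I z))" "continuous_on S (\<lambda>z. sform ?n G (?R z) (?R z))"
      "continuous_on S (\<lambda>z. sform ?n G (?I z) (?I z))" "continuous_on S (\<lambda>z. sform ?n G (?R z) y)"
      "continuous_on S (\<lambda>z. sform ?n G (?I z) y)" for S G y
    by (intro continuous_on_sform contR contI continuous_on_const)+
  have contN: "continuous_on S N" for S
    unfolding N_def by (intro continuous_intros contR contI)
  have "compact C"
  proof -
    have "compactin (product_topology (\<lambda>_. euclidean) UNIV) C"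
      unfolding C_def compactin_PiE by auto
    then show ?thesis by (simp add: euclidean_product_topology)
  qed
  moreover have "closed {z. ?R z \<in> ?W \<and> ?I z \<in> ?W \<and> N z = 1}"
  proof -
    have "{z. ?R z \<in> ?W \<and> ?I z \<in> ?W \<and> N z = 1} =
      (\<Inter>p\<in>{?n..}. {z. Re (z p) = 0}) \<inter> (\<Inter>p\<in>{?n..}. {z. Im (z p) = 0}) \<inter>
      (\<Inter>l\<in>{..<i}. {z. ?w (?R z) (u l) = 0} \<inter> {z. ?w (?R z) (v l) = 0} \<inter> {z. ?w (?I z) (u l) = 0} \<inter> {z. ?w (?I z) (v l) = 0})
      \<inter> {z. N z = 1}"
      by (auto simp: symp_compl_def)
    also have "closed \<dots>"
      by (intro closed_Int closed_INT ballI closed_Collect_eq contR contI contw contN continuous_on_const)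
    finally show ?thesis .
  qed
  ultimately have "compact K" unfolding K_def by blast
  have Npos: "\<exists>p<?n. z p \<noteq> 0" if "N z > 0" for z
    using that unfolding N_def by (rule_tac ccontr) (simp add: sum.neutral)
  have bnn: "?b x x \<ge> 0" for x
  proof (cases "\<exists>p<?n. x p \<noteq> 0")
    case False
    then have "?b x x = ?b (\<lambda>_. 0) x" by (intro sform_cong) auto
    then show ?thesis by simp
  qed (use pos in \<open>simp add: less_imp_le\<close>)
  define D where "D = (\<lambda>z. ?b (?R z) (?R z) + ?b (?I z) (?I z))"
  have Dpos: "D z > 0" if "N z > 0" for z
  proof -
    obtain p where p: "p < ?n" "z p \<noteq> 0" using Npos[OF \<open>N z > 0\<close>] by blast
    then have "Re (z p) \<noteq> 0 \<or> Im (z p) \<noteq> 0" by (auto simp: complex_eq_iff)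
    then have "0 < ?b (?R z) (?R z) \<or> 0 < ?b (?I z) (?I z)"
      using pos[of "?R z"] pos[of "?I z"] p by meson
    then show ?thesis unfolding D_def using bnn[of "?R z"] bnn[of "?I z"] by linarith
  qed
  define \<phi> where "\<phi> = (\<lambda>z. 2 * ?w (?R z) (?I z) / D z)"
  have "D z > 0" if "z \<in> K" for z using that Dpos by (auto simp: K_def)
  then have cont\<phi>: "continuous_on K \<phi>"
    unfolding \<phi>_def by (intro continuous_intros contw) (auto simp: D_def intro!: continuous_intros contw, force)
  have scaleN: "N (\<lambda>p. of_real t * z p) = t\<^sup>2 * N z" for t z
    unfolding N_def by (simp add: power_mult_distrib sum_distrib_left distrib_left)
  have scaleD: "D (\<lambda>p. of_real t * z p) = t\<^sup>2 * D z" for t z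
    unfolding D_def by (simp add: sform_scale_left sform_scale_right power2_eq_square distrib_left mult.assoc)
  have scalew: "?w (?R (\<lambda>p. of_real t * z p)) (?I (\<lambda>p. of_real t * z p)) = t\<^sup>2 * ?w (?R z) (?I z)" for t z
    by (simp add: sform_scale_left sform_scale_right power2_eq_square)
  have toK: "\<exists>t>0. (\<lambda>p. of_real t * z p) \<in> K" if W: "?R z \<in> ?W" "?I z \<in> ?W" and N: "N z > 0" for z
  proof (intro exI conjI)
    let ?t = "1 / sqrt (N z)" and ?z = "\<lambda>p. of_real (1 / sqrt (N z)) * z p"
    show "?t > 0" using N by simp
    have N1: "N ?z = 1" unfolding scaleN using N by (simp add: power_divide)
    have "cmod (?z p) \<le> 1" if "p < ?n" for p
    proof -
      have "(cmod (?z p))\<^sup>2 = (Re (?z p))\<^sup>2 + (Im (?z p))\<^sup>2" by (rule cmod_power2)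
      also have "\<dots> \<le> N ?z" unfolding N_def using that by (intro member_le_sum) auto
      finally show ?thesis unfolding N1 by (simp add: abs_square_le_1)
    qed
    moreover have "z p = 0" if "p \<ge> ?n" for p
      using W that by (auto simp: symp_compl_def complex_eq_iff)
    ultimately have "?z \<in> C" by (auto simp: C_def)
    moreover have "?R ?z \<in> ?W" "?I ?z \<in> ?W"
      using symp_compl_scale[OF W(1), of ?t] symp_compl_scale[OF W(2), of ?t] by simp_all
    ultimately show "?z \<in> K" using N1 by (simp add: K_def)
  qed
  obtain x y where xy: "x \<in> ?W" "y \<in> ?W" "?w x y > 0"
    using symp_compl_isotropic_free[OF gp \<open>i < m\<close>] by blast
  define z0 where "z0 = (\<lambda>p. Complex (x p) (y p))"
  have z0: "?R z0 = x" "?I z0 = y" by (auto simp: z0_def)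
  have Nnn: "N z \<ge> 0" for z unfolding N_def by (intro sum_nonneg) auto
  have wzero: "?w (?R z) (?I z) = 0" if "\<not> N z > 0" for z
  proof -
    have "N z = 0" using that Nnn[of z] by simp
    then have "\<And>p. p < ?n \<Longrightarrow> Re (z p) = 0"
      unfolding N_def by (subst (asm) sum_nonneg_eq_0_iff) (auto simp: add_nonneg_eq_0_iff)
    then show ?thesis using sform_cong[of ?n Jf Jf "?R z" "\<lambda>_. 0" "?I z" "?I z"] by simp
  qed
  have "N z0 > 0" using xy(3) wzero[of z0] z0 by force
  then obtain t0 where t0: "t0 > 0" "(\<lambda>p. of_real t0 * z0 p) \<in> K" using toK[of z0] xy z0 by metis
  then obtain z where z: "z \<in> K" "\<And>z'. z' \<in> K \<Longrightarrow> \<phi> z' \<le> \<phi> z"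
    using continuous_attains_sup[OF \<open>compact K\<close> _ cont\<phi>] by blast
  define \<mu> where "\<mu> = \<phi> z"
  have opt: "2 * ?w (?R z') (?I z') \<le> \<mu> * D z'" if W': "?R z' \<in> ?W" "?I z' \<in> ?W" for z'
  proof (cases "N z' > 0")
    case True
    then obtain t where t: "t > 0" "(\<lambda>p. of_real t * z' p) \<in> K" using toK[OF W' True] by blast
    have "\<phi> (\<lambda>p. of_real t * z' p) \<le> \<mu>" unfolding \<mu>_def by (rule z(2)[OF t(2)])
    then have "2 * ?w (?R z') (?I z') / D z' \<le> \<mu>"
      unfolding \<phi>_def scalew scaleD using t(1) by simp
    then show ?thesis using Dpos[OF True] by (simp add: field_simps)
  next
    case False
    \<comment> \<open>A pair that vanishes below \<open>2 * m\<close> cannot be rescaled to the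
      sphere. Its pairing is 0, so the inequality reduces to the sign of the maximum, for which
      \<open>z0\<close> is a witness.\<close>
    have "\<mu> \<ge> 0"
    proof -
      have "\<phi> (\<lambda>p. of_real t0 * z0 p) \<ge> 0"
        unfolding \<phi>_def scalew scaleD z0 using t0(1) xy(3) Dpos[OF \<open>N z0 > 0\<close>] by simp
      then show ?thesis using z(2)[OF t0(2)] by (simp add: \<mu>_def)
    qed
    moreover have "D z' \<ge> 0" unfolding D_def using bnn by simp
    ultimately show ?thesis using wzero[OF False] by simp
  qed
  have \<mu>0: "\<mu> > 0"
  proof -
    have "0 < 2 * ?w (?R z0) (?I z0)" using xy(3) z0 by simp
    also have "\<dots> \<le> \<mu> * D z0" using opt[of z0] xy z0 by simp
    finally show ?thesis using Dpos[OF \<open>N z0 > 0\<close>] by (simp add: zero_less_mult_iff)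
  qed
  have zK: "?R z \<in> ?W" "?I z \<in> ?W" "N z = 1" using z(1) by (auto simp: K_def)
  have Dz: "D z > 0" using Dpos zK(3) by simp
  have wz: "2 * ?w (?R z) (?I z) = \<mu> * D z" using Dz by (simp add: \<mu>_def \<phi>_def)
  \<comment> \<open>Scaling both vectors by \<open>s\<close> multiplies their pairing by
    \<open>s * s\<close>; this \<open>s\<close> brings it to 1.\<close>
  define s where "s = sqrt (2 / (\<mu> * D z))"
  have s2: "s * s = 2 / (\<mu> * D z)" using \<mu>0 Dz by (simp add: s_def)
  define a where "a = (\<lambda>p. s * Re (z p))"
  define b where "b = (\<lambda>p. s * Im (z p))"
  have aW: "a \<in> ?W" "b \<in> ?W" unfolding a_def b_def using zK symp_compl_scale by auto
  have eq: "symp_compl ?n (u(i := a)) (v(i := b)) i = ?W" by (auto simp: symp_compl_def)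
  have "?w a b = (s * s) * ?w (?R z) (?I z)"
    unfolding a_def b_def by (simp add: sform_scale_left sform_scale_right)
  also have "\<dots> = 1" unfolding s2 using wz \<mu>0 Dz by (simp add: field_simps)
  finally have w1: "?w a b = 1" .
  have "?b a a + ?b b b = (s * s) * D z"
    unfolding a_def b_def D_def by (simp add: sform_scale_left sform_scale_right algebra_simps)
  also have "\<dots> = 2 * (1 / \<mu>)" unfolding s2 using \<mu>0 Dz by (simp add: field_simps)
  finally have bb: "?b a a + ?b b b = 2 * (1 / \<mu>)" .
  have opt': "2 * (1 / \<mu>) * ?w x y \<le> ?b x x + ?b y y" if "x \<in> ?W" "y \<in> ?W" for x y
    using opt[of "\<lambda>p. Complex (x p) (y p)"] that \<mu>0 by (simp add: D_def field_simps)
  have "greedy_pair ?n F (u(i := a)) (v(i := b)) (d(i := 1 / \<mu>)) i"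
    unfolding greedy_pair_def eq using aW w1 bb opt' \<mu>0 by auto
  then show ?thesis by blast
qed

lemma greedy_family_exists:
  assumes pos: "\<And>x. \<exists>p<2 * m. x p \<noteq> 0 \<Longrightarrow> 0 < sform (2 * m) F x x" and "i \<le> m"
  shows "\<exists>u v d. \<forall>j<i. greedy_pair (2 * m) F u v d j"
  using \<open>i \<le> m\<close>
proof (induction i)
  case (Suc i)
  then obtain u v d where g: "\<And>j. j < i \<Longrightarrow> greedy_pair (2 * m) F u v d j" by auto
  obtain a b c where abc: "greedy_pair (2 * m) F (u(i := a)) (v(i := b)) (d(i := c)) i"
    using greedy_pair_exists[of m F i u v d, OF pos g] Suc.prems by (meson Suc_le_eq)
  have "greedy_pair (2 * m) F (u(i := a)) (v(i := b)) (d(i := c)) j" if "j < i" for j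
  proof -
    have "symp_compl (2 * m) (u(i := a)) (v(i := b)) j = symp_compl (2 * m) u v j"
      using that by (auto simp: symp_compl_def)
    then show ?thesis using g[OF that] that by (simp add: greedy_pair_def)
  qed
  with abc show ?case by (metis less_Suc_eq)
qed auto

text \<open>The first-order condition at a minimum, in algebraic form: at t = - \<alpha> / B with B
  above \<beta> a nonzero linear term would outweigh the quadratic one.\<close>

lemma linear_term_zero:
  fixes \<alpha> \<beta> :: real
  assumes "\<And>t. 0 \<le> t * \<alpha> + t\<^sup>2 * \<beta>"
  shows "\<alpha> = 0"
proof (rule ccontr)
  assume "\<alpha> \<noteq> 0"
  define B where "B = \<bar>\<beta>\<bar> + 1"
  have B: "B > 0" "\<beta> < B" by (auto simp: B_def)
  define t where "t = - \<alpha> / B"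
  have "t * \<alpha> + t\<^sup>2 * \<beta> = (\<alpha> / B)\<^sup>2 * (\<beta> - B)"
    unfolding t_def using B by (simp add: field_simps power2_eq_square)
  also have "\<dots> < 0" using \<open>\<alpha> \<noteq> 0\<close> B by (intro mult_pos_neg) auto
  finally show False using assms[of t] by simp
qed

text \<open>Only one member of the pair is moved, by \<open>t\<close> times \<open>x\<close>. In the
  minimality inequality the constant terms cancel, since the pair itself attains equality, so the
  linear term in \<open>t\<close> must vanish. These are the Lagrange equations, with
  \<open>d j\<close> as multiplier.\<close>

lemma greedy_pair_stationary:
  assumes sym: "\<And>p q. p < n \<Longrightarrow> q < n \<Longrightarrow> F p q = F q p"
    and gp: "greedy_pair n F u v d j" and x: "x \<in> symp_compl n u v j"
  shows "sform n F (u j) x = d j * sform n Jf x (v j)" "sform n F (v j) x = d j * sform n Jf (u j) x"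
proof -
  let ?w = "sform n Jf" and ?b = "sform n F"
  have bsym: "?b y z = ?b z y" for y z by (rule sform_swap) (rule sym)
  have uv: "u j \<in> symp_compl n u v j" "v j \<in> symp_compl n u v j" "?w (u j) (v j) = 1"
    "?b (u j) (u j) + ?b (v j) (v j) = 2 * d j"
    and opt: "\<And>x y. x \<in> symp_compl n u v j \<Longrightarrow> y \<in> symp_compl n u v j \<Longrightarrow> 2 * d j * ?w x y \<le> ?b x x + ?b y y"
    using gp by (auto simp: greedy_pair_def)
  have "2 * ?b (u j) x - 2 * d j * ?w x (v j) = 0"
  proof (rule linear_term_zero)
    fix t
    have "2 * d j * ?w (\<lambda>p. u j p + t * x p) (v j) \<le>
      ?b (\<lambda>p. u j p + t * x p) (\<lambda>p. u j p + t * x p) + ?b (v j) (v j)"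
      by (intro opt symp_compl_lin uv x)
    then show "0 \<le> t * (2 * ?b (u j) x - 2 * d j * ?w x (v j)) + t\<^sup>2 * ?b x x"
      using uv(3,4) bsym[of x "u j"]
      by (simp add: sform_add_left sform_add_right sform_scale_left sform_scale_right algebra_simps power2_eq_square)
  qed
  then show "?b (u j) x = d j * ?w x (v j)" by simp
  have "2 * ?b (v j) x - 2 * d j * ?w (u j) x = 0"
  proof (rule linear_term_zero)
    fix t
    have "2 * d j * ?w (u j) (\<lambda>p. v j p + t * x p) \<le>
      ?b (u j) (u j) + ?b (\<lambda>p. v j p + t * x p) (\<lambda>p. v j p + t * x p)"
      by (intro opt symp_compl_lin uv x)
    then show "0 \<le> t * (2 * ?b (v j) x - 2 * d j * ?w (u j) x) + t\<^sup>2 * ?b x x"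
      using uv(3,4) bsym[of x "v j"]
      by (simp add: sform_add_left sform_add_right sform_scale_left sform_scale_right algebra_simps power2_eq_square)
  qed
  then show "?b (v j) x = d j * ?w (u j) x" by simp
qed


text \<open>Every later basis vector lies in the complement of the earlier pairs, so stationarity
  expresses its mixed quadratic values through symplectic pairings, which are known. The values
  increase because pair \<open>j\<close> also competes in the minimisation for each pair
  \<open>i\<close> \<le> \<open>j\<close>. Interleaving the \<open>u\<close> and \<open>v\<close> as
  \<open>E\<close> matches the ordering of \<open>Jf\<close>.\<close>

lemma williamson_family:
  assumes sym: "\<And>p q. p < 2 * m \<Longrightarrow> q < 2 * m \<Longrightarrow> F p q = F q p"
    and pos: "\<And>x :: nat \<Rightarrow> real. \<exists>p<2 * m. x p \<noteq> 0 \<Longrightarrow> 0 < sform (2 * m) F x x"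
  obtains E d where
    "\<And>r s. r < 2 * m \<Longrightarrow> s < 2 * m \<Longrightarrow> sform (2 * m) Jf (E r) (E s) = Jf r s"
    "\<And>r s. r < 2 * m \<Longrightarrow> s < 2 * m \<Longrightarrow> sform (2 * m) F (E r) (E s) = (if r = s then d (r div 2) else 0)"
    "\<And>j. j < m \<Longrightarrow> 0 < d j" "\<And>i j. i \<le> j \<Longrightarrow> j < m \<Longrightarrow> d i \<le> d j"
proof -
  let ?w = "sform (2 * m) Jf" and ?b = "sform (2 * m) F"
  obtain u v d where gp: "\<And>j. j < m \<Longrightarrow> greedy_pair (2 * m) F u v d j"
    using greedy_family_exists[OF pos, of m] by auto
  note can = greedy_pair_canonical[OF gp]
  have mono: "symp_compl (2 * m) u v l \<subseteq> symp_compl (2 * m) u v j" if "j \<le> l" for j l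
    using that by (auto simp: symp_compl_def)
  have mem: "u l \<in> symp_compl (2 * m) u v j" "v l \<in> symp_compl (2 * m) u v j" if "j \<le> l" "l < m" for j l
    using gp[OF that(2)] mono[OF that(1)] by (auto simp: greedy_pair_def)
  have vu: "?w (v j) (u l) = (if j = l then - 1 else 0)" if "j < m" "l < m" for j l
    using can(3)[OF _ that(2,1)] sform_Jf_skew[of "2 * m" "v j" "u l"] by auto
  have bsym: "?b y z = ?b z y" for y z by (rule sform_swap) (rule sym)
  have diag1: "?b (u j) (u l) = (if j = l then d j else 0) \<and> ?b (u j) (v l) = 0 \<and>
      ?b (v j) (u l) = 0 \<and> ?b (v j) (v l) = (if j = l then d j else 0)" if "j \<le> l" "l < m" for j l
  proof -
    have jm: "j < m" using that by simp
    have st: "?b (u j) x = d j * ?w x (v j)" "?b (v j) x = d j * ?w (u j) x"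
      if "x \<in> symp_compl (2 * m) u v j" for x
      using greedy_pair_stationary[OF _ gp[OF jm] that] sym by blast+
    show ?thesis
      using st[OF mem(1)[OF that]] st[OF mem(2)[OF that]] can[OF _ jm that(2)] can[OF _ that(2) jm] jm that(2)
      by auto
  qed
  have diag: "?b (u j) (u l) = (if j = l then d j else 0)" "?b (u j) (v l) = 0"
      "?b (v j) (u l) = 0" "?b (v j) (v l) = (if j = l then d j else 0)" if "j < m" "l < m" for j l
    using diag1[of j l] diag1[of l j] that bsym[of "u j" "u l"] bsym[of "u j" "v l"] bsym[of "v j" "u l"] bsym[of "v j" "v l"]
    by (cases j l rule: linorder_cases; simp)+
  define E where "E = (\<lambda>r. if even r then u (r div 2) else v (r div 2))"
  have E: "E (2 * j) = u j" "E (Suc (2 * j)) = v j" for j by (auto simp: E_def)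
  have split: "\<exists>j<m. r = 2 * j \<or> r = Suc (2 * j)" if "r < 2 * m" for r
    using that by (intro exI[of _ "r div 2"]) presburger
  have main: "?w (E r) (E s) = Jf r s \<and> ?b (E r) (E s) = (if r = s then d (r div 2) else 0)"
    if rs: "r < 2 * m" "s < 2 * m" for r s
  proof -
    obtain j l where j: "j < m" "r = 2 * j \<or> r = Suc (2 * j)" and l: "l < m" "s = 2 * l \<or> s = Suc (2 * l)"
      using split rs by meson
    have ne: "2 * j \<noteq> Suc (2 * l)" "Suc (2 * j) \<noteq> 2 * l" by presburger+
    from j(2) l(2) show ?thesis
      by (elim disjE; simp only: E)
        (simp_all add: can[OF _ j(1) l(1)] vu[OF j(1) l(1)] diag[OF j(1) l(1)] Jf_def ne)
  qed
  have dpos: "0 < d j" if "j < m" for j using gp[OF that] by (simp add: greedy_pair_def)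
  have dmono: "d i \<le> d j" if "i \<le> j" "j < m" for i j
  proof -
    have "2 * d i * ?w (u j) (v j) \<le> ?b (u j) (u j) + ?b (v j) (v j)"
      using gp[of i] mem[OF that] that unfolding greedy_pair_def by auto
    then show ?thesis using can(3)[OF _ that(2,2)] diag[OF that(2,2)] by simp
  qed
  show ?thesis by (rule that[of E d]) (simp_all add: main dpos dmono)
qed

section \<open>Williamson's theorem for matrices\<close>

lemma index_congruence:
  fixes M B :: "'a :: comm_ring_1 mat"
  assumes "M \<in> carrier_mat n n" "B \<in> carrier_mat n n" "r < n" "s < n"
  shows "(M * B * transpose_mat M) $$ (r, s) =
    sform n (\<lambda>p q. B $$ (p, q)) (\<lambda>p. M $$ (r, p)) (\<lambda>q. M $$ (s, q))"
proof -
  have "(M * B * transpose_mat M) $$ (r, s) = (\<Sum>p<n. M $$ (r, p) * (\<Sum>q<n. B $$ (p, q) * M $$ (s, q)))"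
    using assms by (simp add: scalar_prod_def atLeast0LessThan)
  then show ?thesis
    by (simp add: sform_def sum_distrib_left ac_simps)
qed

lemma symp_J_square: "symp_J m * symp_J m = - 1\<^sub>m (2 * m)"
proof (rule eq_matI)
  fix i j assume ij: "i < dim_row (- 1\<^sub>m (2 * m) :: real mat)" "j < dim_col (- 1\<^sub>m (2 * m) :: real mat)"
  define p where "p = (if even i then Suc i else i - 1)"
  have p: "p < 2 * m" 
  proof -
    have "i < 2 * m" using ij by simp
    then show ?thesis unfolding p_def by presburger
  qed
  have J: "Jf i l = (if l = p then (if even i then 1 else - 1) else 0)" for l
    unfolding Jf_def p_def by auto
  have "(symp_J m * symp_J m) $$ (i, j) = (\<Sum>l<2 * m. Jf i l * Jf l j)"
    using ij symp_J_carrier[of m] by (simp add: scalar_prod_def atLeast0LessThan symp_J_index)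
  also have "\<dots> = (if even i then 1 else - 1) * Jf p j"
    using p by (simp add: J if_distrib[of "\<lambda>a. a * _"] cong: if_cong)
  also have "\<dots> = (- 1\<^sub>m (2 * m)) $$ (i, j)"
  proof -
    have "Jf p j = (if i = j then if even i then - 1 else 1 else 0)"
      unfolding Jf_def p_def by (cases i) auto
    then show ?thesis using ij by simp
  qed
  finally show "(symp_J m * symp_J m) $$ (i, j) = (- 1\<^sub>m (2 * m)) $$ (i, j)" .
qed (use symp_J_carrier[of m] in auto)

text \<open>A matrix whose rows form a symplectic basis satisfies the condition with the transpose
  on the right, whereas \<open>symplectic\<close> has it on the left. The hypothesis exhibits
  \<open>?X\<close> as a right inverse of \<open>M\<close>; a right inverse of a square matrix is
  also a left inverse, and this turns the identity around.\<close>

lemma symplectic_transposeI: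
  assumes M: "M \<in> carrier_mat (2 * m) (2 * m)"
    and eq: "M * symp_J m * transpose_mat M = symp_J m"
  shows "symplectic m M"
proof -
  let ?J = "symp_J m" and ?n = "2 * m"
  have J: "?J \<in> carrier_mat ?n ?n" by (rule symp_J_carrier)
  have MT: "transpose_mat M \<in> carrier_mat ?n ?n" using M by simp
  let ?X = "?J * transpose_mat M * (- ?J)"
  have X: "?X \<in> carrier_mat ?n ?n" using J MT by auto
  have "M * ?X = M * (?J * transpose_mat M) * (- ?J)"
    using M J MT by (intro assoc_mult_mat[symmetric]) auto
  also have "M * (?J * transpose_mat M) = ?J"
    using eq M J MT by (subst assoc_mult_mat[symmetric, of _ ?n ?n _ ?n _ ?n]) auto
  also have "?J * (- ?J) = 1\<^sub>m ?n"
    using J by (simp add: symp_J_square)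
  finally have "?X * M = 1\<^sub>m ?n"
    using mat_mult_left_right_inverse[OF M X] by simp
  then have "?J * (?X * M) = ?J" using J by simp
  moreover have "?J * (?X * M) = transpose_mat M * ?J * M"
  proof -
    have "?J * (?X * M) = (?J * ?X) * M"
      using J X M by (intro assoc_mult_mat[symmetric]) auto
    also have "?J * ?X = (?J * (?J * transpose_mat M)) * (- ?J)"
      using J MT by (intro assoc_mult_mat[symmetric]) auto
    also have "?J * (?J * transpose_mat M) = (?J * ?J) * transpose_mat M"
      using J MT by (intro assoc_mult_mat[symmetric]) auto
    also have "\<dots> = - transpose_mat M"
      unfolding symp_J_square using MT by simp
    also have "(- transpose_mat M) * (- ?J) = transpose_mat M * ?J"
      using J MT by simp
    finally show ?thesis .
  qed
  ultimately show ?thesis using M by (simp add: symplectic_def)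
qed

lemma symplectic_transposeD:
  assumes "symplectic m M"
  shows "M * symp_J m * transpose_mat M = symp_J m"
proof -
  let ?J = "symp_J m" and ?n = "2 * m"
  have J: "?J \<in> carrier_mat ?n ?n" by (rule symp_J_carrier)
  have M: "M \<in> carrier_mat ?n ?n" and eq: "transpose_mat M * ?J * M = ?J"
    using assms by (auto simp: symplectic_def)
  have MT: "transpose_mat M \<in> carrier_mat ?n ?n" using M by simp
  have "symplectic m (transpose_mat M)"
    using MT eq M by (intro symplectic_transposeI) auto
  then show ?thesis by (simp add: symplectic_def)
qed

theorem williamson:
  assumes B: "B \<in> carrier_mat (2 * m) (2 * m)"
    and sym: "\<And>p q. p < 2 * m \<Longrightarrow> q < 2 * m \<Longrightarrow> B $$ (p, q) = B $$ (q, p)"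
    and pos: "\<And>x :: nat \<Rightarrow> real. \<exists>p<2 * m. x p \<noteq> 0 \<Longrightarrow> 0 < sform (2 * m) (\<lambda>p q. B $$ (p, q)) x x"
  shows "\<exists>ds M. length ds = m \<and> sorted ds \<and> (\<forall>d \<in> set ds. 0 < d) \<and> symplectic m M \<and>
      M * B * transpose_mat M = diag_block_mat (map (\<lambda>d. d \<cdot>\<^sub>m 1\<^sub>m 2) ds)"
proof -
  obtain E d where
    E: "\<And>r s. r < 2 * m \<Longrightarrow> s < 2 * m \<Longrightarrow> sform (2 * m) Jf (E r) (E s) = Jf r s"
      "\<And>r s. r < 2 * m \<Longrightarrow> s < 2 * m \<Longrightarrow>
         sform (2 * m) (\<lambda>p q. B $$ (p, q)) (E r) (E s) = (if r = s then d (r div 2) else 0)"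
    and d: "\<And>j. j < m \<Longrightarrow> 0 < d j" "\<And>i j. i \<le> j \<Longrightarrow> j < m \<Longrightarrow> d i \<le> d j"
  proof (rule williamson_family[of m "\<lambda>p q. B $$ (p, q)"], goal_cases)
    case (1 p q)
    show ?case by (rule sym[OF 1(2,3)])
  next
    case (2 x)
    show ?case by (rule pos[OF 2(2)])
  next
    case (3 E d)
    show ?case by (rule 3(1)[OF 3(2-5)])
  qed
  \<comment> \<open>The basis vectors become rows, since the congruence has \<open>M\<close> on the
    left and its transpose on the right.\<close>
  define M where "M = Matrix.mat (2 * m) (2 * m) (\<lambda>(r, p). E r p)"
  define ds where "ds = map d [0..<m]"
  have M: "M \<in> carrier_mat (2 * m) (2 * m)" by (simp add: M_def)
  have ent: "(M * C * transpose_mat M) $$ (r, s) = sform (2 * m) (\<lambda>p q. C $$ (p, q)) (E r) (E s)"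
    if "C \<in> carrier_mat (2 * m) (2 * m)" "r < 2 * m" "s < 2 * m" for C r s
    using that by (subst index_congruence[OF M]) (auto intro!: sform_cong simp: M_def)
  have "M * symp_J m * transpose_mat M = symp_J m"
  proof (rule eq_matI)
    fix r s assume "r < dim_row (symp_J m)" "s < dim_col (symp_J m)"
    then have rs: "r < 2 * m" "s < 2 * m" using symp_J_carrier[of m] by auto
    have "sform (2 * m) (\<lambda>p q. symp_J m $$ (p, q)) (E r) (E s) = sform (2 * m) Jf (E r) (E s)"
      by (rule sform_cong) (auto simp: symp_J_index)
    then show "(M * symp_J m * transpose_mat M) $$ (r, s) = symp_J m $$ (r, s)"
      using ent[OF symp_J_carrier rs] E(1)[OF rs] symp_J_index[OF rs] by simp
  qed (use M symp_J_carrier[of m] in auto)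
  then have "symplectic m M" by (rule symplectic_transposeI[OF M])
  moreover have "M * B * transpose_mat M = diag_block_mat (map (\<lambda>d. d \<cdot>\<^sub>m 1\<^sub>m 2) ds)"
  proof (rule eq_matI)
    have len: "length ds = m" by (simp add: ds_def)
    fix r s assume "r < dim_row (diag_block_mat (map (\<lambda>d. d \<cdot>\<^sub>m 1\<^sub>m 2) ds))"
      "s < dim_col (diag_block_mat (map (\<lambda>d. d \<cdot>\<^sub>m (1\<^sub>m 2 :: real mat)) ds))"
    then have rs: "r < 2 * m" "s < 2 * m" using symp_diag_carrier[of ds] len by auto
    moreover have "r div 2 < m" using rs by auto
    ultimately show "(M * B * transpose_mat M) $$ (r, s) = diag_block_mat (map (\<lambda>d. d \<cdot>\<^sub>m 1\<^sub>m 2) ds) $$ (r, s)"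
      using symp_diag_index[of r ds s] len ent[OF B rs] E(2)[OF rs] by (simp add: ds_def)
  qed (use M symp_diag_carrier[of ds] in \<open>auto simp: ds_def\<close>)
  moreover have "sorted ds"
    unfolding ds_def by (auto simp: sorted_iff_nth_mono intro!: d(2))
  moreover have "\<forall>d\<in>set ds. 0 < d" "length ds = m" by (auto simp: ds_def d(1))
  ultimately show ?thesis by blast
qed

subsection \<open>Inertia and symplectic eigenvalues\<close>

definition spd_mat :: "nat \<Rightarrow> real mat \<Rightarrow> bool" where
  "spd_mat n B \<longleftrightarrow> B \<in> carrier_mat n n \<and> (\<forall>p<n. \<forall>q<n. B $$ (p, q) = B $$ (q, p)) \<and>
     (\<forall>x :: nat \<Rightarrow> real. (\<exists>p<n. x p \<noteq> 0) \<longrightarrow> 0 < sform n (\<lambda>p q. B $$ (p, q)) x x)"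

text \<open>The real part gives a real value for every \<open>F\<close>, Hermitian or not.
  Non-Hermitian scalar symbols do occur: multiples of an arbitrary function serve below to show that
  Fourier coefficients determine it.\<close>

definition hform :: "nat \<Rightarrow> (nat \<Rightarrow> nat \<Rightarrow> complex) \<Rightarrow> (nat \<Rightarrow> complex) \<Rightarrow> real" where
  "hform n F z = Re (sform n F (\<lambda>p. cnj (z p)) z)"

definition pencil :: "real mat \<Rightarrow> real \<Rightarrow> nat \<Rightarrow> nat \<Rightarrow> complex" where
  "pencil B c p q = of_real (B $$ (p, q)) + \<i> * of_real (c * Jf p q)"

text \<open>Strict negativity for every nonzero coefficient family forces the vectors
  \<open>Z i\<close>, restricted to indices below \<open>n\<close>, to be linearly independent; so
  this describes a negative definite complex subspace of dimension \<open>R\<close>.\<close>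

definition negdim :: "nat \<Rightarrow> (nat \<Rightarrow> nat \<Rightarrow> complex) \<Rightarrow> nat \<Rightarrow> bool" where
  "negdim n F R \<longleftrightarrow> (\<exists>Z :: nat \<Rightarrow> nat \<Rightarrow> complex. \<forall>\<alpha>. (\<exists>i<R. \<alpha> i \<noteq> 0) \<longrightarrow>
     hform n F (\<lambda>p. \<Sum>i<R. \<alpha> i * Z i p) < 0)"

lemma hform_scale: "hform n F (\<lambda>p. a * z p) = (cmod a)\<^sup>2 * hform n F z"
proof -
  have "sform n F (\<lambda>p. cnj (a * z p)) (\<lambda>p. a * z p) = (cnj a * a) * sform n F (\<lambda>p. cnj (z p)) z"
    by (simp add: sform_scale_left sform_scale_right mult_ac)
  also have "cnj a * a = of_real ((cmod a)\<^sup>2)"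
    by (simp only: complex_norm_square mult.commute[of "cnj a"])
  finally show ?thesis unfolding hform_def by simp
qed

lemma negdim_1_iff: "negdim n F 1 \<longleftrightarrow> (\<exists>z. hform n F z < 0)"
proof
  assume "negdim n F 1"
  then obtain Z :: "nat \<Rightarrow> nat \<Rightarrow> complex" where "\<forall>\<alpha>. (\<exists>i<1. \<alpha> i \<noteq> 0) \<longrightarrow> hform n F (\<lambda>p. \<Sum>i<1. \<alpha> i * Z i p) < 0"
    unfolding negdim_def by blast
  from this[rule_format, of "\<lambda>_. 1"] show "\<exists>z. hform n F z < 0" by auto
next
  assume "\<exists>z. hform n F z < 0"
  then obtain z where z: "hform n F z < 0" by blast
  show "negdim n F 1"
    unfolding negdim_def
    by (rule exI[of _ "\<lambda>_. z"]) (auto simp: hform_scale z intro!: mult_pos_neg)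
qed

lemma hform_pencil:
  "hform n (pencil B c) z =
     sform n (\<lambda>p q. B $$ (p, q)) (\<lambda>p. Re (z p)) (\<lambda>p. Re (z p)) +
     sform n (\<lambda>p q. B $$ (p, q)) (\<lambda>p. Im (z p)) (\<lambda>p. Im (z p)) -
     2 * c * sform n Jf (\<lambda>p. Re (z p)) (\<lambda>p. Im (z p))"
proof -
  let ?x = "\<lambda>p. Re (z p)" and ?y = "\<lambda>p. Im (z p)"
  have "hform n (pencil B c) z = sform n (\<lambda>p q. B $$ (p, q)) ?x ?x + sform n (\<lambda>p q. B $$ (p, q)) ?y ?y -
      c * sform n Jf ?x ?y + c * sform n Jf ?y ?x"
    unfolding hform_def sform_def pencil_def Re_sum
    by (simp add: algebra_simps sum.distrib sum_subtractf sum_distrib_left)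
  then show ?thesis using sform_Jf_skew[of n ?y ?x] by simp
qed

lemma sum_lessThan_double: "(\<Sum>r<2 * m. f r) = (\<Sum>l<m. f (2 * l) + f (Suc (2 * l)))"
  for f :: "nat \<Rightarrow> 'a :: comm_monoid_add"
  by (induction m) (auto simp: ac_simps)

lemma sform_Jf_pairs:
  fixes x y :: "nat \<Rightarrow> real"
  shows "sform (2 * m) Jf x y = (\<Sum>l<m. x (2 * l) * y (Suc (2 * l)) - x (Suc (2 * l)) * y (2 * l))"
proof -
  have *: "(\<Sum>j<2 * m. Jf i j * x i * y j) = (if even i then x i * y (Suc i) else - (x i * y (i - 1)))" if "i < 2 * m" for i
  proof -
    define p where "p = (if even i then Suc i else i - 1)"
    have p: "p < 2 * m" using that unfolding p_def by presburger
    have J: "Jf i j = (if j = p then (if even i then 1 else - 1) else 0)" for j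
      unfolding Jf_def p_def by auto
    have "(\<Sum>j<2 * m. Jf i j * x i * y j) = (if even i then 1 else - 1) * x i * y p"
      using p by (simp add: J if_distrib[of "\<lambda>a. a * _"] cong: if_cong)
    then show ?thesis by (simp add: p_def)
  qed
  have "sform (2 * m) Jf x y = (\<Sum>i<2 * m. if even i then x i * y (Suc i) else - (x i * y (i - 1)))"
    unfolding sform_def by (intro sum.cong refl *) auto
  then show ?thesis by (simp add: sum_lessThan_double)
qed

section \<open>The pencil in Williamson coordinates\<close>

context
  fixes m :: nat and B M :: "real mat" and ds :: "real list"
  assumes B: "B \<in> carrier_mat (2 * m) (2 * m)" and M: "symplectic m M"
    and diag: "M * B * transpose_mat M = diag_block_mat (map (\<lambda>d. d \<cdot>\<^sub>m 1\<^sub>m 2) ds)"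
    and len: "length ds = m" and pos: "\<And>d. d \<in> set ds \<Longrightarrow> 0 < d"
begin

text \<open>The rows of \<open>M\<close> are real, so the real and imaginary parts of the
  coefficients \<open>a\<close> are the coordinates of the real and imaginary parts of
  \<open>z\<close>. In these rows the quadratic form is diagonal and the symplectic form is again
  \<open>Jf\<close>, which couples only the indices \<open>2 * l\<close> and
  \<open>Suc (2 * l)\<close>.\<close>

lemma williamson_hform:
  fixes a :: "nat \<Rightarrow> complex"
  assumes z: "\<And>p. p < 2 * m \<Longrightarrow> z p = (\<Sum>r<2 * m. a r * of_real (M $$ (r, p)))"
  shows "hform (2 * m) (pencil B c) z =
    (\<Sum>l<m. ds ! l * ((cmod (a (2 * l)))\<^sup>2 + (cmod (a (Suc (2 * l))))\<^sup>2) -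
       2 * c * (Re (a (2 * l)) * Im (a (Suc (2 * l))) - Re (a (Suc (2 * l))) * Im (a (2 * l))))"
proof -
  let ?n = "2 * m" and ?b = "sform (2 * m) (\<lambda>p q. B $$ (p, q))" and ?w = "sform (2 * m) Jf"
  let ?E = "\<lambda>r p. M $$ (r, p)"
  have Mc: "M \<in> carrier_mat ?n ?n" using M by (simp add: symplectic_def)
  have gb: "?b (?E r) (?E s) = (if r = s then ds ! (r div 2) else 0)" if "r < ?n" "s < ?n" for r s
    using index_congruence[OF Mc B that] symp_diag_index[of r ds s] that len unfolding diag by simp
  have gw: "?w (?E r) (?E s) = Jf r s" if "r < ?n" "s < ?n" for r s
  proof -
    have "Jf r s = sform ?n (\<lambda>p q. symp_J m $$ (p, q)) (?E r) (?E s)"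
      using index_congruence[OF Mc symp_J_carrier that] symplectic_transposeD[OF M] symp_J_index[OF that] by simp
    also have "\<dots> = ?w (?E r) (?E s)" by (rule sform_cong) (auto simp: symp_J_index)
    finally show ?thesis by simp
  qed
  have bb: "?b (\<lambda>p. \<Sum>r<?n. u r * ?E r p) (\<lambda>p. \<Sum>r<?n. u r * ?E r p) = (\<Sum>l<m. ds ! l * ((u (2 * l))\<^sup>2 + (u (Suc (2 * l)))\<^sup>2))" for u
  proof -
    have "?b (\<lambda>p. \<Sum>r<?n. u r * ?E r p) (\<lambda>p. \<Sum>r<?n. u r * ?E r p) =
        (\<Sum>r<?n. u r * (\<Sum>s<?n. u s * ?b (?E r) (?E s)))"
      by (simp only: sform_sum_left sform_sum_right)
    also have "\<dots> = (\<Sum>r<?n. u r * (\<Sum>s<?n. u s * (if r = s then ds ! (r div 2) else 0)))"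
      by (intro sum.cong refl arg_cong2[where f = "(*)"]) (auto simp: gb)
    also have "\<dots> = (\<Sum>r<?n. ds ! (r div 2) * (u r)\<^sup>2)"
      by (intro sum.cong refl) (simp add: power2_eq_square if_distrib[of "(*) _"] mult_ac cong: if_cong)
    finally show ?thesis by (simp add: sum_lessThan_double distrib_left)
  qed
  have ww: "?w (\<lambda>p. \<Sum>r<?n. u r * ?E r p) (\<lambda>p. \<Sum>r<?n. v r * ?E r p) = ?w u v" for u v
  proof -
    have "?w (\<lambda>p. \<Sum>r<?n. u r * ?E r p) (\<lambda>p. \<Sum>r<?n. v r * ?E r p) =
        (\<Sum>r<?n. u r * (\<Sum>s<?n. v s * ?w (?E r) (?E s)))"
      by (simp only: sform_sum_left sform_sum_right)
    also have "\<dots> = (\<Sum>r<?n. u r * (\<Sum>s<?n. v s * Jf r s))"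
      by (intro sum.cong refl arg_cong2[where f = "(*)"]) (auto simp: gw)
    finally show ?thesis by (simp add: sform_def sum_distrib_left mult_ac)
  qed
  let ?x = "\<lambda>p. \<Sum>r<?n. Re (a r) * ?E r p" and ?y = "\<lambda>p. \<Sum>r<?n. Im (a r) * ?E r p"
  have "hform ?n (pencil B c) z = ?b (\<lambda>p. Re (z p)) (\<lambda>p. Re (z p)) + ?b (\<lambda>p. Im (z p)) (\<lambda>p. Im (z p)) -
      2 * c * ?w (\<lambda>p. Re (z p)) (\<lambda>p. Im (z p))"
    by (rule hform_pencil)
  also have "?b (\<lambda>p. Re (z p)) (\<lambda>p. Re (z p)) = ?b ?x ?x"
    by (rule sform_cong) (auto simp: z)
  also have "?b (\<lambda>p. Im (z p)) (\<lambda>p. Im (z p)) = ?b ?y ?y"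
    by (rule sform_cong) (auto simp: z)
  also have "?w (\<lambda>p. Re (z p)) (\<lambda>p. Im (z p)) = ?w ?x ?y"
    by (rule sform_cong) (auto simp: z)
  finally show ?thesis
    unfolding bb ww
    unfolding sform_Jf_pairs cmod_power2
    by (simp only: sum_distrib_left sum.distrib[symmetric] sum_subtractf[symmetric])
      (intro sum.cong refl, simp add: algebra_simps)
qed

text \<open>Symplecticity makes the inverse of the transpose explicit, namely J M (-J). The
  coefficients \<open>X\<close> are fixed before \<open>z\<close>, so that coordinates depend
  linearly on the vector; the dimension count in the inertia criterion relies on this.\<close>

lemma williamson_coordinates:
  obtains X :: "nat \<Rightarrow> nat \<Rightarrow> real" where
    "\<And>z :: nat \<Rightarrow> complex. \<And>p. p < 2 * m \<Longrightarrow>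
       z p = (\<Sum>r<2 * m. (\<Sum>q<2 * m. of_real (X r q) * z q) * of_real (M $$ (r, p)))"
proof -
  let ?n = "2 * m" and ?J = "symp_J m"
  have Mc: "M \<in> carrier_mat ?n ?n" and MJ: "transpose_mat M * ?J * M = ?J"
    using M by (auto simp: symplectic_def)
  have J: "?J \<in> carrier_mat ?n ?n" by (rule symp_J_carrier)
  define X where "X = ?J * M * (- ?J)"
  have Xc: "X \<in> carrier_mat ?n ?n" using J Mc by (auto simp: X_def)
  have "transpose_mat M * X = (transpose_mat M * (?J * M)) * (- ?J)"
    unfolding X_def using J Mc by (intro assoc_mult_mat[symmetric]) auto
  also have "transpose_mat M * (?J * M) = ?J"
    using J Mc MJ by (subst assoc_mult_mat[symmetric, of _ ?n ?n _ ?n _ ?n]) auto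
  also have "?J * (- ?J) = 1\<^sub>m ?n" using J by (simp add: symp_J_square)
  finally have inv: "transpose_mat M * X = 1\<^sub>m ?n" .
  have ent: "(\<Sum>r<?n. M $$ (r, p) * X $$ (r, q)) = (if p = q then 1 else 0)" if "p < ?n" "q < ?n" for p q
  proof -
    have "(transpose_mat M * X) $$ (p, q) = (\<Sum>r<?n. M $$ (r, p) * X $$ (r, q))"
      using Mc Xc that by (simp add: scalar_prod_def atLeast0LessThan)
    then show ?thesis unfolding inv using that by simp
  qed
  have "z p = (\<Sum>r<?n. (\<Sum>q<?n. of_real (X $$ (r, q)) * z q) * of_real (M $$ (r, p)))"
    if "p < ?n" for z :: "nat \<Rightarrow> complex" and p
  proof -
    have "(\<Sum>r<?n. (\<Sum>q<?n. of_real (X $$ (r, q)) * z q) * of_real (M $$ (r, p))) =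
        (\<Sum>r<?n. \<Sum>q<?n. z q * of_real (M $$ (r, p) * X $$ (r, q)))"
      by (simp add: sum_distrib_left sum_distrib_right mult_ac)
    also have "\<dots> = (\<Sum>q<?n. \<Sum>r<?n. z q * of_real (M $$ (r, p) * X $$ (r, q)))"
      by (rule sum.swap)
    also have "\<dots> = (\<Sum>q<?n. z q * of_real (\<Sum>r<?n. M $$ (r, p) * X $$ (r, q)))"
      by (simp add: sum_distrib_left)
    also have "\<dots> = (\<Sum>q<?n. z q * of_real (if p = q then 1 else 0))"
      by (intro sum.cong refl) (simp only: ent[OF that] lessThan_iff)
    also have "\<dots> = z p"
      using that by (simp add: if_distrib[of of_real] if_distrib[of "(*) _"] cong: if_cong)
    finally show ?thesis by simp
  qed
  then show ?thesis by (rule that)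
qed

text \<open>A block with coordinates (a, b) contributes 2 (d - c) |a|^2 on the line b = i a and 2 (d
  + c) |a|^2 on b = - i a. The lines of the first kind for l \<le> j span a negative space when the
  \<open>j\<close>-th value is below \<open>c\<close>. Conversely, if that value is at least
  \<open>c\<close>, then \<open>j\<close> linear conditions on a space of dimension
  \<open>Suc j\<close> leave a nonzero vector on which no block is negative.\<close>

lemma williamson_inertia:
  assumes srt: "sorted ds" and j: "j < m" and c: "0 \<le> c"
  shows "ds ! j < c \<longleftrightarrow> negdim (2 * m) (pencil B c) (Suc j)"
proof
  assume less: "ds ! j < c"
  \<comment> \<open>Coordinates 1 and i in block \<open>i\<close>: the eigenvector for the
    eigenvalue d - c.\<close>
  let ?Z = "\<lambda>i p. of_real (M $$ (2 * i, p)) + \<i> * of_real (M $$ (Suc (2 * i), p)) :: complex"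
  show "negdim (2 * m) (pencil B c) (Suc j)"
    unfolding negdim_def
  proof (intro exI[of _ ?Z] allI impI)
    fix \<alpha> :: "nat \<Rightarrow> complex" assume "\<exists>i<Suc j. \<alpha> i \<noteq> 0"
    then obtain i where i: "i < Suc j" "\<alpha> i \<noteq> 0" by blast
    define a where "a = (\<lambda>r. if r div 2 < Suc j then if even r then \<alpha> (r div 2) else \<i> * \<alpha> (r div 2) else 0)"
    have "(\<Sum>i<Suc j. \<alpha> i * ?Z i p) = (\<Sum>r<2 * m. a r * of_real (M $$ (r, p)))" for p
    proof -
      have "(\<Sum>r<2 * m. a r * of_real (M $$ (r, p))) = (\<Sum>l<m. if l < Suc j then \<alpha> l * ?Z l p else 0)"
        unfolding sum_lessThan_double by (intro sum.cong refl) (simp add: a_def algebra_simps)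
      also have "\<dots> = (\<Sum>l\<in>{..<m} \<inter> {l. l < Suc j}. \<alpha> l * ?Z l p)"
        by (simp add: sum.If_cases)
      also have "{..<m} \<inter> {l. l < Suc j} = {..<Suc j}" using j by auto
      finally show ?thesis by simp
    qed
    then have "hform (2 * m) (pencil B c) (\<lambda>p. \<Sum>i<Suc j. \<alpha> i * ?Z i p) =
      (\<Sum>l<m. ds ! l * ((cmod (a (2 * l)))\<^sup>2 + (cmod (a (Suc (2 * l))))\<^sup>2) -
         2 * c * (Re (a (2 * l)) * Im (a (Suc (2 * l))) - Re (a (Suc (2 * l))) * Im (a (2 * l))))"
      by (intro williamson_hform)
    also have "\<dots> = (\<Sum>l<m. if l < Suc j then 2 * (ds ! l - c) * (cmod (\<alpha> l))\<^sup>2 else 0)"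
    proof (intro sum.cong refl)
      fix l
      have "Re \<beta> * Im (\<i> * \<beta>) - Re (\<i> * \<beta>) * Im \<beta> = (cmod \<beta>)\<^sup>2" for \<beta>
        by (simp add: cmod_power2) (simp add: power2_eq_square)
      then show "ds ! l * ((cmod (a (2 * l)))\<^sup>2 + (cmod (a (Suc (2 * l))))\<^sup>2) -
         2 * c * (Re (a (2 * l)) * Im (a (Suc (2 * l))) - Re (a (Suc (2 * l))) * Im (a (2 * l))) =
         (if l < Suc j then 2 * (ds ! l - c) * (cmod (\<alpha> l))\<^sup>2 else 0)"
        by (simp add: a_def norm_mult del: times_complex.sel) (simp add: left_diff_distrib)
    qed
    also have "\<dots> < 0"
    proof -
      have dl: "ds ! l < c" if "l < Suc j" for l
        using srt that j len less sorted_nth_mono[of ds l j] by simp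
      have "(\<Sum>l<m. if l < Suc j then 2 * (ds ! l - c) * (cmod (\<alpha> l))\<^sup>2 else 0) < (\<Sum>l<m. 0)"
      proof (rule sum_strict_mono_ex1)
        show "\<forall>l\<in>{..<m}. (if l < Suc j then 2 * (ds ! l - c) * (cmod (\<alpha> l))\<^sup>2 else 0) \<le> 0"
          using dl by (auto intro!: mult_nonpos_nonneg simp: less_imp_le)
        show "\<exists>l\<in>{..<m}. (if l < Suc j then 2 * (ds ! l - c) * (cmod (\<alpha> l))\<^sup>2 else 0) < 0"
          using i j dl[OF i(1)] by (intro bexI[of _ i]) (auto intro!: mult_neg_pos)
      qed simp
      then show ?thesis by simp
    qed
    finally show "hform (2 * m) (pencil B c) (\<lambda>p. \<Sum>i<Suc j. \<alpha> i * ?Z i p) < 0" .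
  qed
next
  assume "negdim (2 * m) (pencil B c) (Suc j)"
  then obtain Z :: "nat \<Rightarrow> nat \<Rightarrow> complex" where
    Z: "\<And>\<alpha>. \<exists>i<Suc j. \<alpha> i \<noteq> 0 \<Longrightarrow> hform (2 * m) (pencil B c) (\<lambda>p. \<Sum>i<Suc j. \<alpha> i * Z i p) < 0"
    unfolding negdim_def by blast
  obtain X :: "nat \<Rightarrow> nat \<Rightarrow> real" where
    X: "\<And>z :: nat \<Rightarrow> complex. \<And>p. p < 2 * m \<Longrightarrow>
       z p = (\<Sum>r<2 * m. (\<Sum>q<2 * m. of_real (X r q) * z q) * of_real (M $$ (r, p)))"
    using williamson_coordinates by blast
  define co where "co = (\<lambda>(z :: nat \<Rightarrow> complex) r. \<Sum>q<2 * m. of_real (X r q) * z q)"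
  show "ds ! j < c"
  proof (rule ccontr)
    assume ge: "\<not> ds ! j < c"
    \<comment> \<open>Each condition puts the coordinates of block \<open>l\<close> <
      \<open>j\<close> on the line b = - i a, where the block is nonnegative. The blocks from
      \<open>j\<close> on are nonnegative by themselves, because their values are at least
      \<open>c\<close>.\<close>
    obtain \<alpha> where \<alpha>: "\<exists>i<Suc j. \<alpha> i \<noteq> 0"
      and kill: "\<And>l. l < j \<Longrightarrow> (\<Sum>i<Suc j. (co (Z i) (Suc (2 * l)) + \<i> * co (Z i) (2 * l)) * \<alpha> i) = 0"
      using homogeneous_system_nontrivial[of j "Suc j" "\<lambda>l i. co (Z i) (Suc (2 * l)) + \<i> * co (Z i) (2 * l)"]
      by blast
    define z where "z = (\<lambda>p. \<Sum>i<Suc j. \<alpha> i * Z i p)"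
    have co_sum: "co z r = (\<Sum>i<Suc j. \<alpha> i * co (Z i) r)" for r
      unfolding co_def z_def sum_distrib_left
      by (subst sum.swap) (simp add: mult_ac)
    have "hform (2 * m) (pencil B c) z =
      (\<Sum>l<m. ds ! l * ((cmod (co z (2 * l)))\<^sup>2 + (cmod (co z (Suc (2 * l))))\<^sup>2) -
         2 * c * (Re (co z (2 * l)) * Im (co z (Suc (2 * l))) - Re (co z (Suc (2 * l))) * Im (co z (2 * l))))"
      by (intro williamson_hform) (simp add: co_def, rule X)
    also have "\<dots> \<ge> 0"
    proof (intro sum_nonneg)
      fix l assume "l \<in> {..<m}"
      then have l: "l < m" by simp
      let ?a = "co z (2 * l)" and ?b = "co z (Suc (2 * l))"
      show "0 \<le> ds ! l * ((cmod ?a)\<^sup>2 + (cmod ?b)\<^sup>2) - 2 * c * (Re ?a * Im ?b - Re ?b * Im ?a)"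
      proof (cases "l < j")
        case True
        have "?b + \<i> * ?a = 0"
          using kill[OF True] unfolding co_sum
          by (simp add: algebra_simps sum.distrib sum_distrib_left del: sum.lessThan_Suc)
        then have b: "?b = - (\<i> * ?a)" by (simp add: eq_neg_iff_add_eq_0)
        have "Re ?a * Im ?b - Re ?b * Im ?a = - (cmod ?a)\<^sup>2"
          unfolding b cmod_power2 by (simp add: power2_eq_square)
        moreover have "0 \<le> c * (cmod ?a)\<^sup>2" using c by simp
        moreover have "0 \<le> ds ! l * ((cmod ?a)\<^sup>2 + (cmod ?b)\<^sup>2)"
          using pos[of "ds ! l"] l len by (intro mult_nonneg_nonneg add_nonneg_nonneg) (auto simp: less_imp_le)
        ultimately show ?thesis by simp
      next
        case False
        then have "c \<le> ds ! l"
          using srt l len ge sorted_nth_mono[of ds j l] by simp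
        then have "c * ((cmod ?a)\<^sup>2 + (cmod ?b)\<^sup>2) \<le> ds ! l * ((cmod ?a)\<^sup>2 + (cmod ?b)\<^sup>2)"
          by (intro mult_right_mono) auto
        moreover have "2 * (Re ?a * Im ?b - Re ?b * Im ?a) \<le> (cmod ?a)\<^sup>2 + (cmod ?b)\<^sup>2"
          using sum_squares_ge_zero[of "Re ?a - Im ?b" "Re ?b + Im ?a"]
          unfolding cmod_power2 by (simp add: power2_eq_square algebra_simps)
        then have "c * (2 * (Re ?a * Im ?b - Re ?b * Im ?a)) \<le> c * ((cmod ?a)\<^sup>2 + (cmod ?b)\<^sup>2)"
          using c by (rule mult_left_mono)
        ultimately show ?thesis by (simp add: mult_ac)
      qed
    qed
    finally show False using Z[OF \<alpha>] by (simp add: z_def)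
  qed
qed

end


text \<open>The inertia criterion holds for every list that arises from some Williamson normal form,
  and its right-hand side depends on \<open>B\<close> alone. Two such lists therefore pass the same
  thresholds, and the definite description is justified.\<close>

lemma symp_spectrum:
  assumes "spd_mat (2 * m) B"
  shows "length (symp_spectrum m B) = m \<and> sorted (symp_spectrum m B) \<and> (\<forall>d \<in> set (symp_spectrum m B). 0 < d) \<and>
     (\<exists>M. symplectic m M \<and>
        M * B * transpose_mat M = diag_block_mat (map (\<lambda>d. d \<cdot>\<^sub>m 1\<^sub>m 2) (symp_spectrum m B)))"
proof -
  let ?P = "\<lambda>ds. length ds = m \<and> sorted ds \<and> (\<forall>d \<in> set ds. 0 < d) \<and>
     (\<exists>M. symplectic m M \<and> M * B * transpose_mat M = diag_block_mat (map (\<lambda>d. d \<cdot>\<^sub>m 1\<^sub>m 2) ds))"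
  have B: "B \<in> carrier_mat (2 * m) (2 * m)" using assms by (simp add: spd_mat_def)
  have "\<exists>ds M. length ds = m \<and> sorted ds \<and> (\<forall>d \<in> set ds. 0 < d) \<and> symplectic m M \<and>
      M * B * transpose_mat M = diag_block_mat (map (\<lambda>d. d \<cdot>\<^sub>m 1\<^sub>m 2) ds)"
    by (rule williamson[OF B]) (use assms in \<open>auto simp: spd_mat_def\<close>)
  then have ex: "\<exists>ds. ?P ds" by blast
  have inertia: "ds ! j < c \<longleftrightarrow> negdim (2 * m) (pencil B c) (Suc j)" if "?P ds" "j < m" "0 \<le> c" for ds j c
  proof -
    from that obtain M where
      "symplectic m M" "M * B * transpose_mat M = diag_block_mat (map (\<lambda>d. d \<cdot>\<^sub>m 1\<^sub>m 2) ds)"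
      by blast
    from williamson_inertia[OF B this] that show ?thesis by blast
  qed
  have le: "ds ! j \<le> es ! j" if P: "?P ds" "?P es" and j: "j < m" for ds es j
  proof (rule ccontr)
    assume "\<not> ?thesis"
    then have "es ! j < ds ! j" by simp
    moreover have "0 \<le> ds ! j" using P(1) j by (simp add: less_imp_le)
    \<comment> \<open>The threshold is \<open>ds ! j\<close> itself: \<open>es\<close> passes it
      strictly, so the criterion makes \<open>ds\<close> pass it too.\<close>
    ultimately have "ds ! j < ds ! j"
      using inertia[OF P(1) j] inertia[OF P(2) j] by blast
    then show False by simp
  qed
  have "ds = es" if P: "?P ds" "?P es" for ds es
  proof (rule nth_equalityI)
    show "length ds = length es" using P by simp
    fix j assume "j < length ds"
    then show "ds ! j = es ! j" using le[OF P] le[OF P(2,1)] P(1) by (simp add: order_antisym)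
  qed
  with ex have "\<exists>!ds. ?P ds" by blast
  then show ?thesis unfolding symp_spectrum_def by (rule theI')
qed

lemma symp_eig_less_iff:
  assumes "spd_mat (2 * m) B" "1 \<le> j" "j \<le> m" "0 \<le> c"
  shows "symp_eig m B j < c \<longleftrightarrow> negdim (2 * m) (pencil B c) j"
proof -
  note sp = symp_spectrum[OF assms(1)]
  then obtain M where
    "symplectic m M" "M * B * transpose_mat M = diag_block_mat (map (\<lambda>d. d \<cdot>\<^sub>m 1\<^sub>m 2) (symp_spectrum m B))"
    by blast
  moreover have "B \<in> carrier_mat (2 * m) (2 * m)" using assms by (simp add: spd_mat_def)
  ultimately show ?thesis
    using williamson_inertia[of B m M "symp_spectrum m B" "j - 1" c] sp assms by (simp add: symp_eig_def)
qed

lemma symp_eig_pos: "spd_mat (2 * m) B \<Longrightarrow> 1 \<le> j \<Longrightarrow> j \<le> m \<Longrightarrow> 0 < symp_eig m B j"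
  using symp_spectrum[of m B] by (simp add: symp_eig_def)

lemma symp_eig_mono: "spd_mat (2 * m) B \<Longrightarrow> 1 \<le> i \<Longrightarrow> i \<le> j \<Longrightarrow> j \<le> m \<Longrightarrow> symp_eig m B i \<le> symp_eig m B j"
  using symp_spectrum[of m B] by (auto simp: symp_eig_def intro!: sorted_nth_mono)

lemma le_symp_eig_1_iff:
  assumes "spd_mat (2 * m) B" "1 \<le> m" "0 \<le> c"
  shows "c \<le> symp_eig m B 1 \<longleftrightarrow> (\<forall>z. 0 \<le> hform (2 * m) (pencil B c) z)"
  using symp_eig_less_iff[OF assms(1) le_refl assms(2,3), unfolded negdim_1_iff] by (meson not_less)

subsection \<open>Positivity of Toeplitz forms and of their symbols\<close>

lemma circ_finite: "finite_measure circ"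
  by (rule finite_measure_lebesgue_on) (rule lmeasurable_interval)

lemma circ_integrable_bounded:
  fixes f :: "real \<Rightarrow> 'b :: {banach, second_countable_topology}"
  assumes "f \<in> borel_measurable circ" "AE \<theta> in circ. norm (f \<theta>) \<le> C"
  shows "integrable circ f"
  using finite_measure.integrable_const_bound[OF circ_finite] assms by blast

lemma measurable_comp_cis:
  assumes "continuous_on (sphere 0 1) h"
  shows "(\<lambda>\<theta>. h (cis \<theta>)) \<in> borel_measurable circ"
proof (rule continuous_imp_measurable_on_sets_lebesgue)
  show "continuous_on {- pi..pi} (\<lambda>\<theta>. h (cis \<theta>))"
    by (rule continuous_on_compose2[OF assms]) (auto intro!: continuous_intros)
qed auto

text \<open>On the unit circle a real polynomial in the real and imaginary parts is a Laurent
  polynomial in z; a power of z clears the negative exponents. That power has modulus 1, so the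
  square of the real polynomial equals the squared modulus of an ordinary polynomial.\<close>

lemma real_polynomial_cis:
  fixes f :: "complex \<Rightarrow> real"
  assumes "real_polynomial_function f"
  shows "\<exists>N (p :: complex poly). \<forall>\<theta>. of_real (f (cis \<theta>)) * cis \<theta> ^ N = poly p (cis \<theta>)"
  using assms
proof (induction rule: real_polynomial_function.induct)
  case (linear f)
  then interpret bounded_linear f .
  have "of_real (f (cis \<theta>)) * cis \<theta> ^ 1 =
    poly [:Complex (f 1 / 2) (f \<i> / 2), 0, Complex (f 1 / 2) (- f \<i> / 2):] (cis \<theta>)" for \<theta>
  proof -
    have "cis \<theta> = cos \<theta> *\<^sub>R 1 + sin \<theta> *\<^sub>R \<i>" by (simp add: complex_eq_iff)
    then have "f (cis \<theta>) = f (cos \<theta> *\<^sub>R 1) + f (sin \<theta> *\<^sub>R \<i>)" by (simp only: add)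
    then have f: "f (cis \<theta>) = cos \<theta> * f 1 + sin \<theta> * f \<i>" by (simp only: scale real_scaleR_def)
    have "(sin \<theta>)\<^sup>2 = 1 - (cos \<theta>)\<^sup>2"
      by (rule sin_squared_eq)
    then have s: "sin \<theta> * (sin \<theta> * t) = t - cos \<theta> * (cos \<theta> * t)" for t
      by (simp add: power2_eq_square mult.assoc[symmetric] left_diff_distrib)
    show ?thesis
      unfolding f by (simp add: complex_eq_iff) (simp add: algebra_simps s diff_divide_distrib)
  qed
  then show ?case by blast
next
  case (const c)
  show ?case by (intro exI[of _ 0] exI[of _ "[:of_real c:]"]) simp
next
  case (add f g)
  then obtain N p M q where
    f: "\<And>\<theta>. of_real (f (cis \<theta>)) * cis \<theta> ^ N = poly p (cis \<theta>)" and
    g: "\<And>\<theta>. of_real (g (cis \<theta>)) * cis \<theta> ^ M = poly q (cis \<theta>)" by blast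
  have "of_real (f (cis \<theta>) + g (cis \<theta>)) * cis \<theta> ^ (N + M) = poly (p * monom 1 M + q * monom 1 N) (cis \<theta>)" for \<theta>
    by (simp add: poly_monom f[symmetric] g[symmetric] algebra_simps power_add)
  then show ?case by blast
next
  case (mult f g)
  then obtain N p M q where
    f: "\<And>\<theta>. of_real (f (cis \<theta>)) * cis \<theta> ^ N = poly p (cis \<theta>)" and
    g: "\<And>\<theta>. of_real (g (cis \<theta>)) * cis \<theta> ^ M = poly q (cis \<theta>)" by blast
  have "of_real (f (cis \<theta>) * g (cis \<theta>)) * cis \<theta> ^ (N + M) = poly (p * q) (cis \<theta>)" for \<theta>
    by (simp add: f[symmetric] g[symmetric] algebra_simps power_add)
  then show ?case by blast
qed

section \<open>Weights with nonnegative integrals against squared moduli of polynomials\<close>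

context
  fixes g :: "real \<Rightarrow> real" and C :: real
  assumes gm: "g \<in> borel_measurable circ" and gb: "AE \<theta> in circ. \<bar>g \<theta>\<bar> \<le> C"
    and gp: "\<And>p. 0 \<le> (LINT \<theta>|circ. g \<theta> * (cmod (poly p (cis \<theta>)))\<^sup>2)"
begin

text \<open>Dominated convergence, in the form used twice below: from polynomials to continuous
  functions, and from those to indicators of compact sets.\<close>

lemma weighted_integral_limit:
  assumes m: "\<And>n. (\<lambda>\<theta>. s n \<theta>) \<in> borel_measurable circ"
    and b: "\<And>n \<theta>. \<bar>s n \<theta>\<bar> \<le> B"
    and lim: "\<And>\<theta>. (\<lambda>n. s n \<theta>) \<longlonglongrightarrow> t \<theta>"
    and nn: "\<And>n. 0 \<le> (LINT \<theta>|circ. g \<theta> * s n \<theta>)"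
  shows "0 \<le> (LINT \<theta>|circ. g \<theta> * t \<theta>)"
proof -
  have tm: "t \<in> borel_measurable circ"
    by (rule borel_measurable_LIMSEQ_real[OF lim m])
  have "(\<lambda>n. LINT \<theta>|circ. g \<theta> * s n \<theta>) \<longlonglongrightarrow> (LINT \<theta>|circ. g \<theta> * t \<theta>)"
  proof (rule integral_dominated_convergence[where w = "\<lambda>_. C * B"])
    show "integrable circ (\<lambda>_. C * B)"
      by (rule finite_measure.integrable_const[OF circ_finite])
    show "AE \<theta> in circ. (\<lambda>n. g \<theta> * s n \<theta>) \<longlonglongrightarrow> g \<theta> * t \<theta>"
      by (intro AE_I2 tendsto_mult_left lim)
    show "AE \<theta> in circ. norm (g \<theta> * s n \<theta>) \<le> C * B" for n
      using gb by eventually_elim (use b in \<open>auto simp: abs_mult intro!: mult_mono order_trans[OF abs_ge_zero]\<close>)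
  qed (use gm m tm in \<open>auto intro!: borel_measurable_times\<close>)
  then show ?thesis by (rule LIMSEQ_le_const) (use nn in auto)
qed

text \<open>Stone--Weierstrass is applied to the square root, so that the approximants are squared moduli
  of polynomials.\<close>

lemma weighted_integral_continuous_nonneg:
  fixes h :: "complex \<Rightarrow> real"
  assumes h: "continuous_on (sphere 0 1) h" and h0: "\<And>z. 0 \<le> h z"
  shows "0 \<le> (LINT \<theta>|circ. g \<theta> * h (cis \<theta>))"
proof -
  have cs: "continuous_on (sphere 0 1) (\<lambda>z. sqrt (h z))" by (intro continuous_intros h)
  have "\<exists>f. real_polynomial_function f \<and> (\<forall>z\<in>sphere 0 1. \<bar>sqrt (h z) - f z\<bar> < 1 / real (Suc n))" for n
    using Stone_Weierstrass_real_polynomial_function[OF compact_sphere cs, of "1 / real (Suc n)"] by (metis of_nat_0_less_iff zero_less_Suc zero_less_divide_1_iff)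
  then obtain f where f: "\<And>n. real_polynomial_function (f n)"
    "\<And>n z. z \<in> sphere 0 1 \<Longrightarrow> \<bar>sqrt (h z) - f n z\<bar> < 1 / real (Suc n)" by metis
  have "bounded ((\<lambda>z. sqrt (h z)) ` sphere 0 1)"
    by (intro compact_imp_bounded compact_continuous_image cs compact_sphere)
  then obtain S where S: "\<And>z. z \<in> sphere 0 1 \<Longrightarrow> \<bar>sqrt (h z)\<bar> \<le> S"
    unfolding bounded_iff by (metis imageI real_norm_def)
  have fb: "\<bar>f n (cis \<theta>)\<bar> \<le> S + 1" for n \<theta>
  proof -
    have "cis \<theta> \<in> sphere 0 1" by simp
    from S[OF this] f(2)[OF this, of n] have "\<bar>f n (cis \<theta>)\<bar> < S + 1 / real (Suc n)" by linarith
    also have "1 / real (Suc n) \<le> 1" by simp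
    finally show ?thesis by simp
  qed
  have "0 \<le> (LINT \<theta>|circ. g \<theta> * (sqrt (h (cis \<theta>)))\<^sup>2)"
  proof (rule weighted_integral_limit[where s = "\<lambda>n \<theta>. (f n (cis \<theta>))\<^sup>2" and B = "(S + 1)\<^sup>2"])
    show "(\<lambda>\<theta>. (f n (cis \<theta>))\<^sup>2) \<in> borel_measurable circ" for n
      by (rule measurable_comp_cis) (intro continuous_intros continuous_at_imp_continuous_on ballI continuous_real_polymonial_function f)
    show "\<bar>(f n (cis \<theta>))\<^sup>2\<bar> \<le> (S + 1)\<^sup>2" for n \<theta>
      using power_mono[OF fb[of n \<theta>], of 2] by simp
    show "(\<lambda>n. (f n (cis \<theta>))\<^sup>2) \<longlonglongrightarrow> (sqrt (h (cis \<theta>)))\<^sup>2" for \<theta>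
    proof (intro tendsto_power)
      have "(\<lambda>n. f n (cis \<theta>) - sqrt (h (cis \<theta>))) \<longlonglongrightarrow> 0"
      proof (rule Lim_null_comparison[where g = "\<lambda>n. 1 / real (Suc n)"])
        show "(\<lambda>n. 1 / real (Suc n)) \<longlonglongrightarrow> 0" by (rule LIMSEQ_Suc[OF lim_1_over_n])
        show "\<forall>\<^sub>F n in sequentially. norm (f n (cis \<theta>) - sqrt (h (cis \<theta>))) \<le> 1 / real (Suc n)"
          using f(2)[of "cis \<theta>"] by (intro always_eventually allI) (simp add: abs_minus_commute less_imp_le)
      qed
      then show "(\<lambda>n. f n (cis \<theta>)) \<longlonglongrightarrow> sqrt (h (cis \<theta>))" by (simp add: LIM_zero_iff)
    qed
    show "0 \<le> (LINT \<theta>|circ. g \<theta> * (f n (cis \<theta>))\<^sup>2)" for n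
    proof -
      obtain N p where p: "\<And>\<theta>. of_real (f n (cis \<theta>)) * cis \<theta> ^ N = poly p (cis \<theta>)"
        using real_polynomial_cis[OF f(1)[of n]] by blast
      have "(f n (cis \<theta>))\<^sup>2 = (cmod (poly p (cis \<theta>)))\<^sup>2" for \<theta>
        by (simp add: p[symmetric] norm_mult norm_power)
      then show ?thesis using gp[of p] by simp
    qed
  qed
  then show ?thesis using h0 by simp
qed

text \<open>The indicator is the pointwise limit of continuous tents built from the distance to
  \<open>K\<close>. The empty set is excluded since \<open>infdist\<close> to it is 0 by convention,
  which would make the tents constantly 1.\<close>

lemma weighted_integral_compact:
  assumes K: "compact K" "K \<noteq> {}"
  shows "0 \<le> (LINT \<theta>|circ. g \<theta> * indicat_real K (cis \<theta>))"
proof (rule weighted_integral_limit[where s = "\<lambda>n \<theta>. max 0 (1 - real n * infdist (cis \<theta>) K)" and B = 1])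
  have cont: "continuous_on (sphere 0 1) (\<lambda>z. max 0 (1 - real n * infdist z K))" for n
    by (intro continuous_intros)
  show "(\<lambda>\<theta>. max 0 (1 - real n * infdist (cis \<theta>) K)) \<in> borel_measurable circ" for n
    by (rule measurable_comp_cis[OF cont])
  show "0 \<le> (LINT \<theta>|circ. g \<theta> * max 0 (1 - real n * infdist (cis \<theta>) K))" for n
    by (rule weighted_integral_continuous_nonneg[OF cont]) simp
  show "\<bar>max 0 (1 - real n * infdist (cis \<theta>) K)\<bar> \<le> 1" for n \<theta>
    using infdist_nonneg[of "cis \<theta>" K] by (auto simp: max_def)
  show "(\<lambda>n. max 0 (1 - real n * infdist (cis \<theta>) K)) \<longlonglongrightarrow> indicat_real K (cis \<theta>)" for \<theta>
  proof (cases "cis \<theta> \<in> K")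
    case True
    then show ?thesis by simp
  next
    case False
    then have pos: "infdist (cis \<theta>) K > 0"
      using K infdist_nonneg[of "cis \<theta>" K] in_closed_iff_infdist_zero[OF compact_imp_closed, of K "cis \<theta>"] by fastforce
    obtain n0 :: nat where n0: "1 < real n0 * infdist (cis \<theta>) K"
      using reals_Archimedean3[OF pos] by blast
    have "max 0 (1 - real n * infdist (cis \<theta>) K) = 0" if "n \<ge> n0" for n
    proof -
      have "real n0 * infdist (cis \<theta>) K \<le> real n * infdist (cis \<theta>) K"
        using that pos by (intro mult_right_mono) auto
      with n0 show ?thesis by simp
    qed
    then have "\<forall>\<^sub>F n in sequentially. max 0 (1 - real n * infdist (cis \<theta>) K) = 0"
      unfolding eventually_sequentially by blast
    then show ?thesis using False by (simp add: tendsto_eventually)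
  qed
qed

text \<open>Were \<open>g\<close> negative on a set of positive measure, inner regularity would give
  a compact part \<open>T\<close> of positive measure, whose image on the circle is again compact.
  The integral of \<open>g\<close> over \<open>T\<close> would be both nonnegative and strictly
  negative.\<close>

lemma AE_nonneg_of_weighted_integrals: "AE \<theta> in circ. 0 \<le> g \<theta>"
proof -
  \<comment> \<open>The endpoints are left out because \<open>cis\<close> identifies them; they form
    a null set and are restored at the end.\<close>
  define S where "S = {\<theta> \<in> {- pi<..<pi}. g \<theta> < 0}"
  have Sc: "{\<theta> \<in> space circ. g \<theta> < 0} \<in> sets circ" using gm by measurable
  have "{- pi<..<pi} \<inter> {\<theta> \<in> space circ. g \<theta> < 0} \<in> sets lebesgue"
    using Sc by (intro sets.Int) (auto simp: sets_restrict_space_iff)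
  also have "{- pi<..<pi} \<inter> {\<theta> \<in> space circ. g \<theta> < 0} = S" by (auto simp: S_def)
  finally have Sm: "S \<in> sets lebesgue" .
  have null: "S \<in> null_sets lebesgue"
  proof (rule ccontr)
    assume "S \<notin> null_sets lebesgue"
    then have "emeasure lebesgue S > 0" using Sm by (auto simp: null_sets_def zero_less_iff_neq_zero)
    then obtain e :: real where e: "0 < e" "ennreal e \<le> emeasure lebesgue S"
      by (cases "emeasure lebesgue S") (auto simp: ennreal_less_iff intro: that[of 1])
    obtain T where T: "closed T" "T \<subseteq> S" "emeasure lebesgue (S - T) < ennreal e"
      using sets_lebesgue_inner_closed[OF Sm e(1)] by metis
    have Tm: "T \<in> sets lebesgue" using T(1) by simp
    have Tpi: "T \<subseteq> {- pi<..<pi}" using T(2) by (auto simp: S_def)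
    have "T \<notin> null_sets lebesgue"
    proof
      assume "T \<in> null_sets lebesgue"
      then have "emeasure lebesgue (S - T) = emeasure lebesgue S"
        using Sm by (rule emeasure_Diff_null_set)
      with T(3) e(2) show False by simp
    qed
    then have Tne: "T \<noteq> {}" by auto
    have "compact T"
      using closed_Int_compact[OF T(1) compact_Icc[of "- pi" pi]] Tpi
      by (simp add: Int_absorb2 subset_iff less_imp_le)
    then have K: "compact (cis ` T)" by (intro compact_continuous_image continuous_intros)
    \<comment> \<open>The only coincidence of \<open>cis\<close> on the closed interval is between
      its endpoints, and \<open>T\<close> contains neither.\<close>
    have ind: "indicat_real (cis ` T) (cis \<theta>) = indicat_real T \<theta>" if \<theta>: "\<theta> \<in> {- pi..pi}" for \<theta>
    proof -
      have "\<theta> \<in> T" if "t \<in> T" "cis \<theta> = cis t" for t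
      proof -
        have t: "- pi < t" "t < pi" using Tpi that by auto
        then have At: "Arg (cis t) = t" by (intro Arg_cis) auto
        show ?thesis
        proof (cases "\<theta> = - pi")
          case True
          then have "cis \<theta> = cis pi" by (simp add: complex_eq_iff)
          then have "Arg (cis t) = pi" using that(2) Arg_cis[of pi] by simp
          then show ?thesis using At t by simp
        next
          case False
          then have "Arg (cis \<theta>) = \<theta>" using \<theta> by (intro Arg_cis) auto
          then have "\<theta> = t" using At that(2) by metis
          then show ?thesis using that(1) by metis
        qed
      qed
      then show ?thesis by (auto simp: indicator_def)
    qed
    have "0 \<le> (LINT \<theta>|circ. g \<theta> * indicat_real (cis ` T) (cis \<theta>))"
      using K Tne by (intro weighted_integral_compact) auto
    also have "\<dots> = (LINT \<theta>|circ. g \<theta> * indicat_real T \<theta>)"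
      by (rule Bochner_Integration.integral_cong) (auto simp: ind)
    finally have nn: "0 \<le> (LINT \<theta>|circ. g \<theta> * indicat_real T \<theta>)" .
    have Tc: "T \<in> sets circ" using Tm Tpi by (auto simp: sets_restrict_space_iff)
    have meas: "(\<lambda>\<theta>. g \<theta> * indicat_real T \<theta>) \<in> borel_measurable circ"
      using gm Tc by measurable
    have "AE \<theta> in circ. norm (g \<theta> * indicat_real T \<theta>) \<le> C"
      using gb by eventually_elim (auto simp: indicator_def)
    then have int: "integrable circ (\<lambda>\<theta>. g \<theta> * indicat_real T \<theta>)"
      by (rule circ_integrable_bounded[OF meas])
    have neg: "g \<theta> * indicat_real T \<theta> \<le> 0" for \<theta>
      using T(2) by (auto simp: indicator_def S_def)
    have "(LINT \<theta>|circ. - (g \<theta> * indicat_real T \<theta>)) = 0"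
      using nn neg integral_nonneg_AE[of "\<lambda>\<theta>. - (g \<theta> * indicat_real T \<theta>)" circ] by simp
    then have "AE \<theta> in circ. - (g \<theta> * indicat_real T \<theta>) = 0"
      by (subst (asm) integral_nonneg_eq_0_iff_AE) (use int neg in auto)
    then have "AE \<theta> in circ. \<theta> \<notin> T"
      by eventually_elim (use T(2) in \<open>auto simp: indicator_def S_def\<close>)
    then have "AE \<theta> in lebesgue. \<theta> \<in> {- pi..pi} \<longrightarrow> \<theta> \<notin> T"
      by (subst (asm) AE_restrict_space_iff) auto
    then have "AE \<theta> in lebesgue. \<theta> \<notin> T"
      by eventually_elim (use Tpi in auto)
    then show False using \<open>T \<notin> null_sets lebesgue\<close> Tm AE_iff_null_sets[OF Tm] by simp
  qed
  have "{- pi, pi} \<in> null_sets lebesgue"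
    by (rule null_sets_completionI) (simp add: finite_imp_null_set_lborel)
  with null have "S \<union> {- pi, pi} \<in> null_sets lebesgue" by (rule null_sets.Un)
  then have "AE \<theta> in lebesgue. \<theta> \<notin> S \<union> {- pi, pi}" by (rule AE_not_in)
  then have "AE \<theta> in lebesgue. \<theta> \<in> {- pi..pi} \<longrightarrow> 0 \<le> g \<theta>"
    by eventually_elim (auto simp: S_def)
  then show ?thesis by (subst AE_restrict_space_iff) auto
qed

end

section \<open>Block Toeplitz forms as integrals of the symbol\<close>

definition fcoeff :: "(real \<Rightarrow> complex) \<Rightarrow> int \<Rightarrow> complex" where
  "fcoeff g n = of_real (1 / (2 * pi)) * (LINT \<theta>|circ. g \<theta> * exp (- \<i> * of_int n * of_real \<theta>))"

text \<open>The infinite block matrix in scalar indices. Its truncations are obtained by bounding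
  the range of summation of a form, so one function stands for all of them.\<close>

definition toep :: "nat \<Rightarrow> (nat \<Rightarrow> nat \<Rightarrow> real \<Rightarrow> complex) \<Rightarrow> nat \<Rightarrow> nat \<Rightarrow> complex" where
  "toep d H p q = fcoeff (H (p mod d) (q mod d)) (int (p div d) - int (q div d))"

definition bounded_symbol :: "nat \<Rightarrow> (nat \<Rightarrow> nat \<Rightarrow> real \<Rightarrow> complex) \<Rightarrow> bool" where
  "bounded_symbol d H \<longleftrightarrow> (\<forall>r<d. \<forall>s<d. H r s \<in> borel_measurable circ \<and> (\<exists>C. AE \<theta> in circ. cmod (H r s \<theta>) \<le> C))"

text \<open>The vector-valued trigonometric polynomial whose coefficients are the consecutive blocks
  of \<open>z\<close>.\<close>

definition tpoly :: "nat \<Rightarrow> nat \<Rightarrow> (nat \<Rightarrow> complex) \<Rightarrow> real \<Rightarrow> nat \<Rightarrow> complex" where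
  "tpoly d n z \<theta> r = (\<Sum>j<n. z (j * d + r) * cis (real j * \<theta>))"

lemma sum_blocks: "(\<Sum>p<n * d. f p) = (\<Sum>i<n. \<Sum>r<d. f (i * d + r))"
  for f :: "nat \<Rightarrow> 'a :: comm_monoid_add"
proof -
  have "(\<Sum>p<n * d. f p) = (\<Sum>i<n. sum f {i * d..<i * d + d})"
    by (rule sum.nat_group[symmetric])
  also have "\<dots> = (\<Sum>i<n. \<Sum>r<d. f (i * d + r))"
  proof (rule sum.cong[OF refl])
    fix i
    show "sum f {i * d..<i * d + d} = (\<Sum>r<d. f (i * d + r))"
      using sum.shift_bounds_nat_ivl[of f 0 "i * d" d] by (simp add: atLeast0LessThan add.commute)
  qed
  finally show ?thesis .
qed

lemma exp_diff_cis: "exp (- \<i> * of_int (int i - int j) * of_real \<theta>) = cnj (cis (real i * \<theta>)) * cis (real j * \<theta>)"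
proof -
  have "exp (- \<i> * of_int (int i - int j) * of_real \<theta>) = exp (\<i> * of_real ((real j - real i) * \<theta>))"
    by (simp add: algebra_simps)
  also have "\<dots> = cis ((real j - real i) * \<theta>)" by (simp only: cis_conv_exp)
  also have "\<dots> = cnj (cis (real i * \<theta>)) * cis (real j * \<theta>)"
    by (simp add: cis_cnj cis_mult left_diff_distrib)
  finally show ?thesis .
qed

lemma exp_cmod: "cmod (exp (- \<i> * of_int n * of_real \<theta>)) = 1"
  by (simp add: norm_exp_eq_Re)

lemma borel_measurable_cnj: "f \<in> borel_measurable M \<Longrightarrow> (\<lambda>x. cnj (f x)) \<in> borel_measurable M"
  using measurable_compose[of f M borel cnj borel] borel_measurable_continuous_onI[of cnj]
    continuous_on_cnj[OF continuous_on_id] by simp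

lemma bounded_symbolD:
  assumes "bounded_symbol d H" "r < d" "s < d"
  shows "H r s \<in> borel_measurable circ" "\<exists>C. AE \<theta> in circ. cmod (H r s \<theta>) \<le> C"
  using assms by (auto simp: bounded_symbol_def)

lemma fcoeff_integrable:
  assumes "g \<in> borel_measurable circ" "AE \<theta> in circ. cmod (g \<theta>) \<le> C"
  shows "integrable circ (\<lambda>\<theta>. g \<theta> * exp (- \<i> * of_int n * of_real \<theta>))"
proof (rule circ_integrable_bounded)
  have "(\<lambda>\<theta>. exp (- \<i> * of_int n * of_real \<theta>)) \<in> borel_measurable circ"
    by (rule continuous_imp_measurable_on_sets_lebesgue) (auto intro!: continuous_intros)
  with assms(1) show "(\<lambda>\<theta>. g \<theta> * exp (- \<i> * of_int n * of_real \<theta>)) \<in> borel_measurable circ"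
    by (rule borel_measurable_times)
  show "AE \<theta> in circ. norm (g \<theta> * exp (- \<i> * of_int n * of_real \<theta>)) \<le> C"
    using assms(2) unfolding norm_mult exp_cmod by simp
qed

lemma sform_tpoly:
  "sform d (\<lambda>r s. H r s \<theta>) (\<lambda>r. cnj (tpoly d n x \<theta> r)) (tpoly d n y \<theta>) =
    (\<Sum>r<d. \<Sum>s<d. \<Sum>i<n. \<Sum>j<n. cnj (x (i * d + r)) * y (j * d + s) *
       (H r s \<theta> * exp (- \<i> * of_int (int i - int j) * of_real \<theta>)))"
  unfolding sform_def tpoly_def exp_diff_cis cnj_sum complex_cnj_mult
proof (intro sum.cong refl)
  fix r s
  show "H r s \<theta> * (\<Sum>i<n. cnj (x (i * d + r)) * cnj (cis (real i * \<theta>))) * (\<Sum>j<n. y (j * d + s) * cis (real j * \<theta>)) =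
    (\<Sum>i<n. \<Sum>j<n. cnj (x (i * d + r)) * y (j * d + s) *
       (H r s \<theta> * (cnj (cis (real i * \<theta>)) * cis (real j * \<theta>))))"
    (is "_ * ?A * ?B = _")
  proof -
    have "H r s \<theta> * ?A * ?B = H r s \<theta> * (?A * ?B)" by (rule mult.assoc)
    also have "?A * ?B = (\<Sum>i<n. \<Sum>j<n. (cnj (x (i * d + r)) * cnj (cis (real i * \<theta>))) * (y (j * d + s) * cis (real j * \<theta>)))"
      by (rule sum_product)
    finally show ?thesis
      by (simp only: sum_distrib_left) (intro sum.cong refl, simp only: mult_ac)
  qed
qed

lemma sform_tpoly_integrable:
  assumes H: "bounded_symbol d H"
  shows "integrable circ (\<lambda>\<theta>. sform d (\<lambda>r s. H r s \<theta>) (\<lambda>r. cnj (tpoly d n x \<theta> r)) (tpoly d n y \<theta>))"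
proof -
  have int: "integrable circ (\<lambda>\<theta>. c * (H r s \<theta> * exp (- \<i> * of_int k * of_real \<theta>)))" if "r < d" "s < d" for r s k c
    using bounded_symbolD[OF H that] fcoeff_integrable by (intro integrable_mult_right) blast
  then show ?thesis
    unfolding sform_tpoly by (intro Bochner_Integration.integrable_sum int) simp_all
qed

text \<open>Expanding the trigonometric polynomials produces the exponentials of the Fourier
  coefficients with exactly the index differences of the Toeplitz matrix. Every later transfer
  between truncations and symbol, for the forms and for the numerical ranges, uses this
  identity.\<close>

lemma sform_toep:
  assumes H: "bounded_symbol d H"
  shows "sform (n * d) (toep d H) (\<lambda>p. cnj (x p)) y =
    of_real (1 / (2 * pi)) *
      (LINT \<theta>|circ. sform d (\<lambda>r s. H r s \<theta>) (\<lambda>r. cnj (tpoly d n x \<theta> r)) (tpoly d n y \<theta>))"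
proof -
  let ?f = "\<lambda>r s i j \<theta>. cnj (x (i * d + r)) * y (j * d + s) * (H r s \<theta> * exp (- \<i> * of_int (int i - int j) * of_real \<theta>))"
  have int: "integrable circ (?f r s i j)" if "r < d" "s < d" for r s i j
    using bounded_symbolD[OF H that] fcoeff_integrable by (intro integrable_mult_right) blast
  have "sform d (\<lambda>r s. H r s \<theta>) (\<lambda>r. cnj (tpoly d n x \<theta> r)) (tpoly d n y \<theta>) =
      (\<Sum>r<d. \<Sum>s<d. \<Sum>i<n. \<Sum>j<n. ?f r s i j \<theta>)" for \<theta>
    by (rule sform_tpoly)
  then have "(LINT \<theta>|circ. sform d (\<lambda>r s. H r s \<theta>) (\<lambda>r. cnj (tpoly d n x \<theta> r)) (tpoly d n y \<theta>)) =
      (LINT \<theta>|circ. (\<Sum>r<d. \<Sum>s<d. \<Sum>i<n. \<Sum>j<n. ?f r s i j \<theta>))" by simp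
  also have "\<dots> = (\<Sum>r<d. LINT \<theta>|circ. (\<Sum>s<d. \<Sum>i<n. \<Sum>j<n. ?f r s i j \<theta>))"
    by (rule Bochner_Integration.integral_sum) (intro Bochner_Integration.integrable_sum int; simp)
  also have "\<dots> = (\<Sum>r<d. \<Sum>s<d. LINT \<theta>|circ. (\<Sum>i<n. \<Sum>j<n. ?f r s i j \<theta>))"
    by (intro sum.cong refl Bochner_Integration.integral_sum) (intro Bochner_Integration.integrable_sum int; simp)
  also have "\<dots> = (\<Sum>r<d. \<Sum>s<d. \<Sum>i<n. \<Sum>j<n. LINT \<theta>|circ. ?f r s i j \<theta>)"
  proof (intro sum.cong refl)
    fix r s assume "r \<in> {..<d}" "s \<in> {..<d}"
    then have *: "integrable circ (?f r s i j)" for i j using int by simp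
    show "(LINT \<theta>|circ. (\<Sum>i<n. \<Sum>j<n. ?f r s i j \<theta>)) = (\<Sum>i<n. \<Sum>j<n. LINT \<theta>|circ. ?f r s i j \<theta>)"
      by (simp only: Bochner_Integration.integral_sum Bochner_Integration.integrable_sum *)
  qed
  finally have eq: "(LINT \<theta>|circ. sform d (\<lambda>r s. H r s \<theta>) (\<lambda>r. cnj (tpoly d n x \<theta> r)) (tpoly d n y \<theta>)) = \<dots>" .
  have pull: "(LINT \<theta>|circ. ?f r s i j \<theta>) = cnj (x (i * d + r)) * y (j * d + s) *
      (LINT \<theta>|circ. H r s \<theta> * exp (- \<i> * of_int (int i - int j) * of_real \<theta>))" for r s i j
    by (rule Bochner_Integration.integral_mult_right_zero)
  have "sform (n * d) (toep d H) (\<lambda>p. cnj (x p)) y =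
      (\<Sum>i<n. \<Sum>r<d. \<Sum>j<n. \<Sum>s<d. of_real (1 / (2 * pi)) * (LINT \<theta>|circ. ?f r s i j \<theta>))"
    unfolding sform_def sum_blocks
    by (intro sum.cong refl, unfold pull toep_def fcoeff_def) (simp add: mult_ac)
  also have "\<dots> = (\<Sum>r<d. \<Sum>i<n. \<Sum>j<n. \<Sum>s<d. of_real (1 / (2 * pi)) * (LINT \<theta>|circ. ?f r s i j \<theta>))"
    by (rule sum.swap)
  also have "\<dots> = (\<Sum>r<d. \<Sum>i<n. \<Sum>s<d. \<Sum>j<n. of_real (1 / (2 * pi)) * (LINT \<theta>|circ. ?f r s i j \<theta>))"
    by (rule sum.cong[OF refl], rule sum.cong[OF refl], rule sum.swap)
  also have "\<dots> = (\<Sum>r<d. \<Sum>s<d. \<Sum>i<n. \<Sum>j<n. of_real (1 / (2 * pi)) * (LINT \<theta>|circ. ?f r s i j \<theta>))"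
    by (rule sum.cong[OF refl], rule sum.swap)
  finally show ?thesis unfolding eq by (simp only: sum_distrib_left)
qed

lemma hform_symbol_measurable:
  assumes "bounded_symbol d H" and "\<And>r. r < d \<Longrightarrow> (\<lambda>\<theta>. z \<theta> r) \<in> borel_measurable circ"
  shows "(\<lambda>\<theta>. hform d (\<lambda>r s. H r s \<theta>) (z \<theta>)) \<in> borel_measurable circ"
  unfolding hform_def sform_def
  by (intro borel_measurable_Re measurable_compose[OF _ borel_measurable_Re] borel_measurable_sum borel_measurable_times)
    (use assms in \<open>auto simp: bounded_symbol_def intro: borel_measurable_cnj\<close>)

lemma sform_cmod_le:
  fixes x y :: "nat \<Rightarrow> complex"
  shows "cmod (sform d F x y) \<le> (\<Sum>r<d. \<Sum>s<d. cmod (F r s) * cmod (x r) * cmod (y s))"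
  unfolding sform_def norm_mult[symmetric]
  by (intro order_trans[OF norm_sum] sum_mono order_refl)

lemma hform_symbol_bounded:
  assumes "bounded_symbol d H"
  shows "\<exists>C. AE \<theta> in circ. \<bar>hform d (\<lambda>r s. H r s \<theta>) z\<bar> \<le> C"
proof -
  from assms obtain C where C: "\<And>r s. r < d \<Longrightarrow> s < d \<Longrightarrow> AE \<theta> in circ. cmod (H r s \<theta>) \<le> C r s"
    unfolding bounded_symbol_def by metis
  have "AE \<theta> in circ. \<forall>r\<in>{..<d}. \<forall>s\<in>{..<d}. cmod (H r s \<theta>) \<le> C r s"
    by (intro AE_ball_countable[THEN iffD2] ballI) (auto intro: C)
  then have "AE \<theta> in circ. \<bar>hform d (\<lambda>r s. H r s \<theta>) z\<bar> \<le> (\<Sum>r<d. \<Sum>s<d. C r s * cmod (z r) * cmod (z s))"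
  proof eventually_elim
    case (elim \<theta>)
    have "\<bar>hform d (\<lambda>r s. H r s \<theta>) z\<bar> \<le> cmod (sform d (\<lambda>r s. H r s \<theta>) (\<lambda>p. cnj (z p)) z)"
      unfolding hform_def by (rule abs_Re_le_cmod)
    also have "\<dots> \<le> (\<Sum>r<d. \<Sum>s<d. cmod (H r s \<theta>) * cmod (cnj (z r)) * cmod (z s))"
      by (rule sform_cmod_le)
    also have "\<dots> \<le> (\<Sum>r<d. \<Sum>s<d. C r s * cmod (z r) * cmod (z s))"
      using elim by (intro sum_mono) (auto intro!: mult_right_mono)
    finally show ?case .
  qed
  then show ?thesis by blast
qed

lemma hform_continuous_limit:
  assumes "\<And>r. r < d \<Longrightarrow> (\<lambda>n. zs n r) \<longlonglongrightarrow> z r"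
  shows "(\<lambda>n. hform d F (zs n)) \<longlonglongrightarrow> hform d F z"
  unfolding hform_def sform_def using assms by (intro tendsto_intros) auto

lemma hform_toep:
  assumes H: "bounded_symbol d H"
  shows "hform (n * d) (toep d H) z = 1 / (2 * pi) * (LINT \<theta>|circ. hform d (\<lambda>r s. H r s \<theta>) (tpoly d n z \<theta>))"
proof -
  let ?S = "\<lambda>\<theta>. sform d (\<lambda>r s. H r s \<theta>) (\<lambda>r. cnj (tpoly d n z \<theta> r)) (tpoly d n z \<theta>)"
  have "hform (n * d) (toep d H) z = 1 / (2 * pi) * Re (LINT \<theta>|circ. ?S \<theta>)"
    unfolding hform_def sform_toep[OF H] by simp
  also have "Re (LINT \<theta>|circ. ?S \<theta>) = (LINT \<theta>|circ. Re (?S \<theta>))"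
    using sform_tpoly_integrable[OF H] by (rule integral_Re[symmetric])
  finally show ?thesis by (simp only: hform_def)
qed

lemma toep_nonneg_of_symbol_nonneg:
  assumes H: "bounded_symbol d H" and nn: "AE \<theta> in circ. \<forall>z. 0 \<le> hform d (\<lambda>r s. H r s \<theta>) z"
  shows "0 \<le> hform (n * d) (toep d H) z"
proof -
  have "0 \<le> (LINT \<theta>|circ. hform d (\<lambda>r s. H r s \<theta>) (tpoly d n z \<theta>))"
    by (rule integral_nonneg_AE) (use nn in \<open>eventually_elim, blast\<close>)
  then show ?thesis unfolding hform_toep[OF H] by simp
qed

text \<open>For a fixed vector \<open>x\<close>, test vectors of the form polynomial times
  \<open>x\<close> turn the Toeplitz form into an integral of the scalar function \<open>?g\<close>
  against |p|^2, to which the scalar criterion applies. A countable dense set of vectors and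
  continuity then give one null set for all vectors.\<close>

lemma symbol_nonneg_of_toep_nonneg:
  assumes H: "bounded_symbol d H"
    and nn: "\<And>n z. 0 \<le> hform (n * d) (toep d H) z"
  shows "AE \<theta> in circ. \<forall>z. 0 \<le> hform d (\<lambda>r s. H r s \<theta>) z"
proof -
  have fixed: "AE \<theta> in circ. 0 \<le> hform d (\<lambda>r s. H r s \<theta>) x" for x
  proof -
    let ?g = "\<lambda>\<theta>. hform d (\<lambda>r s. H r s \<theta>) x"
    have m: "?g \<in> borel_measurable circ" by (rule hform_symbol_measurable[OF H]) simp
    obtain C where C: "AE \<theta> in circ. \<bar>?g \<theta>\<bar> \<le> C" using hform_symbol_bounded[OF H] by blast
    have "0 \<le> (LINT \<theta>|circ. ?g \<theta> * (cmod (poly p (cis \<theta>)))\<^sup>2)" for p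
    proof -
      \<comment> \<open>Block \<open>j\<close> is the \<open>j\<close>-th coefficient of
        \<open>p\<close> times \<open>x\<close>, so the associated trigonometric polynomial is
        \<open>p\<close> times \<open>x\<close>.\<close>
      define z where "z = (\<lambda>q. coeff p (q div d) * x (q mod d))"
      define n where "n = Suc (degree p)"
      have tz: "tpoly d n z \<theta> r = poly p (cis \<theta>) * x r" if "r < d" for r \<theta>
      proof -
        have "tpoly d n z \<theta> r = (\<Sum>j<n. coeff p j * x r * cis \<theta> ^ j)"
          unfolding tpoly_def z_def using that by (intro sum.cong refl) (simp add: Complex.DeMoivre)
        then show ?thesis
          by (simp add: poly_altdef n_def lessThan_Suc_atMost sum_distrib_left mult_ac del: sum.atMost_Suc)
      qed
      have "hform d (\<lambda>r s. H r s \<theta>) (tpoly d n z \<theta>) = ?g \<theta> * (cmod (poly p (cis \<theta>)))\<^sup>2" for \<theta>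
      proof -
        have "hform d (\<lambda>r s. H r s \<theta>) (tpoly d n z \<theta>) = hform d (\<lambda>r s. H r s \<theta>) (\<lambda>r. poly p (cis \<theta>) * x r)"
          unfolding hform_def by (intro arg_cong[where f = Re] sform_cong) (auto simp: tz)
        then show ?thesis unfolding hform_scale by (simp only: mult.commute)
      qed
      then have "hform (n * d) (toep d H) z = 1 / (2 * pi) * (LINT \<theta>|circ. ?g \<theta> * (cmod (poly p (cis \<theta>)))\<^sup>2)"
        unfolding hform_toep[OF H] by simp
      then have "(LINT \<theta>|circ. ?g \<theta> * (cmod (poly p (cis \<theta>)))\<^sup>2) = 2 * pi * hform (n * d) (toep d H) z"
        by simp
      with nn[of n z] show ?thesis by simp
    qed
    then show ?thesis by (rule AE_nonneg_of_weighted_integrals[OF m C])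
  qed
  \<comment> \<open>The exceptional null set obtained so far depends on \<open>x\<close>; only
    countably many of them may be united.\<close>
  obtain D :: "complex set" where D: "countable D" "\<And>X. open X \<Longrightarrow> X \<noteq> {} \<Longrightarrow> \<exists>d\<in>D. d \<in> X"
    using countable_dense_setE by blast
  let ?Q = "PiE {..<d} (\<lambda>_. D)"
  have "countable ?Q" by (intro countable_PiE D(1)) simp
  then have "AE \<theta> in circ. \<forall>x\<in>?Q. 0 \<le> hform d (\<lambda>r s. H r s \<theta>) x"
    by (subst AE_ball_countable) (auto intro: fixed)
  then show ?thesis
  proof eventually_elim
    case (elim \<theta>)
    show ?case
    proof
      fix z :: "nat \<Rightarrow> complex"
      have "\<exists>c\<in>D. dist c (z r) < 1 / real (Suc n)" for n r
        using D(2)[of "ball (z r) (1 / real (Suc n))"] by (auto simp: dist_commute)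
      then have ex: "\<exists>c. c \<in> D \<and> dist c (z r) < 1 / real (Suc n)" for n r by blast
      define c where "c = (\<lambda>n r. SOME c. c \<in> D \<and> dist c (z r) < 1 / real (Suc n))"
      have c: "c n r \<in> D" "dist (c n r) (z r) < 1 / real (Suc n)" for n r
        using someI_ex[OF ex[of r n]] by (auto simp: c_def)
      define zs where "zs = (\<lambda>n. restrict (c n) {..<d})"
      have "(\<lambda>n. hform d (\<lambda>r s. H r s \<theta>) (zs n)) \<longlonglongrightarrow> hform d (\<lambda>r s. H r s \<theta>) z"
      proof (rule hform_continuous_limit)
        fix r assume "r < d"
        have "(\<lambda>n. c n r) \<longlonglongrightarrow> z r"
        proof (rule metric_LIMSEQ_I)
          fix e :: real assume "e > 0"
          then obtain n0 where n0: "1 / real (Suc n0) < e" using nat_approx_posE by blast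
          have "dist (c n r) (z r) < e" if "n \<ge> n0" for n
          proof -
            have "1 / real (Suc n) \<le> 1 / real (Suc n0)" using that by (simp add: field_simps)
            then show ?thesis using c(2)[of n r] n0 by linarith
          qed
          then show "\<exists>n0. \<forall>n\<ge>n0. dist (c n r) (z r) < e" by blast
        qed
        then show "(\<lambda>n. zs n r) \<longlonglongrightarrow> z r" using \<open>r < d\<close> by (simp add: zs_def)
      qed
      moreover have "0 \<le> hform d (\<lambda>r s. H r s \<theta>) (zs n)" for n
        using elim c(1) by (auto simp: zs_def)
      ultimately show "0 \<le> hform d (\<lambda>r s. H r s \<theta>) z"
        by (intro LIMSEQ_le_const) auto
    qed
  qed
qed

subsection \<open>Square summable sequences\<close>

lemma cip_sum:
  assumes "x \<in> carrier_vec d" "y \<in> carrier_vec d"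
  shows "cip x y = (\<Sum>r<d. cnj (vec_index x r) * vec_index y r)"
  using assms unfolding cip_def scalar_prod_def
  by (auto simp: atLeast0LessThan mult.commute conjugate_complex_def intro!: sum.cong)

text \<open>Young's inequality with a free weight \<open>a\<close>: unlike a product of norms, its
  right-hand side can be summed term by term along a sequence.\<close>

lemma cip_le:
  assumes "x \<in> carrier_vec d" "y \<in> carrier_vec d" "a > 0"
  shows "cmod (cip x y) \<le> (a * vec_norm2 x + vec_norm2 y / a) / 2"
proof -
  have "u * v \<le> (a * u\<^sup>2 + v\<^sup>2 / a) / 2" for u v :: real
  proof -
    have "0 \<le> (a * u - v)\<^sup>2" by simp
    then have "2 * (a * u * v) \<le> a * (a * u\<^sup>2 + v\<^sup>2 / a)"
      using assms(3) by (simp add: power2_eq_square algebra_simps)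
    then have "a * (u * v) \<le> a * ((a * u\<^sup>2 + v\<^sup>2 / a) / 2)" by (simp add: mult.assoc)
    then show ?thesis using assms(3) by simp
  qed
  then have "(\<Sum>r<d. cmod (vec_index x r) * cmod (vec_index y r)) \<le>
      (\<Sum>r<d. (a * (cmod (vec_index x r))\<^sup>2 + (cmod (vec_index y r))\<^sup>2 / a) / 2)"
    by (intro sum_mono)
  moreover have "cmod (cip x y) \<le> (\<Sum>r<d. cmod (vec_index x r) * cmod (vec_index y r))"
    unfolding cip_sum[OF assms(1,2)] by (rule order_trans[OF norm_sum]) (simp add: norm_mult)
  ultimately show ?thesis
    using assms(1,2) unfolding vec_norm2_def
    by (simp add: sum.distrib sum_distrib_left sum_divide_distrib add_divide_distrib)
qed

lemma vec_norm2_nonneg: "0 \<le> vec_norm2 v"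
  unfolding vec_norm2_def by (intro sum_nonneg) auto

lemma l2_carrier: "x \<in> l2 d \<Longrightarrow> x i \<in> carrier_vec d"
  by (simp add: l2_def)

lemma l2_cip_summable:
  assumes "x \<in> l2 d" "y \<in> l2 d"
  shows "summable (\<lambda>i. cip (x i) (y i))"
proof (rule summable_comparison_test)
  show "summable (\<lambda>i. (1 * vec_norm2 (x i) + vec_norm2 (y i) / 1) / 2)"
    using assms by (intro summable_divide summable_add summable_mult) (auto simp: l2_def)
  show "\<exists>N. \<forall>n\<ge>N. norm (cip (x n) (y n)) \<le> (1 * vec_norm2 (x n) + vec_norm2 (y n) / 1) / 2"
    by (intro exI[of _ 0] allI impI cip_le[OF l2_carrier[OF assms(1)] l2_carrier[OF assms(2)]]) simp
qed

lemma l2_add_scale: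
  assumes "x \<in> l2 d" "y \<in> l2 d"
  shows "(\<lambda>i. x i + c \<cdot>\<^sub>v y i) \<in> l2 d"
proof -
  have car: "x i \<in> carrier_vec d" "y i \<in> carrier_vec d" for i using assms by (auto simp: l2_def)
  have le: "vec_norm2 (x i + c \<cdot>\<^sub>v y i) \<le> 2 * vec_norm2 (x i) + 2 * (cmod c)\<^sup>2 * vec_norm2 (y i)" for i
  proof -
    have "(cmod (u + c * v))\<^sup>2 \<le> 2 * (cmod u)\<^sup>2 + 2 * (cmod c)\<^sup>2 * (cmod v)\<^sup>2" for u v
    proof -
      have "(cmod (u + c * v))\<^sup>2 \<le> (cmod u + cmod (c * v))\<^sup>2"
        by (intro power_mono norm_triangle_ineq) simp
      also have "\<dots> \<le> 2 * (cmod u)\<^sup>2 + 2 * (cmod (c * v))\<^sup>2"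
        using sum_squares_bound[of "cmod u" "cmod (c * v)"] by (simp add: power2_sum)
      finally show ?thesis by (simp add: norm_mult power_mult_distrib)
    qed
    then have "(\<Sum>r<d. (cmod (vec_index (x i) r + c * vec_index (y i) r))\<^sup>2) \<le>
        (\<Sum>r<d. 2 * (cmod (vec_index (x i) r))\<^sup>2 + 2 * (cmod c)\<^sup>2 * (cmod (vec_index (y i) r))\<^sup>2)"
      by (intro sum_mono)
    then show ?thesis
      using car[of i] unfolding vec_norm2_def
      by (simp add: sum.distrib sum_distrib_left)
  qed
  have "summable (\<lambda>i. vec_norm2 (x i + c \<cdot>\<^sub>v y i))"
  proof (rule summable_comparison_test)
    show "summable (\<lambda>i. 2 * vec_norm2 (x i) + 2 * (cmod c)\<^sup>2 * vec_norm2 (y i))"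
      using assms by (intro summable_add summable_mult) (auto simp: l2_def)
    show "\<exists>N. \<forall>n\<ge>N. norm (vec_norm2 (x n + c \<cdot>\<^sub>v y n)) \<le> 2 * vec_norm2 (x n) + 2 * (cmod c)\<^sup>2 * vec_norm2 (y n)"
      using le vec_norm2_nonneg by (simp add: abs_of_nonneg)
  qed
  then show ?thesis using car by (simp add: l2_def)
qed

lemma l2_inner_add_scale:
  assumes "x \<in> l2 d" "y \<in> l2 d" "z \<in> l2 d"
  shows "l2_inner (\<lambda>i. x i + c \<cdot>\<^sub>v y i) z = l2_inner x z + cnj c * l2_inner y z"
    "l2_inner z (\<lambda>i. x i + c \<cdot>\<^sub>v y i) = l2_inner z x + c * l2_inner z y"
proof -
  note car = l2_carrier[OF assms(1)] l2_carrier[OF assms(2)] l2_carrier[OF assms(3)]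
  have "cip (x i + c \<cdot>\<^sub>v y i) (z i) = cip (x i) (z i) + cnj c * cip (y i) (z i)"
    "cip (z i) (x i + c \<cdot>\<^sub>v y i) = cip (z i) (x i) + c * cip (z i) (y i)" for i
    using car[of i] by (simp_all add: cip_sum[of _ d] sum.distrib sum_distrib_left algebra_simps)
  then show "l2_inner (\<lambda>i. x i + c \<cdot>\<^sub>v y i) z = l2_inner x z + cnj c * l2_inner y z"
    "l2_inner z (\<lambda>i. x i + c \<cdot>\<^sub>v y i) = l2_inner z x + c * l2_inner z y"
    unfolding l2_inner_def using assms
    by (simp_all add: suminf_add[symmetric] suminf_mult[symmetric] summable_mult l2_cip_summable)
qed

lemma l2_norm_square: "x \<in> l2 d \<Longrightarrow> (l2_norm x)\<^sup>2 = (\<Sum>i. vec_norm2 (x i))"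
  unfolding l2_norm_def by (simp add: suminf_nonneg vec_norm2_nonneg l2_def)

lemma l2_inner_self:
  assumes "x \<in> l2 d"
  shows "l2_inner x x = of_real ((l2_norm x)\<^sup>2)"
proof -
  have "cip (x i) (x i) = of_real (vec_norm2 (x i))" for i
  proof -
    have "dim_vec (x i) = d" using l2_carrier[OF assms, of i] by simp
    then show ?thesis
      unfolding cip_sum[OF l2_carrier[OF assms] l2_carrier[OF assms]] vec_norm2_def of_real_sum complex_norm_square
      by (simp only: mult.commute)
  qed
  moreover have "summable (\<lambda>i. vec_norm2 (x i))" using assms by (simp add: l2_def)
  ultimately show ?thesis
    unfolding l2_inner_def l2_norm_square[OF assms] by (simp add: suminf_of_real)
qed

lemma l2_inner_le:
  assumes "x \<in> l2 d" "y \<in> l2 d" "a > 0"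
  shows "cmod (l2_inner x y) \<le> (a * (l2_norm x)\<^sup>2 + (l2_norm y)\<^sup>2 / a) / 2"
proof -
  have sm: "summable (\<lambda>i. vec_norm2 (x i))" "summable (\<lambda>i. vec_norm2 (y i))"
    using assms by (auto simp: l2_def)
  have le: "cmod (cip (x i) (y i)) \<le> (a * vec_norm2 (x i) + vec_norm2 (y i) / a) / 2" for i
    by (rule cip_le[OF l2_carrier[OF assms(1)] l2_carrier[OF assms(2)] assms(3)])
  have s: "summable (\<lambda>i. (a * vec_norm2 (x i) + vec_norm2 (y i) / a) / 2)"
    by (intro summable_divide summable_add summable_mult sm)
  have n: "summable (\<lambda>i. cmod (cip (x i) (y i)))"
    by (rule summable_comparison_test[OF _ s]) (use le in auto)
  have "cmod (l2_inner x y) \<le> (\<Sum>i. cmod (cip (x i) (y i)))"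
    unfolding l2_inner_def by (rule summable_norm[OF n])
  also have "\<dots> \<le> (\<Sum>i. (a * vec_norm2 (x i) + vec_norm2 (y i) / a) / 2)"
    by (rule suminf_le[OF le n s])
  also have "\<dots> = (a * (l2_norm x)\<^sup>2 + (l2_norm y)\<^sup>2 / a) / 2"
    unfolding l2_norm_square[OF assms(1)] l2_norm_square[OF assms(2)]
    by (rule sums_unique[symmetric]) (intro sums_divide sums_add sums_mult summable_sums sm)
  finally show ?thesis .
qed

text \<open>With \<open>y = S x\<close> for the inverse \<open>S\<close> and \<open>t = 1 / C\<close> for a bound \<open>C\<close> of \<open>S\<close>, expand
  \<open>0 \<le> \<langle>x - t y, T (x - t y)\<rangle>\<close>.\<close>

lemma positive_invertible_coercive:
  assumes bT: "bounded_op d T" and pT: "positive_invertible d T"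
  shows "\<exists>\<delta>>0. \<forall>x\<in>l2 d. \<delta> * (l2_norm x)\<^sup>2 \<le> Re (l2_inner x (T x))"
proof -
  obtain S where bS: "bounded_op d S" and TS: "\<And>x. x \<in> l2 d \<Longrightarrow> T (S x) = x"
    using pT unfolding positive_invertible_def by blast
  from bS obtain C0 where C0: "\<And>x. x \<in> l2 d \<Longrightarrow> l2_norm (S x) \<le> C0 * l2_norm x"
    unfolding bounded_op_def by blast
  \<comment> \<open>The bound supplied by \<open>bounded_op\<close> has no prescribed sign, and
    \<open>C\<close> is to be divided by.\<close>
  define C where "C = \<bar>C0\<bar> + 1"
  have C: "C > 0" by (simp add: C_def)
  have nn: "0 \<le> l2_norm x" if "x \<in> l2 d" for x
    unfolding l2_norm_def using that by (simp add: suminf_nonneg vec_norm2_nonneg l2_def)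
  have "1 / C * (l2_norm x)\<^sup>2 \<le> Re (l2_inner x (T x))" if x: "x \<in> l2 d" for x
  proof -
    define y where "y = S x"
    define w where "w = (\<lambda>i. x i + complex_of_real (- 1 / C) \<cdot>\<^sub>v y i)"
    have y: "y \<in> l2 d" using bS x by (auto simp: bounded_op_def y_def)
    have Ty: "T y = x" using TS[OF x] by (simp add: y_def)
    have Tx: "T x \<in> l2 d" using bT x by (auto simp: bounded_op_def)
    have w: "w \<in> l2 d" unfolding w_def by (rule l2_add_scale[OF x y])
    have cy: "(\<lambda>i. complex_of_real (- 1 / C) \<cdot>\<^sub>v y i) \<in> l2 d"
    proof -
      have "(\<lambda>i. 0\<^sub>v d :: complex vec) \<in> l2 d" by (simp add: l2_def vec_norm2_def)
      from l2_add_scale[OF this y] show ?thesis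
        using l2_carrier[OF y] by simp
    qed
    have "T w = (\<lambda>i. T x i + T (\<lambda>i. complex_of_real (- 1 / C) \<cdot>\<^sub>v y i) i)"
      unfolding w_def by (rule bT[unfolded bounded_op_def, THEN conjunct2, THEN conjunct1, rule_format, OF x cy])
    also have "T (\<lambda>i. complex_of_real (- 1 / C) \<cdot>\<^sub>v y i) = (\<lambda>i. complex_of_real (- 1 / C) \<cdot>\<^sub>v T y i)"
      by (rule bT[unfolded bounded_op_def, THEN conjunct2, THEN conjunct2, THEN conjunct1, rule_format, OF y])
    finally have Tw: "T w = (\<lambda>i. T x i + complex_of_real (- 1 / C) \<cdot>\<^sub>v x i)" unfolding Ty .
    have "0 \<le> Re (l2_inner w (T w))"
    proof (cases "w = (\<lambda>i. 0\<^sub>v d)")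
      case True
      have "T w i \<in> carrier_vec d" for i using bT w l2_carrier unfolding bounded_op_def by blast
      then have "l2_inner w (T w) = 0"
        unfolding l2_inner_def True by (simp add: cip_sum[of _ d])
      then show ?thesis by simp
    next
      case False
      then have "0 < l2_inner w (T w)" using pT w unfolding positive_invertible_def by blast
      then show ?thesis by (simp add: less_complex_def)
    qed
    also have "l2_inner w (T w) = l2_inner x (T x) - of_real (1 / C) * l2_inner x x
       - of_real (1 / C) * (l2_inner y (T x) - of_real (1 / C) * l2_inner y x)"
    proof -
      have "l2_inner w (T w) = l2_inner x (T w) + cnj (complex_of_real (- 1 / C)) * l2_inner y (T w)"
        unfolding w_def by (rule l2_inner_add_scale(1)[OF x y]) (use bT w in \<open>auto simp: bounded_op_def w_def\<close>)
      also have "l2_inner x (T w) = l2_inner x (T x) + complex_of_real (- 1 / C) * l2_inner x x"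
        unfolding Tw by (rule l2_inner_add_scale(2)[OF Tx x x])
      also have "l2_inner y (T w) = l2_inner y (T x) + complex_of_real (- 1 / C) * l2_inner y x"
        unfolding Tw by (rule l2_inner_add_scale(2)[OF Tx x y])
      finally show ?thesis by simp
    qed
    also have "l2_inner y (T x) = l2_inner x x"
      using pT y x Ty unfolding positive_invertible_def by metis
    finally have "2 / C * (l2_norm x)\<^sup>2 \<le> Re (l2_inner x (T x)) + 1 / C * (1 / C * Re (l2_inner y x))"
      unfolding l2_inner_self[OF x] by (simp add: algebra_simps)
    also have "Re (l2_inner y x) \<le> C * (l2_norm x)\<^sup>2"
    proof -
      have "Re (l2_inner y x) \<le> cmod (l2_inner y x)" by (rule complex_Re_le_cmod)
      also have "\<dots> \<le> (1 / C * (l2_norm y)\<^sup>2 + (l2_norm x)\<^sup>2 / (1 / C)) / 2"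
        using C by (intro l2_inner_le[OF y x]) simp
      also have "(l2_norm y)\<^sup>2 \<le> (C * l2_norm x)\<^sup>2"
      proof (rule power_mono)
        have "l2_norm y \<le> C0 * l2_norm x" unfolding y_def by (rule C0[OF x])
        also have "\<dots> \<le> C * l2_norm x" using nn[OF x] by (intro mult_right_mono) (auto simp: C_def)
        finally show "l2_norm y \<le> C * l2_norm x" .
      qed (rule nn[OF y])
      finally show ?thesis using C by (simp add: power2_eq_square field_simps)
    qed
    finally show ?thesis using C by (simp add: field_simps)
  qed
  then show ?thesis using C by (intro exI[of _ "1 / C"]) simp
qed

subsection \<open>Fourier coefficients and shifted vectors\<close>

lemma fcoeff_add:
  assumes "f \<in> borel_measurable circ" "\<exists>C. AE \<theta> in circ. cmod (f \<theta>) \<le> C"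
    "g \<in> borel_measurable circ" "\<exists>C. AE \<theta> in circ. cmod (g \<theta>) \<le> C"
  shows "fcoeff (\<lambda>\<theta>. f \<theta> + g \<theta>) n = fcoeff f n + fcoeff g n"
proof -
  have i: "integrable circ (\<lambda>\<theta>. f \<theta> * exp (- \<i> * of_int n * of_real \<theta>))"
    "integrable circ (\<lambda>\<theta>. g \<theta> * exp (- \<i> * of_int n * of_real \<theta>))"
    using assms fcoeff_integrable by blast+
  have "(LINT \<theta>|circ. (f \<theta> + g \<theta>) * exp (- \<i> * of_int n * of_real \<theta>)) =
    (LINT \<theta>|circ. f \<theta> * exp (- \<i> * of_int n * of_real \<theta>)) + (LINT \<theta>|circ. g \<theta> * exp (- \<i> * of_int n * of_real \<theta>))"
    unfolding distrib_right by (rule Bochner_Integration.integral_add[OF i])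
  then show ?thesis unfolding fcoeff_def by (simp only: distrib_left)
qed

lemma fcoeff_scale: "fcoeff (\<lambda>\<theta>. c * f \<theta>) n = c * fcoeff f n"
  unfolding fcoeff_def by (simp add: mult.assoc)

lemma fcoeff_cnj: "fcoeff (\<lambda>\<theta>. cnj (f \<theta>)) n = cnj (fcoeff f (- n))"
proof -
  have "(LINT \<theta>|circ. cnj (f \<theta>) * exp (- \<i> * of_int n * of_real \<theta>)) =
    (LINT \<theta>|circ. cnj (f \<theta> * exp (- \<i> * of_int (- n) * of_real \<theta>)))"
    by (simp add: exp_cnj)
  also have "\<dots> = cnj (LINT \<theta>|circ. f \<theta> * exp (- \<i> * of_int (- n) * of_real \<theta>))"
    by (rule Bochner_Integration.integral_cnj)
  finally show ?thesis unfolding fcoeff_def by simp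
qed

lemma fcoeff_const: "fcoeff (\<lambda>_. c) n = (if n = 0 then c else 0)"
proof -
  have "(LINT \<theta>|circ. exp (- \<i> * of_int n * of_real \<theta>)) = (if n = 0 then 2 * of_real pi else 0)"
  proof (cases "n = 0")
    case True
    have "(LINT \<theta>|circ. (1 :: complex)) = of_real (measure circ (space circ))"
      by (simp add: scaleR_conv_of_real)
    also have "measure circ (space circ) = 2 * pi" by (simp add: measure_restrict_space)
    finally show ?thesis using True by simp
  next
    case False
    let ?a = "- \<i> * of_int n"
    have "integrable circ (\<lambda>\<theta>. 1 * exp (- \<i> * of_int n * of_real \<theta>))"
      by (rule fcoeff_integrable[where C = 1]) auto
    then have "(LINT \<theta>|circ. exp (- \<i> * of_int n * of_real \<theta>)) = integral {- pi..pi} (\<lambda>\<theta>. exp (?a * of_real \<theta>))"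
      by (subst lebesgue_integral_eq_integral) auto
    also have "((\<lambda>\<theta>. exp (?a * of_real \<theta>)) has_integral (exp (?a * of_real pi) / ?a - exp (?a * of_real (- pi)) / ?a)) {- pi..pi}"
    proof (rule fundamental_theorem_of_calculus)
      show "((\<lambda>\<theta>. exp (?a * of_real \<theta>) / ?a) has_vector_derivative exp (?a * of_real x)) (at x within {- pi..pi})" for x
        using False by (auto intro!: derivative_eq_intros has_vector_derivative_real_field simp: field_simps)
    qed simp
    then have "integral {- pi..pi} (\<lambda>\<theta>. exp (?a * of_real \<theta>)) = exp (?a * of_real pi) / ?a - exp (?a * of_real (- pi)) / ?a"
      by (rule integral_unique)
    also have "exp (?a * of_real (- pi)) = exp (?a * of_real pi + 2 * of_int n * of_real pi * \<i>)"
      by (simp add: algebra_simps)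
    also have "\<dots> = exp (?a * of_real pi)"
    proof -
      have "exp (2 * of_int n * of_real pi * \<i>) = 1"
        using exp_integer_2pi[of "of_int n"] by simp
      then show ?thesis by (simp only: exp_add mult_1_right)
    qed
    finally show ?thesis using False by simp
  qed
  then show ?thesis unfolding fcoeff_def by simp
qed

lemma const_bounded: "\<exists>C. AE \<theta> in M. cmod c \<le> C"
  by (rule exI[of _ "cmod c"]) simp

lemma bounded_symbol_add_const:
  assumes "bounded_symbol d S"
  shows "bounded_symbol d (\<lambda>r s \<theta>. S r s \<theta> + K r s)"
  unfolding bounded_symbol_def
proof (intro allI impI conjI)
  fix r s assume rs: "r < d" "s < d"
  show "(\<lambda>\<theta>. S r s \<theta> + K r s) \<in> borel_measurable circ"
    using bounded_symbolD(1)[OF assms rs] by (intro borel_measurable_add) auto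
  obtain C where C: "AE \<theta> in circ. cmod (S r s \<theta>) \<le> C" using bounded_symbolD(2)[OF assms rs] by blast
  have "AE \<theta> in circ. cmod (S r s \<theta> + K r s) \<le> C + cmod (K r s)"
    using C by eventually_elim (rule norm_triangle_mono, auto)
  then show "\<exists>C. AE \<theta> in circ. cmod (S r s \<theta> + K r s) \<le> C" by blast
qed

lemma fcoeff_add_const:
  assumes "bounded_symbol d S" "r < d" "s < d"
  shows "fcoeff (\<lambda>\<theta>. S r s \<theta> + c) n = fcoeff (S r s) n + (if n = 0 then c else 0)"
  by (subst fcoeff_add[OF bounded_symbolD[OF assms]]) (auto intro: const_bounded simp: fcoeff_const)

text \<open>A constant has only a zeroth Fourier coefficient. This serves twice: for adding i c J
  and for subtracting a multiple of the identity.\<close>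

lemma toep_add_const:
  assumes "bounded_symbol d S" "d > 0"
  shows "toep d (\<lambda>r s \<theta>. S r s \<theta> + K r s) p q =
    toep d S p q + (if p div d = q div d then K (p mod d) (q mod d) else 0)"
  unfolding toep_def using fcoeff_add_const[OF assms(1), of "p mod d" "q mod d"] assms(2) by auto

text \<open>\<open>Jf\<close> couples only \<open>2 * l\<close> with its successor, and for even
  \<open>d\<close> such a pair never straddles a block boundary. Hence the large symplectic matrix
  is the Toeplitz matrix of a constant symbol.\<close>

lemma Jf_blocks:
  assumes "even d" "r < d" "s < d"
  shows "Jf (a * d + r) (b * d + s) = (if a = b then Jf r s else 0)"
proof -
  have 1: "a = b \<and> s = Suc r" if "b * d + s = Suc (a * d + r)" "even r" "r < d" "s < d" for a b r s
  proof -
    have "Suc r < d" using that(2,3) assms(1) by presburger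
    moreover have eq: "b * d + s = a * d + Suc r" using that(1) by simp
    moreover have "(b * d + s) div d = b" "(b * d + s) mod d = s" using that(4) by simp_all
    moreover have "(a * d + Suc r) div d = a" "(a * d + Suc r) mod d = Suc r"
      using \<open>Suc r < d\<close> by (simp_all del: add_Suc_right)
    ultimately show ?thesis by metis
  qed
  have ev: "even (a * d + r) \<longleftrightarrow> even r" "even (b * d + s) \<longleftrightarrow> even s" using assms(1) by simp_all
  have "even (a * d + r) \<and> b * d + s = Suc (a * d + r) \<longleftrightarrow> a = b \<and> even r \<and> s = Suc r"
    using 1[of b s a r] assms ev(1) by auto
  moreover have "odd (a * d + r) \<and> a * d + r = Suc (b * d + s) \<longleftrightarrow> a = b \<and> odd r \<and> r = Suc s"
  proof -
    have "even s" if "odd r" "a * d + r = Suc (b * d + s)"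
      using that ev by (metis even_Suc)
    then show ?thesis using 1[of a r b s] assms ev(1) by auto
  qed
  ultimately show ?thesis unfolding Jf_def by (simp only:) auto
qed

lemma Jf_div_mod:
  assumes "even d" "d > 0"
  shows "Jf p q = (if p div d = q div d then Jf (p mod d) (q mod d) else 0)"
  using Jf_blocks[OF assms(1), of "p mod d" "q mod d" "p div d" "q div d"] assms(2) by simp

lemma sform_zero_coeffs: "(\<And>p q. p < n \<Longrightarrow> q < n \<Longrightarrow> F p q = 0) \<Longrightarrow> sform n F x y = 0"
  unfolding sform_def by (intro sum.neutral ballI) simp

text \<open>The Toeplitz forms of the scalar symbols c g all vanish and are in particular
  nonnegative, so Re (c g) \<ge> 0 almost everywhere. Taking c among 1, -1, i, -i leaves only g =
  0.\<close>

lemma AE_eq_zero_of_fcoeff_zero: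
  assumes g: "g \<in> borel_measurable circ" "\<exists>C. AE \<theta> in circ. cmod (g \<theta>) \<le> C"
    and z: "\<And>n. fcoeff g n = 0"
  shows "AE \<theta> in circ. g \<theta> = 0"
proof -
  have pos: "AE \<theta> in circ. 0 \<le> Re (c * g \<theta>)" for c
  proof -
    let ?H = "\<lambda>(r :: nat) (s :: nat) \<theta>. c * g \<theta>"
    obtain C where C: "AE \<theta> in circ. cmod (g \<theta>) \<le> C" using g(2) by blast
    have "AE \<theta> in circ. cmod (c * g \<theta>) \<le> cmod c * C"
      using C by eventually_elim (simp add: norm_mult mult_left_mono)
    then have H: "bounded_symbol 1 ?H"
      unfolding bounded_symbol_def using g(1) by (auto intro!: borel_measurable_times)
    have "hform (n * 1) (toep 1 ?H) z = 0" for n z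
      unfolding hform_def by (subst sform_zero_coeffs) (auto simp: toep_def fcoeff_scale \<open>\<And>n. fcoeff g n = 0\<close>)
    then have "AE \<theta> in circ. \<forall>z. 0 \<le> hform 1 (\<lambda>r s. c * g \<theta>) z"
      using symbol_nonneg_of_toep_nonneg[OF H] by simp
    then show ?thesis
    proof eventually_elim
      case (elim \<theta>)
      from elim[rule_format, of "\<lambda>_. 1"] show ?case by (simp add: hform_def sform_def)
    qed
  qed
  show ?thesis using pos[of 1] pos[of "-1"] pos[of "\<i>"] pos[of "- \<i>"]
    by eventually_elim (simp add: complex_eq_iff)
qed

section \<open>Negative subspaces from shifted copies\<close>

definition shift_vec :: "nat \<Rightarrow> nat \<Rightarrow> (nat \<Rightarrow> complex) \<Rightarrow> nat \<Rightarrow> complex" where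
  "shift_vec M a z p = (if a \<le> p \<and> p < a + M then z (p - a) else 0)"

lemma sum_shift_vec:
  assumes "a + M \<le> N"
  shows "(\<Sum>p<N. f p * shift_vec M a z p) = (\<Sum>p<M. f (a + p) * z p)"
proof -
  have "(\<Sum>p<N. f p * shift_vec M a z p) = (\<Sum>p\<in>{0 + a..<M + a}. f p * shift_vec M a z p)"
    using assms by (intro sum.mono_neutral_right) (auto simp: shift_vec_def)
  also have "\<dots> = (\<Sum>p\<in>{0..<M}. f (p + a) * shift_vec M a z (p + a))"
    by (rule sum.shift_bounds_nat_ivl)
  also have "\<dots> = (\<Sum>p<M. f (a + p) * z p)"
    by (simp add: atLeast0LessThan shift_vec_def add.commute)
  finally show ?thesis .
qed

lemma sform_shift_vec:
  assumes "a + M \<le> N" "b + M \<le> N"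
  shows "sform N F (\<lambda>p. cnj (shift_vec M a x p)) (shift_vec M b y) =
    sform M (\<lambda>p q. F (a + p) (b + q)) (\<lambda>p. cnj (x p)) y"
proof -
  have c: "cnj (shift_vec M a x p) = shift_vec M a (\<lambda>p. cnj (x p)) p" for p
    by (simp add: shift_vec_def)
  have "sform N F (\<lambda>p. cnj (shift_vec M a x p)) (shift_vec M b y) =
      (\<Sum>p<N. (\<Sum>q<M. F p (b + q) * y q) * shift_vec M a (\<lambda>p. cnj (x p)) p)"
    unfolding sform_def c
  proof (rule sum.cong[OF refl])
    fix p
    let ?u = "shift_vec M a (\<lambda>p. cnj (x p)) p"
    have "(\<Sum>q<N. F p q * ?u * shift_vec M b y q) = (\<Sum>q<N. F p q * shift_vec M b y q) * ?u"
      by (simp add: sum_distrib_left sum_distrib_right mult_ac)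
    then show "(\<Sum>q<N. F p q * ?u * shift_vec M b y q) = (\<Sum>q<M. F p (b + q) * y q) * ?u"
      by (simp only: sum_shift_vec[OF assms(2)])
  qed
  also have "\<dots> = (\<Sum>p<M. (\<Sum>q<M. F (a + p) (b + q) * y q) * cnj (x p))"
    by (rule sum_shift_vec[OF assms(1)])
  finally show ?thesis by (simp add: sform_def sum_distrib_left sum_distrib_right mult_ac)
qed

text \<open>Toeplitz invariance gives the Gram matrix of the shifted copies a diagonal with real
  part - \<eta>, while decay makes its off-diagonal entries at most \<open>e * Q\<close>. With
  \<open>m\<close> copies the matrix is diagonally dominant, hence its form is negative.\<close>

lemma negdim_of_negative_vector:
  assumes d: "d > 0"
    and decay: "\<And>e. e > 0 \<Longrightarrow> \<exists>K. \<forall>r<d. \<forall>s<d. \<forall>n. \<bar>n\<bar> \<ge> int K \<longrightarrow> cmod (fcoeff (H r s) n) \<le> e"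
    and neg: "hform (n0 * d) (toep d H) z < 0"
  shows "\<exists>n1. \<forall>n\<ge>n1. negdim (n * d) (toep d H) m"
proof -
  define M where "M = n0 * d"
  define \<eta> where "\<eta> = - hform M (toep d H) z"
  have \<eta>: "\<eta> > 0" using neg by (simp add: \<eta>_def M_def)
  \<comment> \<open>Bounds the double sum in the off-diagonal entries; the added 1 keeps it positive
    for the division below.\<close>
  define Q where "Q = (\<Sum>p<M. \<Sum>q<M. cmod (z p) * cmod (z q)) + 1"
  have Q: "Q > 0" unfolding Q_def by (intro add_nonneg_pos sum_nonneg) auto
  \<comment> \<open>Chosen so that \<open>e * Q * real m\<close> stays below \<eta>, which lets the
    diagonal win over \<open>m\<close> entries in each row.\<close>
  define e where "e = \<eta> / (2 * (real m + 1) * Q)"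
  have "e > 0" using \<eta> Q by (simp add: e_def)
  then obtain K where K: "\<And>r s n. r < d \<Longrightarrow> s < d \<Longrightarrow> \<bar>n\<bar> \<ge> int K \<Longrightarrow> cmod (fcoeff (H r s) n) \<le> e"
    using decay by meson
  \<comment> \<open>Block indices within one copy differ by less than \<open>n0\<close>, so copies
    shifted by multiples of \<open>L\<close> only meet coefficients of index at least
    \<open>K\<close> in absolute value.\<close>
  define L where "L = n0 + K"
  have "negdim (n * d) (toep d H) m" if n: "n \<ge> m * L + n0" for n
    unfolding negdim_def
  proof (intro exI[of _ "\<lambda>a. shift_vec M (a * L * d) z"] allI impI)
    fix \<alpha> :: "nat \<Rightarrow> complex" assume nz: "\<exists>i<m. \<alpha> i \<noteq> 0"
    let ?F = "toep d H" and ?Z = "\<lambda>a. shift_vec M (a * L * d) z"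
    define G where "G = (\<lambda>a b. sform (n * d) ?F (\<lambda>p. cnj (?Z a p)) (?Z b))"
    have fit: "a * L * d + M \<le> n * d" if "a < m" for a
    proof -
      have "a * L + n0 \<le> n" using that n by (meson add_le_mono1 le_trans less_imp_le mult_le_mono1)
      then have "(a * L + n0) * d \<le> n * d" by (rule mult_le_mono1)
      then show ?thesis by (simp add: M_def distrib_right)
    qed
    have Gab: "G a b = sform M (\<lambda>p q. ?F (a * L * d + p) (b * L * d + q)) (\<lambda>p. cnj (z p)) z"
      if "a < m" "b < m" for a b
      unfolding G_def by (rule sform_shift_vec[OF fit[OF that(1)] fit[OF that(2)]])
    have F: "?F (a * L * d + p) (b * L * d + q) =
      fcoeff (H (p mod d) (q mod d)) (int (p div d) - int (q div d) + (int a - int b) * int L)" for a b p q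
    proof -
      have "(a * L * d + p) div d = a * L + p div d" "(b * L * d + q) div d = b * L + q div d"
        "(a * L * d + p) mod d = p mod d" "(b * L * d + q) mod d = q mod d" using d by simp_all
      then show ?thesis unfolding toep_def by (simp only:) (simp add: algebra_simps)
    qed
    have Gaa: "Re (G a a) = - \<eta>" if "a < m" for a
    proof -
      have "G a a = sform M ?F (\<lambda>p. cnj (z p)) z"
        unfolding Gab[OF that that] by (intro sform_cong refl) (simp only: F, simp only: toep_def diff_self mult_zero_left add_0_right)
      then show ?thesis by (simp add: \<eta>_def hform_def)
    qed
    have Goff: "cmod (G a b) \<le> e * Q" if "a < m" "b < m" "a \<noteq> b" for a b
    proof -
      have "cmod (?F (a * L * d + p) (b * L * d + q)) \<le> e" if "p < M" "q < M" for p q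
      proof -
        have "p div d < n0" "q div d < n0"
          using that d by (simp_all add: M_def less_mult_imp_div_less)
        moreover have "int L \<le> \<bar>(int a - int b) * int L\<bar>"
        proof -
          have "1 * int L \<le> \<bar>int a - int b\<bar> * int L"
            using \<open>a \<noteq> b\<close> by (intro mult_right_mono) auto
          then show ?thesis by (simp add: abs_mult)
        qed
        ultimately have "int K \<le> \<bar>int (p div d) - int (q div d) + (int a - int b) * int L\<bar>"
          unfolding L_def by linarith
        then show ?thesis unfolding F using d by (intro K) auto
      qed
      then have "(\<Sum>p<M. \<Sum>q<M. cmod (?F (a * L * d + p) (b * L * d + q)) * cmod (cnj (z p)) * cmod (z q)) \<le>
          (\<Sum>p<M. \<Sum>q<M. e * cmod (z p) * cmod (z q))"
        by (intro sum_mono) (auto intro!: mult_right_mono)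
      also have "\<dots> \<le> e * Q"
        unfolding Q_def using \<open>e > 0\<close> by (simp add: sum_distrib_left distrib_left mult.assoc)
      finally show ?thesis
        unfolding Gab[OF that(1,2)] by (rule order_trans[OF sform_cmod_le])
    qed
    have "hform (n * d) ?F (\<lambda>p. \<Sum>i<m. \<alpha> i * ?Z i p) = Re (\<Sum>a<m. cnj (\<alpha> a) * (\<Sum>b<m. \<alpha> b * G a b))"
      unfolding hform_def cnj_sum complex_cnj_mult G_def by (simp only: sform_sum_left sform_sum_right)
    also have "\<dots> = (\<Sum>a<m. \<Sum>b<m. Re (cnj (\<alpha> a) * \<alpha> b * G a b))"
      by (simp only: sum_distrib_left Re_sum mult.assoc)
    also have "\<dots> \<le> (\<Sum>a<m. \<Sum>b<m. e * Q * (((cmod (\<alpha> a))\<^sup>2 + (cmod (\<alpha> b))\<^sup>2) / 2) - (if a = b then \<eta> * (cmod (\<alpha> a))\<^sup>2 else 0))"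
    proof (intro sum_mono)
      fix a b assume "a \<in> {..<m}" "b \<in> {..<m}"
      then have ab: "a < m" "b < m" by auto
      show "Re (cnj (\<alpha> a) * \<alpha> b * G a b) \<le> e * Q * (((cmod (\<alpha> a))\<^sup>2 + (cmod (\<alpha> b))\<^sup>2) / 2) - (if a = b then \<eta> * (cmod (\<alpha> a))\<^sup>2 else 0)"
      proof (cases "a = b")
        case True
        have "cnj (\<alpha> a) * \<alpha> a = of_real ((cmod (\<alpha> a))\<^sup>2)"
          by (simp only: complex_norm_square mult.commute[of "cnj (\<alpha> a)"])
        then have "Re (cnj (\<alpha> a) * \<alpha> a * G a a) = - \<eta> * (cmod (\<alpha> a))\<^sup>2"
          using Gaa[OF ab(1)] by simp
        moreover have "0 \<le> e * Q * (cmod (\<alpha> a))\<^sup>2" using \<open>e > 0\<close> Q by simp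
        ultimately show ?thesis using True by simp
      next
        case False
        have "Re (cnj (\<alpha> a) * \<alpha> b * G a b) \<le> cmod (cnj (\<alpha> a) * \<alpha> b * G a b)" by (rule complex_Re_le_cmod)
        also have "\<dots> = (cmod (\<alpha> a) * cmod (\<alpha> b)) * cmod (G a b)" by (simp add: norm_mult)
        also have "\<dots> \<le> (((cmod (\<alpha> a))\<^sup>2 + (cmod (\<alpha> b))\<^sup>2) / 2) * (e * Q)"
          using sum_squares_bound[of "cmod (\<alpha> a)" "cmod (\<alpha> b)"]
          by (intro mult_mono Goff[OF ab False]) auto
        finally show ?thesis using False by (simp add: mult.commute)
      qed
    qed
    also have "\<dots> = (e * Q * real m - \<eta>) * (\<Sum>a<m. (cmod (\<alpha> a))\<^sup>2)"
    proof -
      have "(\<Sum>a<m. \<Sum>b<m. e * Q * (((cmod (\<alpha> a))\<^sup>2 + (cmod (\<alpha> b))\<^sup>2) / 2)) = e * Q * (real m * (\<Sum>a<m. (cmod (\<alpha> a))\<^sup>2))"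
        unfolding sum_distrib_left[symmetric] sum_divide_distrib[symmetric] sum.distrib
        by (simp add: sum_distrib_left sum_distrib_right mult_ac)
      then show ?thesis
        by (simp add: sum_subtractf sum_distrib_left left_diff_distrib mult.assoc)
    qed
    also have "\<dots> < 0"
    proof (rule mult_neg_pos)
      have "e * Q = \<eta> / (2 * (real m + 1))"
        unfolding e_def using Q by simp
      then have "e * Q * real m = \<eta> * (real m / (2 * (real m + 1)))" by simp
      also have "\<dots> < \<eta> * 1" using \<eta> by (intro mult_strict_left_mono) (auto simp: field_simps)
      finally show "e * Q * real m - \<eta> < 0" by simp
      obtain i where "i < m" "\<alpha> i \<noteq> 0" using nz by blast
      then show "0 < (\<Sum>a<m. (cmod (\<alpha> a))\<^sup>2)" by (intro sum_pos2[of _ i]) auto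
    qed
    finally show "hform (n * d) ?F (\<lambda>p. \<Sum>i<m. \<alpha> i * ?Z i p) < 0" .
  qed
  then show ?thesis by blast
qed

subsection \<open>The Toeplitz operator and its symbol\<close>

definition entry :: "(real \<Rightarrow> complex mat) \<Rightarrow> nat \<Rightarrow> nat \<Rightarrow> real \<Rightarrow> complex" where
  "entry A r s \<theta> = A \<theta> $$ (r, s)"

lemma entry_bounded_symbol: "A \<in> Linf d \<Longrightarrow> bounded_symbol d (entry A)"
  unfolding Linf_def bounded_symbol_def entry_def[abs_def] by blast

lemma fourier_coeff_entry: "r < d \<Longrightarrow> s < d \<Longrightarrow> fourier_coeff d A n $$ (r, s) = fcoeff (entry A r s) n"
  by (simp add: fourier_coeff_def fcoeff_def entry_def)

definition fin_seq :: "nat \<Rightarrow> nat \<Rightarrow> (nat \<Rightarrow> complex) \<Rightarrow> nat \<Rightarrow> complex vec" where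
  "fin_seq d n z i = Matrix.vec d (\<lambda>r. if i < n then z (i * d + r) else 0)"

lemma fin_seq_carrier [simp]: "fin_seq d n z i \<in> carrier_vec d"
  by (simp add: fin_seq_def)

lemma fin_seq_index: "r < d \<Longrightarrow> vec_index (fin_seq d n z i) r = (if i < n then z (i * d + r) else 0)"
  by (simp add: fin_seq_def)

lemma vec_norm2_fin_seq: "vec_norm2 (fin_seq d n z i) = (if i < n then \<Sum>r<d. (cmod (z (i * d + r)))\<^sup>2 else 0)"
  by (simp add: vec_norm2_def fin_seq_def)

lemma fin_seq_l2: "fin_seq d n z \<in> l2 d"
proof -
  have "summable (\<lambda>i. vec_norm2 (fin_seq d n z i))"
    by (rule summable_finite[of "{..<n}"]) (auto simp: vec_norm2_fin_seq)
  then show ?thesis by (simp add: l2_def)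
qed

lemma l2_norm_fin_seq: "(l2_norm (fin_seq d n z))\<^sup>2 = (\<Sum>p<n * d. (cmod (z p))\<^sup>2)"
proof -
  have "(l2_norm (fin_seq d n z))\<^sup>2 = (\<Sum>i<n. vec_norm2 (fin_seq d n z i))"
    unfolding l2_norm_square[OF fin_seq_l2] by (rule suminf_finite) (auto simp: vec_norm2_fin_seq)
  then show ?thesis unfolding sum_blocks by (simp add: vec_norm2_fin_seq)
qed

lemma toeplitz_op_fin_seq:
  assumes "r < d"
  shows "vec_index (toeplitz_op d A (fin_seq d n y) i) r =
    (\<Sum>j<n. \<Sum>s<d. fcoeff (entry A r s) (int i - int j) * y (j * d + s))"
proof -
  have c: "vec_index (fourier_coeff d A (int i - int j) *\<^sub>v fin_seq d n y j) r =
      (if j < n then \<Sum>s<d. fcoeff (entry A r s) (int i - int j) * y (j * d + s) else 0)" for j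
  proof -
    have "fourier_coeff d A (int i - int j) \<in> carrier_mat d d" by (simp add: fourier_coeff_def)
    then have "vec_index (fourier_coeff d A (int i - int j) *\<^sub>v fin_seq d n y j) r =
        (\<Sum>s<d. fourier_coeff d A (int i - int j) $$ (r, s) * vec_index (fin_seq d n y j) s)"
      using assms by (auto simp: scalar_prod_def atLeast0LessThan carrier_vecD[OF fin_seq_carrier] intro!: sum.cong)
    also have "\<dots> = (\<Sum>s<d. fcoeff (entry A r s) (int i - int j) * (if j < n then y (j * d + s) else 0))"
      using assms by (intro sum.cong refl) (simp add: fourier_coeff_entry fin_seq_index)
    finally show ?thesis by simp
  qed
  have "vec_index (toeplitz_op d A (fin_seq d n y) i) r =
      (\<Sum>j. if j < n then \<Sum>s<d. fcoeff (entry A r s) (int i - int j) * y (j * d + s) else 0)"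
    unfolding toeplitz_op_def using assms by (simp add: c)
  also have "\<dots> = (\<Sum>j<n. if j < n then \<Sum>s<d. fcoeff (entry A r s) (int i - int j) * y (j * d + s) else 0)"
    by (rule suminf_finite) auto
  finally show ?thesis by simp
qed

text \<open>For finitely supported sequences all series terminate, so the operator's form reduces to
  a finite sum; through this the hypotheses on the operator reach the Fourier coefficients.\<close>

lemma l2_inner_toeplitz_op:
  "l2_inner (fin_seq d n x) (toeplitz_op d A (fin_seq d n y)) =
    sform (n * d) (toep d (entry A)) (\<lambda>p. cnj (x p)) y"
proof -
  let ?T = "toeplitz_op d A (fin_seq d n y)"
  have T: "?T i \<in> carrier_vec d" for i by (simp add: toeplitz_op_def)
  have c: "cip (fin_seq d n x i) (?T i) = (if i < n then \<Sum>r<d. cnj (x (i * d + r)) * vec_index (?T i) r else 0)" for i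
    by (simp add: cip_sum[OF fin_seq_carrier T] fin_seq_index)
  have "l2_inner (fin_seq d n x) ?T = (\<Sum>i<n. cip (fin_seq d n x i) (?T i))"
    unfolding l2_inner_def by (rule suminf_finite) (auto simp: c)
  also have "\<dots> = (\<Sum>i<n. \<Sum>r<d. \<Sum>j<n. \<Sum>s<d.
      fcoeff (entry A r s) (int i - int j) * cnj (x (i * d + r)) * y (j * d + s))"
    by (intro sum.cong refl) (simp add: c toeplitz_op_fin_seq sum_distrib_left mult_ac)
  also have "\<dots> = sform (n * d) (toep d (entry A)) (\<lambda>p. cnj (x p)) y"
    unfolding sform_def sum_blocks by (intro sum.cong refl) (simp add: toep_def)
  finally show ?thesis .
qed

lemma l2_inner_cnj:
  assumes "x \<in> l2 d" "y \<in> l2 d"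
  shows "l2_inner x y = cnj (l2_inner y x)"
proof -
  have "cip (x i) (y i) = cnj (cip (y i) (x i))" for i
    using assms by (simp add: cip_sum[of _ d] l2_carrier mult.commute)
  then show ?thesis
    unfolding l2_inner_def
    using bounded_linear.suminf[OF bounded_linear_cnj l2_cip_summable[OF assms(2,1)]] by simp
qed

lemma sform_delta:
  "a < n \<Longrightarrow> b < n \<Longrightarrow> sform n F (\<lambda>p. if p = a then 1 else 0) (\<lambda>p. if p = b then 1 else 0) = F a b"
  by (simp add: sform_def if_distrib[of "\<lambda>u. _ * u"] if_distrib[of "\<lambda>u. u * _"] cong: if_cong)

text \<open>Self-adjointness of the operator is tested on unit sequences, which isolates single
  matrix entries.\<close>

lemma fcoeff_hermitian:
  assumes bT: "bounded_op d (toeplitz_op d A)" and pT: "positive_invertible d (toeplitz_op d A)"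
    and rs: "r < d" "s < d"
  shows "fcoeff (entry A r s) m = cnj (fcoeff (entry A s r) (- m))"
proof -
  have toep: "toep d (entry A) a b = cnj (toep d (entry A) b a)" for a b
  proof -
    let ?n = "Suc (a + b)"
    let ?x = "\<lambda>p. if p = a then 1 else 0 :: complex" and ?y = "\<lambda>p. if p = b then 1 else 0 :: complex"
    have d: "0 < d" using rs by simp
    have "?n * 1 \<le> ?n * d" using d by (intro mult_le_mono2) simp
    then have le: "?n \<le> ?n * d" by (simp only: mult_1_right)
    have ab: "a < ?n * d" "b < ?n * d" by (rule less_le_trans[OF _ le], simp)+
    let ?X = "fin_seq d ?n ?x" and ?Y = "fin_seq d ?n ?y" and ?T = "toeplitz_op d A"
    have TX: "?T ?X \<in> l2 d" using bT fin_seq_l2 unfolding bounded_op_def by blast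
    have "l2_inner ?X (?T ?Y) = l2_inner (?T ?X) ?Y"
      using pT fin_seq_l2 unfolding positive_invertible_def by blast
    also have "\<dots> = cnj (l2_inner ?Y (?T ?X))" by (rule l2_inner_cnj[OF TX fin_seq_l2])
    finally have "sform (?n * d) (toep d (entry A)) (\<lambda>p. cnj (?x p)) ?y = cnj (sform (?n * d) (toep d (entry A)) (\<lambda>p. cnj (?y p)) ?x)"
      unfolding l2_inner_toeplitz_op .
    moreover have "(\<lambda>p. cnj (?x p)) = ?x" "(\<lambda>p. cnj (?y p)) = ?y" by auto
    ultimately show ?thesis using ab by (simp only: sform_delta)
  qed
  have div: "(j * d + t) div d = j" "(j * d + t) mod d = t" if "t < d" for j t using that by simp_all
  \<comment> \<open>\<open>nat m\<close> and \<open>nat (- m)\<close> are admissible block indices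
    with difference \<open>m\<close>, whichever sign \<open>m\<close> has.\<close>
  have m: "int (nat m) - int (nat (- m)) = m" "int (nat (- m)) - int (nat m) = - m" by linarith+
  show ?thesis
    using toep[of "nat m * d + r" "nat (- m) * d + s"]
    unfolding toep_def div[OF rs(1)] div[OF rs(2)] m .
qed

text \<open>The point is that \<delta> does not depend on \<open>n\<close>: it gives definiteness of
  every truncation and also survives the passage to the symbol.\<close>

lemma toeplitz_coercive:
  assumes bT: "bounded_op d (toeplitz_op d A)" and pT: "positive_invertible d (toeplitz_op d A)"
  obtains \<delta> where "\<delta> > 0" "\<And>n z. \<delta> * (\<Sum>p<n * d. (cmod (z p))\<^sup>2) \<le> hform (n * d) (toep d (entry A)) z"
proof -
  obtain \<delta> where \<delta>: "\<delta> > 0" "\<And>x. x \<in> l2 d \<Longrightarrow> \<delta> * (l2_norm x)\<^sup>2 \<le> Re (l2_inner x (toeplitz_op d A x))"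
    using positive_invertible_coercive[OF bT pT] by blast
  show ?thesis
  proof (rule that[OF \<delta>(1)])
    show "\<delta> * (\<Sum>p<n * d. (cmod (z p))\<^sup>2) \<le> hform (n * d) (toep d (entry A)) z" for n z
      using \<delta>(2)[OF fin_seq_l2[of d n z]] unfolding l2_norm_fin_seq l2_inner_toeplitz_op hform_def .
  qed
qed

text \<open>These coefficients are entries of the image of a unit sequence under the operator, and
  that image is square summable.\<close>

lemma fcoeff_decay:
  assumes bT: "bounded_op d (toeplitz_op d A)" and rs: "r < d" "s < d"
  shows "(\<lambda>i. fcoeff (entry A r s) (int i)) \<longlonglongrightarrow> 0"
proof -
  let ?e = "\<lambda>p. if p = s then 1 else 0 :: complex"
  let ?x = "toeplitz_op d A (fin_seq d 1 ?e)"
  have "?x \<in> l2 d" using bT fin_seq_l2 unfolding bounded_op_def by blast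
  then have "(\<lambda>i. vec_norm2 (?x i)) \<longlonglongrightarrow> 0" by (intro summable_LIMSEQ_zero) (simp add: l2_def)
  then have lim: "(\<lambda>i. sqrt (vec_norm2 (?x i))) \<longlonglongrightarrow> 0" using tendsto_real_sqrt by fastforce
  have "cmod (fcoeff (entry A r s) (int i)) \<le> sqrt (vec_norm2 (?x i))" for i
  proof -
    have "vec_index (?x i) r = fcoeff (entry A r s) (int i)"
      using rs by (simp add: toeplitz_op_fin_seq if_distrib[of "\<lambda>u. _ * u"] cong: if_cong)
    moreover have "(cmod (vec_index (?x i) r))\<^sup>2 \<le> vec_norm2 (?x i)"
      unfolding vec_norm2_def using rs by (intro member_le_sum) (auto simp: toeplitz_op_def)
    ultimately show ?thesis by (simp add: real_le_rsqrt)
  qed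
  then show ?thesis by (intro Lim_null_comparison[OF _ lim]) simp
qed

section \<open>Consequences of partial symmetry and positive invertibility\<close>

context
  fixes d :: nat and A :: "real \<Rightarrow> complex mat"
  assumes A: "A \<in> Linf d" and ps: "partially_symmetric d A"
    and bT: "bounded_op d (toeplitz_op d A)" and pT: "positive_invertible d (toeplitz_op d A)"
begin

lemma fcoeff_even:
  assumes "r < d" "s < d"
  shows "fcoeff (entry A r s) (- n) = fcoeff (entry A r s) n"
proof -
  have "fcoeff (entry A r s) (- int m) = fcoeff (entry A r s) (int m)" for m
    using ps assms unfolding partially_symmetric_def by (metis fourier_coeff_entry)
  from this[of "nat n"] this[of "nat (- n)"] show ?thesis by (cases "n \<ge> 0") auto
qed

lemma fcoeff_real:
  assumes "r < d" "s < d"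
  shows "cnj (fcoeff (entry A r s) n) = fcoeff (entry A r s) n"
proof -
  have "fcoeff (entry A r s) n \<in> \<real>"
    using ps assms unfolding partially_symmetric_def by (metis fourier_coeff_entry)
  then show ?thesis by (simp add: Reals_cnj_iff)
qed

lemma fcoeff_symmetric:
  assumes "r < d" "s < d"
  shows "fcoeff (entry A r s) n = fcoeff (entry A s r) n"
  using fcoeff_hermitian[OF bT pT assms, of n] fcoeff_even[OF assms(2,1), of n] fcoeff_real[OF assms(2,1), of n] by simp

text \<open>Evenness carries the decay over to negative indices, and the sum \<open>N\<close> of the
  finitely many thresholds dominates each of them.\<close>

lemma fcoeff_uniform_decay:
  assumes "e > 0"
  shows "\<exists>K. \<forall>r<d. \<forall>s<d. \<forall>n. \<bar>n\<bar> \<ge> int K \<longrightarrow> cmod (fcoeff (entry A r s) n) \<le> e"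
proof -
  have "\<exists>K. \<forall>i\<ge>K. cmod (fcoeff (entry A r s) (int i)) \<le> e" if "r < d" "s < d" for r s
    using LIMSEQ_D[OF fcoeff_decay[OF bT that] assms] by (auto intro: less_imp_le)
  then obtain K where K: "\<And>r s i. r < d \<Longrightarrow> s < d \<Longrightarrow> i \<ge> K r s \<Longrightarrow> cmod (fcoeff (entry A r s) (int i)) \<le> e"
    by metis
  define N where "N = (\<Sum>r<d. \<Sum>s<d. K r s)"
  have "cmod (fcoeff (entry A r s) n) \<le> e" if rs: "r < d" "s < d" and n: "\<bar>n\<bar> \<ge> int N" for r s n
  proof -
    have "K r s \<le> (\<Sum>s<d. K r s)" using rs by (intro member_le_sum) auto
    also have "\<dots> \<le> N" unfolding N_def using rs by (intro member_le_sum[of r _ "\<lambda>r. \<Sum>s<d. K r s"]) auto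
    finally have "K r s \<le> nat \<bar>n\<bar>" using n by linarith
    then have "cmod (fcoeff (entry A r s) (int (nat \<bar>n\<bar>))) \<le> e" by (rule K[OF rs])
    moreover have "fcoeff (entry A r s) (int (nat \<bar>n\<bar>)) = fcoeff (entry A r s) n"
      using fcoeff_even[OF rs, of n] by (cases "n \<ge> 0") auto
    ultimately show ?thesis by simp
  qed
  then show ?thesis by blast
qed

text \<open>Real even coefficients are unchanged by conjugating the function, and symmetric ones by
  exchanging row and column. The differences of the corresponding entries have zero coefficients, so
  they vanish almost everywhere.\<close>

lemma AE_real_symmetric:
  "AE \<theta> in circ. \<forall>r<d. \<forall>s<d. Im (A \<theta> $$ (r, s)) = 0 \<and> A \<theta> $$ (r, s) = A \<theta> $$ (s, r)"
proof -
  note bS = bounded_symbolD[OF entry_bounded_symbol[OF A]]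
  have "AE \<theta> in circ. Im (A \<theta> $$ (r, s)) = 0 \<and> A \<theta> $$ (r, s) = A \<theta> $$ (s, r)" if rs: "r < d" "s < d" for r s
  proof -
    obtain C C' where C: "AE \<theta> in circ. cmod (entry A r s \<theta>) \<le> C" "AE \<theta> in circ. cmod (entry A s r \<theta>) \<le> C'"
      using bS(2)[OF rs] bS(2)[OF rs(2,1)] by blast
    have scale: "(\<lambda>\<theta>. (- 1) * f \<theta>) \<in> borel_measurable circ \<and> (AE \<theta> in circ. cmod ((- 1) * f \<theta>) \<le> C)"
      if "f \<in> borel_measurable circ" "AE \<theta> in circ. cmod (f \<theta>) \<le> C" for f :: "real \<Rightarrow> complex" and C
      using that by simp
    have zero: "AE \<theta> in circ. entry A r s \<theta> + (- 1) * f \<theta> = 0"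
      if f: "f \<in> borel_measurable circ" "AE \<theta> in circ. cmod (f \<theta>) \<le> C'" and eq: "\<And>n. fcoeff f n = fcoeff (entry A r s) n"
      for f C'
    proof (rule AE_eq_zero_of_fcoeff_zero)
      show "(\<lambda>\<theta>. entry A r s \<theta> + (- 1) * f \<theta>) \<in> borel_measurable circ"
        using bS(1)[OF rs] scale[OF f] by (intro borel_measurable_add) auto
      have "AE \<theta> in circ. cmod (entry A r s \<theta> + (- 1) * f \<theta>) \<le> C + C'"
        using C(1) f(2) by eventually_elim (rule norm_triangle_mono, auto)
      then show "\<exists>C. AE \<theta> in circ. cmod (entry A r s \<theta> + (- 1) * f \<theta>) \<le> C" by blast
      have "fcoeff (\<lambda>\<theta>. entry A r s \<theta> + (- 1) * f \<theta>) n = fcoeff (entry A r s) n + fcoeff (\<lambda>\<theta>. (- 1) * f \<theta>) n" for n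
        using bS[OF rs] scale[OF f] by (intro fcoeff_add) auto
      then show "fcoeff (\<lambda>\<theta>. entry A r s \<theta> + (- 1) * f \<theta>) n = 0" for n
        unfolding fcoeff_scale eq by simp
    qed
    have 1: "AE \<theta> in circ. entry A r s \<theta> + (- 1) * entry A s r \<theta> = 0"
      by (rule zero[OF bS(1)[OF rs(2,1)] C(2)]) (rule fcoeff_symmetric[OF rs(2,1)])
    have 2: "AE \<theta> in circ. entry A r s \<theta> + (- 1) * cnj (entry A r s \<theta>) = 0"
    proof (rule zero)
      show "(\<lambda>\<theta>. cnj (entry A r s \<theta>)) \<in> borel_measurable circ" by (rule borel_measurable_cnj[OF bS(1)[OF rs]])
      show "AE \<theta> in circ. cmod (cnj (entry A r s \<theta>)) \<le> C" using C(1) by simp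
      show "fcoeff (\<lambda>\<theta>. cnj (entry A r s \<theta>)) n = fcoeff (entry A r s) n" for n
        unfolding fcoeff_cnj fcoeff_even[OF rs] by (rule fcoeff_real[OF rs])
    qed
    from 1 2 show ?thesis by eventually_elim (auto simp: entry_def complex_eq_iff)
  qed
  then have "AE \<theta> in circ. \<forall>r\<in>{..<d}. \<forall>s\<in>{..<d}. Im (A \<theta> $$ (r, s)) = 0 \<and> A \<theta> $$ (r, s) = A \<theta> $$ (s, r)"
    by (intro AE_ball_countable[THEN iffD2] ballI) auto
  then show ?thesis by eventually_elim auto
qed

text \<open>The Toeplitz criterion yields only semidefiniteness. It is therefore applied to the
  symbol minus \<delta> times the identity, whose Toeplitz forms are still nonnegative by
  coercivity; strict positivity follows.\<close>

lemma AE_symbol_spd: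
  assumes d: "d > 0"
  shows "AE \<theta> in circ. spd_mat d (map_mat Re (A \<theta>))"
proof -
  obtain \<delta> where \<delta>: "\<delta> > 0" "\<And>n z. \<delta> * (\<Sum>p<n * d. (cmod (z p))\<^sup>2) \<le> hform (n * d) (toep d (entry A)) z"
    using toeplitz_coercive[OF bT pT] by blast
  let ?K = "\<lambda>r s. if r = s then - of_real \<delta> else 0 :: complex"
  let ?H = "\<lambda>r s \<theta>. entry A r s \<theta> + ?K r s"
  note bS = entry_bounded_symbol[OF A]
  have sub: "hform n (\<lambda>p q. F p q + (if p = q then - of_real \<delta> else 0)) z = hform n F z - \<delta> * (\<Sum>p<n. (cmod (z p))\<^sup>2)" for n F z
  proof -
    have "sform n (\<lambda>p q. F p q + (if p = q then - of_real \<delta> else 0)) (\<lambda>p. cnj (z p)) z =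
        sform n F (\<lambda>p. cnj (z p)) z + (\<Sum>p<n. - of_real \<delta> * (cnj (z p) * z p))"
      unfolding sform_def distrib_right sum.distrib
      by (simp add: if_distrib[of "\<lambda>u. u * _"] mult.assoc cong: if_cong)
    moreover have "cnj (z p) * z p = of_real ((cmod (z p))\<^sup>2)" for p
      by (simp only: complex_norm_square mult.commute[of "cnj (z p)"])
    ultimately show ?thesis by (simp add: hform_def sum_negf sum_distrib_left)
  qed
  have "0 \<le> hform (n * d) (toep d ?H) z" for n z
  proof -
    have "toep d ?H = (\<lambda>p q. toep d (entry A) p q + (if p = q then - of_real \<delta> else 0))"
    proof (intro ext)
      fix p q
      have "p = q \<longleftrightarrow> p div d = q div d \<and> p mod d = q mod d" by (metis div_mult_mod_eq)
      then show "toep d ?H p q = toep d (entry A) p q + (if p = q then - of_real \<delta> else 0)"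
        unfolding toep_add_const[OF bS d] by auto
    qed
    then show ?thesis using \<delta>(2)[where n = n and z = z] by (simp add: sub)
  qed
  then have "AE \<theta> in circ. \<forall>z. 0 \<le> hform d (\<lambda>r s. ?H r s \<theta>) z"
    by (rule symbol_nonneg_of_toep_nonneg[OF bounded_symbol_add_const[OF bS]])
  moreover have "AE \<theta> in circ. A \<theta> \<in> carrier_mat d d"
    using A by (intro AE_I2) (auto simp: Linf_def)
  ultimately show ?thesis using AE_real_symmetric
  proof eventually_elim
    case (elim \<theta>)
    have car: "map_mat Re (A \<theta>) \<in> carrier_mat d d" using elim(2) by simp
    have ent: "map_mat Re (A \<theta>) $$ (p, q) = Re (A \<theta> $$ (p, q))" if "p < d" "q < d" for p q
      using elim(2) that by simp
    have "0 < sform d (\<lambda>p q. map_mat Re (A \<theta>) $$ (p, q)) x x" if x: "\<exists>p<d. x p \<noteq> 0" for x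
    proof -
      have "sform d (\<lambda>p q. map_mat Re (A \<theta>) $$ (p, q)) x x = hform d (\<lambda>r s. entry A r s \<theta>) (\<lambda>p. of_real (x p))"
        unfolding hform_def sform_def Re_sum by (intro sum.cong refl) (simp add: ent entry_def)
      moreover have "0 < (\<Sum>p<d. (cmod (of_real (x p)))\<^sup>2)"
      proof -
        obtain p where "p < d" "x p \<noteq> 0" using x by blast
        then show ?thesis by (intro sum_pos2[of _ p]) auto
      qed
      moreover have "0 \<le> hform d (\<lambda>r s. entry A r s \<theta>) (\<lambda>p. of_real (x p)) - \<delta> * (\<Sum>p<d. (cmod (of_real (x p)))\<^sup>2)"
        using elim(1) unfolding sub by blast
      ultimately show ?thesis using mult_pos_pos[OF \<delta>(1)] by force
    qed
    then show ?case unfolding spd_mat_def using car elim(3) ent by simp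
  qed
qed

lemma toep_real_entries:
  assumes "0 < d"
  shows "Im (toep d (entry A) p q) = 0" "toep d (entry A) p q = toep d (entry A) q p"
proof -
  have m: "p mod d < d" "q mod d < d" using assms by auto
  from fcoeff_real[OF m, of "int (p div d) - int (q div d)"] show "Im (toep d (entry A) p q) = 0"
    unfolding toep_def by (simp add: complex_eq_iff)
  show "toep d (entry A) p q = toep d (entry A) q p"
    unfolding toep_def
    using fcoeff_symmetric[OF m] fcoeff_even[OF m(2,1), of "int (q div d) - int (p div d)"] by simp
qed

lemma toeplitz_trunc_entry:
  assumes "0 < d" "p < n * d" "q < n * d"
  shows "map_mat Re (toeplitz_trunc d n A) $$ (p, q) = Re (toep d (entry A) p q)"
  using assms by (simp add: toeplitz_trunc_def toep_def fourier_coeff_entry)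

lemma toeplitz_trunc_spd:
  assumes d: "0 < d"
  shows "spd_mat (n * d) (map_mat Re (toeplitz_trunc d n A))"
proof -
  obtain \<delta> where \<delta>: "\<delta> > 0" "\<And>n z. \<delta> * (\<Sum>p<n * d. (cmod (z p))\<^sup>2) \<le> hform (n * d) (toep d (entry A)) z"
    using toeplitz_coercive[OF bT pT] by blast
  have "0 < sform (n * d) (\<lambda>p q. map_mat Re (toeplitz_trunc d n A) $$ (p, q)) x x" if x: "\<exists>p<n * d. x p \<noteq> 0" for x
  proof -
    have "sform (n * d) (\<lambda>p q. map_mat Re (toeplitz_trunc d n A) $$ (p, q)) x x =
        hform (n * d) (toep d (entry A)) (\<lambda>p. of_real (x p))"
      unfolding hform_def sform_def Re_sum by (intro sum.cong refl) (simp add: toeplitz_trunc_entry[OF d])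
    moreover have "0 < (\<Sum>p<n * d. (cmod (of_real (x p)))\<^sup>2)"
    proof -
      obtain p where "p < n * d" "x p \<noteq> 0" using x by blast
      then show ?thesis by (intro sum_pos2[of _ p]) auto
    qed
    ultimately show ?thesis using mult_pos_pos[OF \<delta>(1)] \<delta>(2)[where n = n and z = "\<lambda>p. of_real (x p)"] by force
  qed
  moreover have "map_mat Re (toeplitz_trunc d n A) \<in> carrier_mat (n * d) (n * d)" by (simp add: toeplitz_trunc_def)
  ultimately show ?thesis
    unfolding spd_mat_def using toeplitz_trunc_entry[OF d] toep_real_entries(2)[OF d] by metis
qed

end

subsection \<open>Limits and symplectic numerical ranges\<close>

lemma scalar_prod_sform:
  fixes B :: "'a :: comm_ring_1 mat"
  assumes "B \<in> carrier_mat n n" "u \<in> carrier_vec n" "v \<in> carrier_vec n"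
  shows "scalar_prod u (B *\<^sub>v v) = sform n (\<lambda>p q. B $$ (p, q)) (vec_index u) (vec_index v)"
  using assms
  by (auto simp: scalar_prod_def sform_def atLeast0LessThan sum_distrib_left mult_ac intro!: sum.cong)

lemma cip_sform:
  assumes "B \<in> carrier_mat n n" "u \<in> carrier_vec n" "v \<in> carrier_vec n"
  shows "cip u (B *\<^sub>v v) = sform n (\<lambda>p q. B $$ (p, q)) (\<lambda>p. cnj (vec_index u p)) (vec_index v)"
proof -
  have "B *\<^sub>v v \<in> carrier_vec n" using assms by simp
  then show ?thesis
    using assms
    by (auto simp: cip_sum[of _ n] scalar_prod_def sform_def atLeast0LessThan sum_distrib_left mult_ac intro!: sum.cong)
qed

lemma sform_of_real:
  "sform n (\<lambda>p q. of_real (F p q)) (\<lambda>p. cnj (u p)) v =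
    Complex (sform n F (\<lambda>p. Re (u p)) (\<lambda>p. Re (v p)) + sform n F (\<lambda>p. Im (u p)) (\<lambda>p. Im (v p)))
      (sform n F (\<lambda>p. Re (u p)) (\<lambda>p. Im (v p)) - sform n F (\<lambda>p. Im (u p)) (\<lambda>p. Re (v p)))"
  unfolding sform_def complex_eq_iff Re_sum Im_sum complex.sel
  by (simp add: sum.distrib[symmetric] sum_subtractf[symmetric] algebra_simps)

lemma hform_cong: "(\<And>i j. i < n \<Longrightarrow> j < n \<Longrightarrow> F i j = G i j) \<Longrightarrow> hform n F z = hform n G z"
  unfolding hform_def by (intro arg_cong[where f = Re] sform_cong) auto

lemma negdim_cong: "(\<And>i j. i < n \<Longrightarrow> j < n \<Longrightarrow> F i j = G i j) \<Longrightarrow> negdim n F m = negdim n G m"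
  unfolding negdim_def using hform_cong[of n F G] by simp

text \<open>A negative vector of the pencil gives, after normalisation, a pair with pairing 1 and
  value below \<open>c\<close>. Multiplying one member by \<open>t\<close> and dividing the other by
  \<open>t\<close> keeps the pairing and drives the value to infinity, so \<open>c\<close> is
  attained at an intermediate \<open>t\<close>.\<close>

lemma mem_symp_num_range:
  assumes B: "spd_mat (2 * m) B" and m: "1 \<le> m" and c: "0 \<le> c" and less: "symp_eig m B 1 < c"
  shows "c \<in> symp_num_range m B"
proof -
  let ?b = "sform (2 * m) (\<lambda>p q. B $$ (p, q))" and ?w = "sform (2 * m) Jf"
  have Bc: "B \<in> carrier_mat (2 * m) (2 * m)" using B by (simp add: spd_mat_def)
  have pos: "0 < ?b x x" if "\<exists>p<2 * m. x p \<noteq> 0" for x :: "nat \<Rightarrow> real"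
    using B that by (simp add: spd_mat_def)
  have "\<not> (\<forall>z. 0 \<le> hform (2 * m) (pencil B c) z)"
    using less le_symp_eig_1_iff[OF B m c] by simp
  then obtain z where "hform (2 * m) (pencil B c) z < 0" by (auto simp: not_le)
  then obtain x y where neg: "?b x x + ?b y y < 2 * c * ?w x y"
    unfolding hform_pencil by force
  have nn: "0 \<le> ?b x x" for x :: "nat \<Rightarrow> real"
  proof (cases "\<exists>p<2 * m. x p \<noteq> 0")
    case False
    then have "?b x x = ?b (\<lambda>_. 0) x" by (intro sform_cong) auto
    then show ?thesis by simp
  qed (use pos in \<open>simp add: less_imp_le\<close>)
  have "0 < 2 * c * ?w x y" using neg nn[of x] nn[of y] by linarith
  then have w: "0 < ?w x y" using c by (simp add: zero_less_mult_iff)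
  have "\<exists>p<2 * m. x p \<noteq> 0"
  proof (rule ccontr)
    assume "\<not> ?thesis"
    then have "?w x y = ?w (\<lambda>_. 0) y" by (intro sform_cong) auto
    then show False using w by simp
  qed
  then have bx: "0 < ?b x x" by (rule pos)
  define \<beta> where "\<beta> = ?b x x / ?w x y"
  define \<gamma> where "\<gamma> = ?b y y / ?w x y"
  have \<beta>: "\<beta> > 0" using bx w by (simp add: \<beta>_def)
  have \<gamma>: "\<gamma> \<ge> 0" using nn w by (simp add: \<gamma>_def)
  have lt: "(\<beta> + \<gamma>) / 2 < c"
    unfolding \<beta>_def \<gamma>_def add_divide_distrib[symmetric] using neg w by (simp add: field_simps)
  define g where "g = (\<lambda>t :: real. (t\<^sup>2 * \<beta> + \<gamma> / t\<^sup>2) / 2)"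
  \<comment> \<open>Large enough that \<open>T * \<beta>\<close> alone reaches \<open>2 * c\<close>;
    since \<open>T\<close> \<ge> 1, so does \<open>T\<^sup>2 * \<beta>\<close>.\<close>
  define T where "T = max 1 (2 * c / \<beta>)"
  have T: "T \<ge> 1" "2 * c \<le> T * \<beta>" using \<beta> by (auto simp: T_def max_def field_simps)
  have "g 1 \<le> c" using lt by (simp add: g_def)
  moreover have "c \<le> g T"
  proof -
    have "T * \<beta> \<le> T\<^sup>2 * \<beta>" using T(1) \<beta> by (intro mult_right_mono) (auto simp: power2_eq_square)
    moreover have "0 \<le> \<gamma> / T\<^sup>2" using \<gamma> by simp
    ultimately show ?thesis using T(2) by (simp add: g_def)
  qed
  moreover have "continuous_on {1..T} g"
    unfolding g_def by (intro continuous_intros) auto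
  ultimately obtain t where t: "1 \<le> t" "g t = c"
    using IVT'[of g 1 c T] T(1) by blast
  define s where "s = sqrt (?w x y)"
  have s: "s > 0" "s * s = ?w x y" using w by (auto simp: s_def)
  define u where "u = Matrix.vec (2 * m) (\<lambda>p. t / s * x p)"
  define v where "v = Matrix.vec (2 * m) (\<lambda>p. 1 / (t * s) * y p)"
  have uv: "u \<in> carrier_vec (2 * m)" "v \<in> carrier_vec (2 * m)" by (auto simp: u_def v_def)
  have "scalar_prod u (symp_J m *\<^sub>v v) = ?w (\<lambda>p. t / s * x p) (\<lambda>p. 1 / (t * s) * y p)"
    unfolding scalar_prod_sform[OF symp_J_carrier uv] by (rule sform_cong) (auto simp: symp_J_index u_def v_def)
  also have "\<dots> = 1"
    unfolding sform_scale_left sform_scale_right s(2)[symmetric] using t(1) s(1) by simp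
  finally have 1: "scalar_prod u (symp_J m *\<^sub>v v) = 1" .
  have "scalar_prod u (B *\<^sub>v u) = ?b (\<lambda>p. t / s * x p) (\<lambda>p. t / s * x p)"
    unfolding scalar_prod_sform[OF Bc uv(1,1)] by (rule sform_cong) (auto simp: u_def)
  also have "\<dots> = t\<^sup>2 * \<beta>"
    unfolding sform_scale_left sform_scale_right \<beta>_def s(2)[symmetric] by (simp add: power2_eq_square)
  finally have 2: "scalar_prod u (B *\<^sub>v u) = t\<^sup>2 * \<beta>" .
  have "scalar_prod v (B *\<^sub>v v) = ?b (\<lambda>p. 1 / (t * s) * y p) (\<lambda>p. 1 / (t * s) * y p)"
    unfolding scalar_prod_sform[OF Bc uv(2,2)] by (rule sform_cong) (auto simp: v_def)
  also have "\<dots> = \<gamma> / t\<^sup>2"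
    unfolding sform_scale_left sform_scale_right \<gamma>_def s(2)[symmetric] by (simp add: power2_eq_square)
  finally have 3: "scalar_prod v (B *\<^sub>v v) = \<gamma> / t\<^sup>2" .
  have "c = (scalar_prod u (B *\<^sub>v u) + scalar_prod v (B *\<^sub>v v)) / 2"
    unfolding 2 3 using t(2) by (simp add: g_def)
  then show ?thesis unfolding symp_num_range_def using uv 1 by blast
qed

lemma L2_sform_integrable:
  assumes H: "bounded_symbol d H" and u: "u \<in> L2 d" and v: "v \<in> L2 d"
  shows "integrable circ (\<lambda>\<theta>. sform d (\<lambda>r s. H r s \<theta>) (\<lambda>p. cnj (vec_index (u \<theta>) p)) (vec_index (v \<theta>)))"
  unfolding sform_def
proof (intro Bochner_Integration.integrable_sum)
  fix r s assume "r \<in> {..<d}" "s \<in> {..<d}"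
  then have rs: "r < d" "s < d" by auto
  obtain C where C: "AE \<theta> in circ. cmod (H r s \<theta>) \<le> C" using bounded_symbolD(2)[OF H rs] by blast
  have um: "(\<lambda>\<theta>. vec_index (u \<theta>) r) \<in> borel_measurable circ" and vm: "(\<lambda>\<theta>. vec_index (v \<theta>) s) \<in> borel_measurable circ"
    using u v rs by (auto simp: L2_def)
  have "integrable circ (\<lambda>\<theta>. \<bar>C\<bar> * (vec_norm2 (u \<theta>) + vec_norm2 (v \<theta>)))"
    using u v by (intro integrable_mult_right Bochner_Integration.integrable_add) (auto simp: L2_def)
  then show "integrable circ (\<lambda>\<theta>. H r s \<theta> * cnj (vec_index (u \<theta>) r) * vec_index (v \<theta>) s)"
  proof (rule Bochner_Integration.integrable_bound)
    show "(\<lambda>\<theta>. H r s \<theta> * cnj (vec_index (u \<theta>) r) * vec_index (v \<theta>) s) \<in> borel_measurable circ"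
      by (intro borel_measurable_times bounded_symbolD(1)[OF H rs] borel_measurable_cnj um vm)
    have "AE \<theta> in circ. u \<theta> \<in> carrier_vec d \<and> v \<theta> \<in> carrier_vec d"
      using u v by (intro AE_I2) (auto simp: L2_def)
    with C show "AE \<theta> in circ. norm (H r s \<theta> * cnj (vec_index (u \<theta>) r) * vec_index (v \<theta>) s) \<le>
        norm (\<bar>C\<bar> * (vec_norm2 (u \<theta>) + vec_norm2 (v \<theta>)))"
    proof eventually_elim
      case (elim \<theta>)
      let ?x = "cmod (vec_index (u \<theta>) r)" and ?y = "cmod (vec_index (v \<theta>) s)"
      have "?x\<^sup>2 \<le> vec_norm2 (u \<theta>)" "?y\<^sup>2 \<le> vec_norm2 (v \<theta>)"
        unfolding vec_norm2_def using elim(2) rs by (auto intro!: member_le_sum)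
      then have "?x * ?y \<le> vec_norm2 (u \<theta>) + vec_norm2 (v \<theta>)"
        using sum_squares_bound[of ?x ?y] zero_le_power2[of ?x] zero_le_power2[of ?y] by linarith
      then have "cmod (H r s \<theta>) * (?x * ?y) \<le> \<bar>C\<bar> * (vec_norm2 (u \<theta>) + vec_norm2 (v \<theta>))"
        using elim(1) by (intro mult_mono) auto
      then show ?case
        by (simp add: norm_mult mult.assoc abs_mult abs_of_nonneg add_nonneg_nonneg vec_norm2_nonneg)
    qed
  qed
qed

lemma tpoly_L2: "(\<lambda>\<theta>. Matrix.vec d (tpoly d n z \<theta>)) \<in> L2 d"
proof -
  have cont: "continuous_on S (\<lambda>\<theta>. tpoly d n z \<theta> r)" for S r
    unfolding tpoly_def by (intro continuous_intros)
  have "integrable circ (\<lambda>\<theta>. \<Sum>r<d. (cmod (tpoly d n z \<theta> r))\<^sup>2)"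
  proof (rule circ_integrable_bounded)
    show "(\<lambda>\<theta>. \<Sum>r<d. (cmod (tpoly d n z \<theta> r))\<^sup>2) \<in> borel_measurable circ"
      by (intro continuous_imp_measurable_on_sets_lebesgue continuous_intros cont) simp
    have "cmod (tpoly d n z \<theta> r) \<le> (\<Sum>j<n. cmod (z (j * d + r)))" for r \<theta>
      unfolding tpoly_def by (rule order_trans[OF norm_sum]) (simp add: norm_mult)
    then have "(\<Sum>r<d. (cmod (tpoly d n z \<theta> r))\<^sup>2) \<le> (\<Sum>r<d. (\<Sum>j<n. cmod (z (j * d + r)))\<^sup>2)" for \<theta>
      by (intro sum_mono power_mono) auto
    then show "AE \<theta> in circ. norm (\<Sum>r<d. (cmod (tpoly d n z \<theta> r))\<^sup>2) \<le> (\<Sum>r<d. (\<Sum>j<n. cmod (z (j * d + r)))\<^sup>2)"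
      by (simp add: abs_of_nonneg sum_nonneg)
  qed
  moreover have "(\<lambda>\<theta>. tpoly d n z \<theta> r) \<in> borel_measurable circ" for r
    by (intro continuous_imp_measurable_on_sets_lebesgue cont) simp
  moreover have "tpoly d n z (- pi) = tpoly d n z pi"
    unfolding tpoly_def by (intro ext sum.cong refl) (simp add: complex_eq_iff)
  ultimately show ?thesis by (simp add: L2_def vec_norm2_def)
qed

lemma const_symbol: "bounded_symbol d (\<lambda>r s \<theta>. K r s)"
  unfolding bounded_symbol_def using const_bounded by auto

section \<open>Eigenvalues and numerical ranges of the truncations\<close>

context
  fixes k :: nat and A :: "real \<Rightarrow> complex mat"
  assumes k: "1 \<le> k" and A: "A \<in> Linf (2 * k)" and ps: "partially_symmetric (2 * k) A"
    and bT: "bounded_op (2 * k) (toeplitz_op (2 * k) A)"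
    and pT: "positive_invertible (2 * k) (toeplitz_op (2 * k) A)"
begin

abbreviation (input) "trunc n \<equiv> map_mat Re (toeplitz_trunc (2 * k) n A)"

definition psymbol :: "real \<Rightarrow> nat \<Rightarrow> nat \<Rightarrow> real \<Rightarrow> complex" where
  "psymbol c r s \<theta> = entry A r s \<theta> + \<i> * of_real (c * Jf r s)"

lemma k_pos: "0 < 2 * k" using k by simp

lemma psymbol_bounded: "bounded_symbol (2 * k) (psymbol c)"
  using bounded_symbol_add_const[OF entry_bounded_symbol[OF A]] by (simp add: psymbol_def[abs_def])

lemma trunc_spd: "spd_mat (2 * (n * k)) (trunc n)"
  using toeplitz_trunc_spd[OF A ps bT pT k_pos, of n] by (simp add: mult.left_commute)

lemma pencil_trunc:
  assumes "p < 2 * (n * k)" "q < 2 * (n * k)"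
  shows "pencil (trunc n) c p q = toep (2 * k) (psymbol c) p q"
proof -
  have pq: "p < n * (2 * k)" "q < n * (2 * k)" using assms by (simp_all add: mult.left_commute)
  have "toep (2 * k) (psymbol c) p q = toep (2 * k) (entry A) p q +
      (if p div (2 * k) = q div (2 * k) then \<i> * of_real (c * Jf (p mod (2 * k)) (q mod (2 * k))) else 0)"
    using toep_add_const[OF entry_bounded_symbol[OF A] k_pos] by (simp add: psymbol_def[abs_def])
  also have "\<dots> = toep (2 * k) (entry A) p q + \<i> * of_real (c * Jf p q)"
    using Jf_div_mod[of "2 * k" p q] k_pos by simp
  also have "toep (2 * k) (entry A) p q = of_real (trunc n $$ (p, q))"
    unfolding toeplitz_trunc_entry[OF A ps bT pT k_pos pq]
    using toep_real_entries(1)[OF A ps bT pT k_pos, of p q] by (simp add: complex_eq_iff)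
  finally show ?thesis by (simp add: pencil_def)
qed

lemma trunc_eig_less_iff:
  assumes "1 \<le> m" "m \<le> n * k" "0 \<le> c"
  shows "symp_eig (n * k) (trunc n) m < c \<longleftrightarrow> negdim (n * (2 * k)) (toep (2 * k) (psymbol c)) m"
proof -
  have "symp_eig (n * k) (trunc n) m < c \<longleftrightarrow> negdim (2 * (n * k)) (pencil (trunc n) c) m"
    by (rule symp_eig_less_iff[OF trunc_spd assms])
  also have "\<dots> \<longleftrightarrow> negdim (2 * (n * k)) (toep (2 * k) (psymbol c)) m"
    by (rule negdim_cong) (rule pencil_trunc)
  finally show ?thesis by (simp add: mult.left_commute)
qed

lemma AE_symbol_eig:
  "AE \<theta> in circ. \<forall>c\<ge>0. c \<le> symp_eig k (map_mat Re (A \<theta>)) 1 \<longleftrightarrow> (\<forall>z. 0 \<le> hform (2 * k) (\<lambda>r s. psymbol c r s \<theta>) z)"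
proof -
  have "AE \<theta> in circ. A \<theta> \<in> carrier_mat (2 * k) (2 * k)"
    using A by (intro AE_I2) (auto simp: Linf_def)
  with AE_symbol_spd[OF A ps bT pT k_pos] AE_real_symmetric[OF A ps bT pT] show ?thesis
  proof eventually_elim
    case (elim \<theta>)
    have "pencil (map_mat Re (A \<theta>)) c r s = psymbol c r s \<theta>" if "r < 2 * k" "s < 2 * k" for c r s
      using elim(2,3) that by (simp add: pencil_def psymbol_def entry_def complex_eq_iff)
    then have "hform (2 * k) (pencil (map_mat Re (A \<theta>)) c) z = hform (2 * k) (\<lambda>r s. psymbol c r s \<theta>) z" for c z
      by (rule hform_cong)
    then show ?case using le_symp_eig_1_iff[OF elim(1) k] by simp
  qed
qed

text \<open>The left side is membership in the set whose supremum defines \<open>ess_inf\<close>.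
  Both sides are compared with nonnegativity of the pencil symbol, pointwise and through its
  Toeplitz forms, so the function of eigenvalues is never integrated.\<close>

lemma AE_le_symbol_eig_iff:
  assumes c: "0 \<le> c"
  shows "(AE \<theta> in circ. c \<le> symp_eig k (map_mat Re (A \<theta>)) 1) \<longleftrightarrow> (\<forall>n\<ge>1. c \<le> symp_eig (n * k) (trunc n) 1)"
proof -
  have "(AE \<theta> in circ. c \<le> symp_eig k (map_mat Re (A \<theta>)) 1) \<longleftrightarrow>
      (AE \<theta> in circ. \<forall>z. 0 \<le> hform (2 * k) (\<lambda>r s. psymbol c r s \<theta>) z)"
  proof
    assume "AE \<theta> in circ. c \<le> symp_eig k (map_mat Re (A \<theta>)) 1"
    with AE_symbol_eig show "AE \<theta> in circ. \<forall>z. 0 \<le> hform (2 * k) (\<lambda>r s. psymbol c r s \<theta>) z"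
      by eventually_elim (use c in blast)
  next
    assume "AE \<theta> in circ. \<forall>z. 0 \<le> hform (2 * k) (\<lambda>r s. psymbol c r s \<theta>) z"
    with AE_symbol_eig show "AE \<theta> in circ. c \<le> symp_eig k (map_mat Re (A \<theta>)) 1"
      by eventually_elim (use c in blast)
  qed
  also have "\<dots> \<longleftrightarrow> (\<forall>n z. 0 \<le> hform (n * (2 * k)) (toep (2 * k) (psymbol c)) z)"
    using toep_nonneg_of_symbol_nonneg[OF psymbol_bounded] symbol_nonneg_of_toep_nonneg[OF psymbol_bounded] by blast
  \<comment> \<open>For \<open>n = 0\<close> the form is an empty sum, and there is no first
    symplectic eigenvalue to speak of.\<close>
  also have "\<dots> \<longleftrightarrow> (\<forall>n\<ge>1. \<forall>z. 0 \<le> hform (n * (2 * k)) (toep (2 * k) (psymbol c)) z)"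
  proof -
    have "hform (0 * (2 * k)) F z = 0" for F z by (simp add: hform_def sform_def)
    then show ?thesis by (metis less_one not_less order_refl)
  qed
  also have "\<dots> \<longleftrightarrow> (\<forall>n\<ge>1. c \<le> symp_eig (n * k) (trunc n) 1)"
  proof -
    have "c \<le> symp_eig (n * k) (trunc n) 1 \<longleftrightarrow> (\<forall>z. 0 \<le> hform (n * (2 * k)) (toep (2 * k) (psymbol c)) z)" if "n \<ge> 1" for n
    proof -
      have "1 \<le> n * k" using that k by simp
      from trunc_eig_less_iff[OF order_refl this c] show ?thesis
        unfolding negdim_1_iff by (meson not_less)
    qed
    then show ?thesis by blast
  qed
  finally show ?thesis .
qed

definition minf :: real where
  "minf = ess_inf circ (\<lambda>\<theta>. symp_eig k (map_mat Re (A \<theta>)) 1)"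

text \<open>The essential infimum is the infimum of the first eigenvalues of the truncations. The
  supremum in \<open>ess_inf\<close> has its intended meaning because the set contains 0 and is
  bounded above by the first eigenvalue of the first truncation.\<close>

lemma minf_props:
  shows "0 \<le> minf" "\<And>n. 1 \<le> n \<Longrightarrow> minf \<le> symp_eig (n * k) (trunc n) 1"
    "\<And>c. minf < c \<Longrightarrow> \<exists>n\<ge>1. symp_eig (n * k) (trunc n) 1 < c"
    "AE \<theta> in circ. minf \<le> symp_eig k (map_mat Re (A \<theta>)) 1"
proof -
  let ?f = "\<lambda>\<theta>. symp_eig k (map_mat Re (A \<theta>)) 1"
  let ?E = "{c. AE \<theta> in circ. c \<le> ?f \<theta>}"
  have pos: "0 < symp_eig (n * k) (trunc n) 1" if "1 \<le> n" for n
    using that k by (intro symp_eig_pos[OF trunc_spd]) auto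
  have zero: "0 \<in> ?E" using AE_le_symbol_eig_iff[of 0] pos by (simp add: less_imp_le)
  have bound: "c \<le> symp_eig (n * k) (trunc n) 1" if "c \<in> ?E" "1 \<le> n" for c n
  \<comment> \<open>The equivalence covers nonnegative \<open>c\<close>; negative ones lie below the
    eigenvalues, which are positive.\<close>
  proof (cases "0 \<le> c")
    case True
    then show ?thesis using AE_le_symbol_eig_iff[of c] that by simp
  next
    case False
    then show ?thesis using pos[OF that(2)] by simp
  qed
  have bdd: "bdd_above ?E" by (rule bdd_aboveI[of _ "symp_eig (1 * k) (trunc 1) 1"]) (rule bound, auto)
  show m0: "0 \<le> minf" unfolding minf_def ess_inf_def by (rule cSup_upper[OF zero bdd])
  show le: "minf \<le> symp_eig (n * k) (trunc n) 1" if "1 \<le> n" for n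
    unfolding minf_def ess_inf_def by (rule cSup_least) (use zero bound[OF _ that] in auto)
  show "AE \<theta> in circ. minf \<le> ?f \<theta>" using AE_le_symbol_eig_iff[OF m0] le by simp
  show "\<exists>n\<ge>1. symp_eig (n * k) (trunc n) 1 < c" if "minf < c" for c
  proof (rule ccontr)
    assume "\<not> ?thesis"
    then have "\<forall>n\<ge>1. c \<le> symp_eig (n * k) (trunc n) 1" by (simp add: not_less)
    then have "c \<in> ?E" using AE_le_symbol_eig_iff[of c] that m0 by simp
    then have "c \<le> minf" unfolding minf_def ess_inf_def by (rule cSup_upper[OF _ bdd])
    then show False using that by simp
  qed
qed

lemma psymbol_decay:
  assumes "e > 0"
  shows "\<exists>K. \<forall>r<2 * k. \<forall>s<2 * k. \<forall>n. \<bar>n\<bar> \<ge> int K \<longrightarrow> cmod (fcoeff (psymbol c r s) n) \<le> e"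
proof -
  obtain K where K: "\<And>r s n. r < 2 * k \<Longrightarrow> s < 2 * k \<Longrightarrow> \<bar>n\<bar> \<ge> int K \<Longrightarrow> cmod (fcoeff (entry A r s) n) \<le> e"
    using fcoeff_uniform_decay[OF A ps bT pT assms] by meson
  \<comment> \<open>\<open>Suc K\<close> excludes the index 0, the only one at which the added
    constant contributes.\<close>
  have "cmod (fcoeff (psymbol c r s) n) \<le> e" if rs: "r < 2 * k" "s < 2 * k" and n: "\<bar>n\<bar> \<ge> int (Suc K)" for r s n
  proof -
    have "n \<noteq> 0" using n by auto
    then show ?thesis
      using K[OF rs, of n] n fcoeff_add_const[OF entry_bounded_symbol[OF A] rs, of "\<i> * of_real (c * Jf r s)" n]
      by (simp add: psymbol_def[abs_def])
  qed
  then show ?thesis by blast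
qed

lemma symp_eig_trunc_tendsto:
  assumes m: "1 \<le> m"
  shows "(\<lambda>n. symp_eig (n * k) (trunc n) m) \<longlonglongrightarrow> minf"
proof (rule order_tendstoI)
  \<comment> \<open>From \<open>n\<close> \<ge> \<open>m\<close> on the \<open>m\<close>-th
    eigenvalue exists; earlier terms of the sequence are unspecified and do not affect the
    limit.\<close>
  have mn: "m \<le> n * k" if "n \<ge> m" for n
    using that k mult_le_mono[of m n 1 k] by simp
  fix a assume a: "a < minf"
  have "a < symp_eig (n * k) (trunc n) m" if "n \<ge> m" for n
  proof -
    have "minf \<le> symp_eig (n * k) (trunc n) 1" using minf_props(2)[of n] that m by simp
    also have "\<dots> \<le> symp_eig (n * k) (trunc n) m"
      by (rule symp_eig_mono[OF trunc_spd order_refl m mn[OF that]])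
    finally show ?thesis using a by simp
  qed
  then show "\<forall>\<^sub>F n in sequentially. a < symp_eig (n * k) (trunc n) m"
    unfolding eventually_sequentially by blast
next
  have mn: "m \<le> n * k" if "n \<ge> m" for n
    using that k mult_le_mono[of m n 1 k] by simp
  fix c assume c: "minf < c"
  then have c0: "0 \<le> c" using minf_props(1) by simp
  obtain n0 where n0: "n0 \<ge> 1" "symp_eig (n0 * k) (trunc n0) 1 < c" using minf_props(3)[OF c] by blast
  have "1 \<le> n0 * k" using n0(1) k by simp
  with n0(2) obtain z where z: "hform (n0 * (2 * k)) (toep (2 * k) (psymbol c)) z < 0"
    using trunc_eig_less_iff[OF order_refl _ c0, of n0] unfolding negdim_1_iff by blast
  obtain n1 where n1: "\<And>n. n \<ge> n1 \<Longrightarrow> negdim (n * (2 * k)) (toep (2 * k) (psymbol c)) m"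
    using negdim_of_negative_vector[OF k_pos psymbol_decay z] by blast
  have "symp_eig (n * k) (trunc n) m < c" if "n \<ge> max m n1" for n
    using trunc_eig_less_iff[OF m mn c0, of n] n1[of n] that by simp
  then show "\<forall>\<^sub>F n in sequentially. symp_eig (n * k) (trunc n) m < c"
    unfolding eventually_sequentially by blast
qed

text \<open>The real vectors are read as coefficients of trigonometric polynomials. The integral
  identity for Toeplitz forms preserves the value, and also the constraint, which is the Toeplitz
  form of the constant symbol J.\<close>

lemma trunc_range_subset:
  assumes "t \<in> symp_num_range (n * k) (trunc n)"
  shows "complex_of_real t \<in> symbol_symp_num_range k A"
proof -
  let ?d = "2 * k"
  obtain u v where uv: "u \<in> carrier_vec (2 * (n * k))" "v \<in> carrier_vec (2 * (n * k))"
    and one: "scalar_prod u (symp_J (n * k) *\<^sub>v v) = 1"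
    and t: "t = (scalar_prod u (trunc n *\<^sub>v u) + scalar_prod v (trunc n *\<^sub>v v)) / 2"
    using assms unfolding symp_num_range_def by blast
  have nd: "n * ?d = 2 * (n * k)" by simp
  let ?U = "\<lambda>w :: real vec. \<lambda>\<theta>. Matrix.vec ?d (tpoly ?d n (\<lambda>p. of_real (vec_index w p)) \<theta>)"
  have Tc: "trunc n \<in> carrier_mat (2 * (n * k)) (2 * (n * k))" using trunc_spd by (simp add: spd_mat_def)
  let ?S = "\<lambda>H x y \<theta>. sform ?d (\<lambda>r s. H r s \<theta>) (\<lambda>r. cnj (tpoly ?d n (\<lambda>p. of_real (vec_index x p)) \<theta> r))
     (tpoly ?d n (\<lambda>p. of_real (vec_index y p)) \<theta>)"
  have cipA: "cip (?U x \<theta>) (A \<theta> *\<^sub>v ?U y \<theta>) = ?S (entry A) x y \<theta>" if "\<theta> \<in> {- pi..pi}" for x y \<theta>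
  proof -
    have "A \<theta> \<in> carrier_mat ?d ?d" using A that by (simp add: Linf_def)
    then show ?thesis
      by (subst cip_sform) (auto intro!: sform_cong simp: entry_def)
  qed
  have cipJ: "cip (?U x \<theta>) (map_mat complex_of_real (symp_J k) *\<^sub>v ?U y \<theta>) = ?S (\<lambda>r s \<theta>. of_real (Jf r s)) x y \<theta>" for x y \<theta>
    using symp_J_carrier[of k] by (subst cip_sform[of _ ?d]) (auto intro!: sform_cong simp: symp_J_index)
  have quad: "of_real (1 / (2 * pi)) * (LINT \<theta>|circ. ?S (entry A) x x \<theta>) = of_real (scalar_prod x (trunc n *\<^sub>v x))"
    if x: "x \<in> carrier_vec (2 * (n * k))" for x :: "real vec"
  proof -
    have "of_real (1 / (2 * pi)) * (LINT \<theta>|circ. ?S (entry A) x x \<theta>) =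
        sform (n * ?d) (toep ?d (entry A)) (\<lambda>p. cnj (of_real (vec_index x p))) (\<lambda>p. of_real (vec_index x p))"
      by (rule sform_toep[OF entry_bounded_symbol[OF A], symmetric])
    also have "\<dots> = sform (n * ?d) (\<lambda>p q. of_real (trunc n $$ (p, q))) (\<lambda>p. cnj (of_real (vec_index x p))) (\<lambda>p. of_real (vec_index x p))"
      using toep_real_entries(1)[OF A ps bT pT k_pos]
      by (intro sform_cong refl) (auto simp: toeplitz_trunc_entry[OF A ps bT pT k_pos] complex_eq_iff)
    also have "\<dots> = of_real (scalar_prod x (trunc n *\<^sub>v x))"
      unfolding sform_of_real scalar_prod_sform[OF Tc x x] nd by (simp add: complex_eq_iff)
    finally show ?thesis .
  qed
  have "of_real (1 / (2 * pi)) * (LINT \<theta>|circ. (cip (?U u \<theta>) (A \<theta> *\<^sub>v ?U u \<theta>) + cip (?U v \<theta>) (A \<theta> *\<^sub>v ?U v \<theta>)) / 2) =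
      of_real (1 / (2 * pi)) * (LINT \<theta>|circ. (?S (entry A) u u \<theta> + ?S (entry A) v v \<theta>) / 2)"
    by (intro arg_cong2[where f = "(*)"] refl Bochner_Integration.integral_cong) (simp_all add: cipA)
  also have "(LINT \<theta>|circ. (?S (entry A) u u \<theta> + ?S (entry A) v v \<theta>) / 2) =
      ((LINT \<theta>|circ. ?S (entry A) u u \<theta>) + (LINT \<theta>|circ. ?S (entry A) v v \<theta>)) / 2"
    using sform_tpoly_integrable[OF entry_bounded_symbol[OF A]] by simp
  also have "of_real (1 / (2 * pi)) * \<dots> =
      (of_real (1 / (2 * pi)) * (LINT \<theta>|circ. ?S (entry A) u u \<theta>) + of_real (1 / (2 * pi)) * (LINT \<theta>|circ. ?S (entry A) v v \<theta>)) / 2"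
    by (simp only: distrib_left times_divide_eq_right)
  also have "\<dots> = complex_of_real t"
    unfolding t quad[OF uv(1)] quad[OF uv(2)] by simp
  finally have val: "complex_of_real t = of_real (1 / (2 * pi)) *
      (LINT \<theta>|circ. (cip (?U u \<theta>) (A \<theta> *\<^sub>v ?U u \<theta>) + cip (?U v \<theta>) (A \<theta> *\<^sub>v ?U v \<theta>)) / 2)" by simp
  have "of_real (1 / (2 * pi)) * (LINT \<theta>|circ. cip (?U u \<theta>) (map_mat complex_of_real (symp_J k) *\<^sub>v ?U v \<theta>)) =
      sform (n * ?d) (toep ?d (\<lambda>r s \<theta>. of_real (Jf r s))) (\<lambda>p. cnj (of_real (vec_index u p))) (\<lambda>p. of_real (vec_index v p))"
    unfolding cipJ by (rule sform_toep[OF const_symbol, symmetric])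
  also have "\<dots> = sform (n * ?d) (\<lambda>p q. of_real (Jf p q)) (\<lambda>p. cnj (of_real (vec_index u p))) (\<lambda>p. of_real (vec_index v p))"
  proof (intro sform_cong refl)
    fix p q
    show "toep ?d (\<lambda>r s \<theta>. of_real (Jf r s)) p q = of_real (Jf p q)"
      by (subst Jf_div_mod[of ?d p q]) (use k_pos in \<open>simp_all add: toep_def fcoeff_const\<close>)
  qed
  also have "\<dots> = of_real (sform (2 * (n * k)) Jf (vec_index u) (vec_index v))"
    unfolding sform_of_real nd by (simp add: complex_eq_iff)
  also have "sform (2 * (n * k)) Jf (vec_index u) (vec_index v) = 1"
    using one unfolding scalar_prod_sform[OF symp_J_carrier uv]
    by (subst (asm) sform_cong[where G = Jf and x' = "vec_index u" and y' = "vec_index v"]) (auto simp: symp_J_index)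
  finally have con: "of_real (1 / (2 * pi)) * (LINT \<theta>|circ. cip (?U u \<theta>) (map_mat complex_of_real (symp_J k) *\<^sub>v ?U v \<theta>)) = 1"
    by simp
  show ?thesis
    unfolding symbol_symp_num_range_def mem_Collect_eq
    by (intro exI[of _ "?U u"] exI[of _ "?U v"] conjI val con tpoly_L2)
qed

text \<open>At almost every \<theta> the pencil at \<open>minf\<close> is nonnegative, which bounds
  the quadratic values below by \<open>minf\<close> times the real part of the pairing. Integrating,
  the constraint turns the right-hand side into \<open>minf\<close>.\<close>

lemma symbol_range_bound:
  assumes "\<zeta> \<in> symbol_symp_num_range k A"
  shows "\<exists>t\<ge>minf. \<zeta> = complex_of_real t"
proof -
  let ?d = "2 * k" and ?J = "map_mat complex_of_real (symp_J k)"
  obtain u v where uv: "u \<in> L2 ?d" "v \<in> L2 ?d"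
    and one: "complex_of_real (1 / (2 * pi)) * (LINT \<theta>|circ. cip (u \<theta>) (?J *\<^sub>v v \<theta>)) = 1"
    and \<zeta>: "\<zeta> = complex_of_real (1 / (2 * pi)) *
        (LINT \<theta>|circ. (cip (u \<theta>) (A \<theta> *\<^sub>v u \<theta>) + cip (v \<theta>) (A \<theta> *\<^sub>v v \<theta>)) / 2)"
    using assms unfolding symbol_symp_num_range_def by blast
  let ?S = "\<lambda>H x y \<theta>. sform ?d (\<lambda>r s. H r s \<theta>) (\<lambda>p. cnj (vec_index (x \<theta>) p)) (vec_index (y \<theta>))"
  define q where "q = (\<lambda>\<theta>. (?S (entry A) u u \<theta> + ?S (entry A) v v \<theta>) / 2)"
  define \<omega> where "\<omega> = ?S (\<lambda>r s \<theta>. of_real (Jf r s)) u v"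
  have car: "u \<theta> \<in> carrier_vec ?d" "v \<theta> \<in> carrier_vec ?d" "A \<theta> \<in> carrier_mat ?d ?d" if "\<theta> \<in> {- pi..pi}" for \<theta>
    using uv A that by (auto simp: L2_def Linf_def)
  have qeq: "(cip (u \<theta>) (A \<theta> *\<^sub>v u \<theta>) + cip (v \<theta>) (A \<theta> *\<^sub>v v \<theta>)) / 2 = q \<theta>" if "\<theta> \<in> {- pi..pi}" for \<theta>
    using car[OF that] by (simp add: q_def cip_sform entry_def)
  have \<omega>eq: "cip (u \<theta>) (?J *\<^sub>v v \<theta>) = \<omega> \<theta>" if "\<theta> \<in> {- pi..pi}" for \<theta>
    using car[OF that] symp_J_carrier[of k] unfolding \<omega>_def
    by (subst cip_sform[of _ ?d]) (auto intro!: sform_cong simp: symp_J_index)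
  have \<zeta>q: "\<zeta> = complex_of_real (1 / (2 * pi)) * (LINT \<theta>|circ. q \<theta>)"
    unfolding \<zeta> by (intro arg_cong2[where f = "(*)"] refl Bochner_Integration.integral_cong) (simp_all add: qeq)
  have "(LINT \<theta>|circ. cip (u \<theta>) (?J *\<^sub>v v \<theta>)) = (LINT \<theta>|circ. \<omega> \<theta>)"
    by (intro Bochner_Integration.integral_cong) (simp_all add: \<omega>eq)
  with one have \<omega>1: "complex_of_real (1 / (2 * pi)) * (LINT \<theta>|circ. \<omega> \<theta>) = 1" by simp
  have qi: "integrable circ q"
    unfolding q_def using L2_sform_integrable[OF entry_bounded_symbol[OF A]] uv by simp
  have \<omega>i: "integrable circ \<omega>"
    unfolding \<omega>_def by (rule L2_sform_integrable[OF const_symbol uv])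
  have AEq: "AE \<theta> in circ. Im (q \<theta>) = 0 \<and> minf * Re (\<omega> \<theta>) \<le> Re (q \<theta>)"
  proof -
    have "AE \<theta> in circ. A \<theta> \<in> carrier_mat ?d ?d" using car by (intro AE_I2) simp
    with AE_symbol_spd[OF A ps bT pT k_pos] AE_real_symmetric[OF A ps bT pT] minf_props(4) show ?thesis
    proof eventually_elim
      case (elim \<theta>)
      let ?B = "map_mat Re (A \<theta>)"
      let ?b = "sform ?d (\<lambda>p q. ?B $$ (p, q))" and ?w = "sform ?d Jf"
      let ?Ru = "\<lambda>p. Re (vec_index (u \<theta>) p)" and ?Iu = "\<lambda>p. Im (vec_index (u \<theta>) p)"
      let ?Rv = "\<lambda>p. Re (vec_index (v \<theta>) p)" and ?Iv = "\<lambda>p. Im (vec_index (v \<theta>) p)"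
      have ent: "entry A r s \<theta> = of_real (?B $$ (r, s))" if "r < ?d" "s < ?d" for r s
        using elim(2,4) that by (simp add: entry_def complex_eq_iff)
      have sym: "?b x y = ?b y x" for x y
        using elim(1) by (intro sform_swap) (simp add: spd_mat_def)
      have S: "?S (entry A) x x \<theta> = of_real (?b (\<lambda>p. Re (vec_index (x \<theta>) p)) (\<lambda>p. Re (vec_index (x \<theta>) p)) +
          ?b (\<lambda>p. Im (vec_index (x \<theta>) p)) (\<lambda>p. Im (vec_index (x \<theta>) p)))" for x
      proof -
        have "?S (entry A) x x \<theta> = sform ?d (\<lambda>r s. of_real (?B $$ (r, s))) (\<lambda>p. cnj (vec_index (x \<theta>) p)) (vec_index (x \<theta>))"
          by (intro sform_cong refl ent)
        then show ?thesis
          unfolding sform_of_real using sym[of "\<lambda>p. Re (vec_index (x \<theta>) p)" "\<lambda>p. Im (vec_index (x \<theta>) p)"]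
          by (simp add: complex_eq_iff)
      qed
      have nn: "0 \<le> hform ?d (pencil ?B minf) z" for z
        using le_symp_eig_1_iff[OF elim(1) k minf_props(1)] elim(3) by blast
      \<comment> \<open>Complex \<open>u\<close> and \<open>v\<close> are split into two real pairs,
        the real parts and the imaginary parts; the pencil inequality is used for each, and the two
        are added.\<close>
      have "0 \<le> ?b ?Ru ?Ru + ?b ?Rv ?Rv - 2 * minf * ?w ?Ru ?Rv"
        using nn[of "\<lambda>p. Complex (?Ru p) (?Rv p)"] unfolding hform_pencil by simp
      moreover have "0 \<le> ?b ?Iu ?Iu + ?b ?Iv ?Iv - 2 * minf * ?w ?Iu ?Iv"
        using nn[of "\<lambda>p. Complex (?Iu p) (?Iv p)"] unfolding hform_pencil by simp
      moreover have "Re (\<omega> \<theta>) = ?w ?Ru ?Rv + ?w ?Iu ?Iv"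
        unfolding \<omega>_def sform_of_real by simp
      ultimately show ?case
        unfolding q_def S by (simp add: algebra_simps)
    qed
  qed
  define t where "t = 1 / (2 * pi) * (LINT \<theta>|circ. Re (q \<theta>))"
  have "Im (LINT \<theta>|circ. q \<theta>) = (LINT \<theta>|circ. Im (q \<theta>))" by (rule integral_Im[OF qi, symmetric])
  also have "\<dots> = 0" by (rule integral_eq_zero_AE) (use AEq in \<open>auto elim: eventually_mono\<close>)
  finally have "(LINT \<theta>|circ. q \<theta>) = of_real (LINT \<theta>|circ. Re (q \<theta>))"
    using integral_Re[OF qi] by (simp add: complex_eq_iff)
  then have "\<zeta> = complex_of_real t" unfolding \<zeta>q t_def by simp
  moreover have "minf \<le> t"
  proof -
    have "1 / (2 * pi) * (LINT \<theta>|circ. Re (\<omega> \<theta>)) = Re (complex_of_real (1 / (2 * pi)) * (LINT \<theta>|circ. \<omega> \<theta>))"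
      using integral_Re[OF \<omega>i] by simp
    then have 1: "1 / (2 * pi) * (LINT \<theta>|circ. Re (\<omega> \<theta>)) = 1" unfolding \<omega>1 by (simp only: one_complex.sel)
    have "(LINT \<theta>|circ. minf * Re (\<omega> \<theta>)) \<le> (LINT \<theta>|circ. Re (q \<theta>))"
      by (rule integral_mono_AE) (use qi \<omega>i AEq in \<open>auto elim: eventually_mono\<close>)
    then have "1 / (2 * pi) * (LINT \<theta>|circ. minf * Re (\<omega> \<theta>)) \<le> t"
      unfolding t_def by (intro mult_left_mono) auto
    moreover have "1 / (2 * pi) * (LINT \<theta>|circ. minf * Re (\<omega> \<theta>)) = minf * (1 / (2 * pi) * (LINT \<theta>|circ. Re (\<omega> \<theta>)))"
      unfolding Bochner_Integration.integral_mult_right_zero by (rule mult.left_commute)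
    ultimately show ?thesis unfolding 1 by simp
  qed
  ultimately show ?thesis by blast
qed

text \<open>The open half-line above \<open>minf\<close> is contained in the union of the truncated
  ranges, that union in the range of the symbol, and this in the closed half-line. Whether
  \<open>minf\<close> itself is attained is left open, which is why closures are compared.\<close>

lemma closure_ranges:
  "closure (\<Union>n \<in> {1..}. complex_of_real ` symp_num_range (n * k) (trunc n)) = closure (symbol_symp_num_range k A)"
    (is "closure ?U = closure ?W")
proof
  have "?U \<subseteq> ?W" using trunc_range_subset by auto
  then show "closure ?U \<subseteq> closure ?W" by (rule closure_mono)
  have above: "complex_of_real ` {minf<..} \<subseteq> ?U"
  proof
    fix \<zeta> assume "\<zeta> \<in> complex_of_real ` {minf<..}"
    then obtain c where c: "minf < c" "\<zeta> = complex_of_real c" by auto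
    obtain n where n: "n \<ge> 1" "symp_eig (n * k) (trunc n) 1 < c" using minf_props(3)[OF c(1)] by blast
    have "c \<in> symp_num_range (n * k) (trunc n)"
      by (rule mem_symp_num_range[OF trunc_spd _ _ n(2)]) (use n(1) k c(1) minf_props(1) in auto)
    then show "\<zeta> \<in> ?U" using n(1) c(2) by auto
  qed
  have "?W \<subseteq> complex_of_real ` {minf..}" using symbol_range_bound by auto
  also have "{minf..} = closure {minf<..}" by simp
  also have "complex_of_real ` closure {minf<..} \<subseteq> closure ?U"
    by (rule image_closure_subset[OF _ closed_closure subset_trans[OF above closure_subset]])
      (intro continuous_intros)
  finally show "closure ?W \<subseteq> closure ?U" by (rule closure_minimal) simp
qed

end

theorem theorem4p3:
  fixes k :: nat and A :: "real \<Rightarrow> complex mat"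
  assumes "1 \<le> k"
    and "A \<in> Linf (2 * k)"
    and "partially_symmetric (2 * k) A"
    and "bounded_op (2 * k) (toeplitz_op (2 * k) A)"
    and "positive_invertible (2 * k) (toeplitz_op (2 * k) A)"
  shows "(\<forall>m \<ge> 1.
            (\<lambda>n. symp_eig (n * k) (real_mat (toeplitz_trunc (2 * k) n A)) m)
              \<longlonglongrightarrow> ess_inf circ (\<lambda>\<theta>. symp_eig k (real_mat (A \<theta>)) 1)) \<and>
         closure (\<Union>n \<in> {1..}. complex_of_real `
              symp_num_range (n * k) (real_mat (toeplitz_trunc (2 * k) n A)))
           = closure (symbol_symp_num_range k A)"
  using symp_eig_trunc_tendsto[OF assms] closure_ranges[OF assms] unfolding minf_def[OF assms] by blast

end
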